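(* Let $G$ be a centrally indecomposable $p$-group of genus $2$ over a field $k$. Then $G$ is isoclinic to one of the following two types of groups: (i) a central quotient of a Heisenberg group $$H=\left\{\begin{bmatrix}1&e&w\\0&1&f\\0&0&1\end{bmatrix} : e,f,w\in k[x]/(a(x)^c)\right\},\qquad a(x)\in k[x]\text{ irreducible},$$ by a subgroup $L\leq [H,H]\cong k^m$, $m=c\deg a(x)$, which is a $k$-subspace of codimension $2$; or (ii) the matrix group $$H^{\flat}=\left\{\left[\begin{array}{c|c|c} I_2 & \begin{array}{cccc} e_1&\cdots&e_m&0\\ 0&e_1&\cdots&e_m\end{array} & \begin{array}{c} w_1\\ w_2\end{array}\\ \hline & I_{m+1} & \begin{array}{c} f_0\\ \vdots\\ f_m\end{array}\\ \hline & & 1\end{array}\right] : e_i,f_j,w_\ell\in k\right\}$$ (for some positive integer $m$).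
   Context: All groups are finite. For a group $G$ of nilpotence class $2$, with $G'=[G,G]\leq Z(G)$, the commutation bimap is $\circ_G\colon G/Z(G)\times G/Z(G)\to G'$, $(xZ(G),yZ(G))\mapsto [x,y]$. For a bimap $\circ\colon U\times V\to W$, its centroid is the ring $$C(\circ)=\{(\sigma_U,\sigma_V;\sigma_W)\in \mathrm{End}(U)\times\mathrm{End}(V)\times\mathrm{End}(W): (u\sigma_U)\circ v=(u\circ v)\sigma_W=u\circ(v\sigma_V)\ \forall u,v\}.$$ A $p$-group $G$ of class $2$ has genus $2$ over a field $k$ if $C(\circ_G)\cong k$ and $G'$ has dimension $2$ as a vector space over $k$ (so $\circ_G$ is a $k$-bilinear alternating map $k^d\times k^d\to k^2$ for some $d$). A central decomposition of a group $G$ is a set $\mathcal H$ of subgroups generating $G$ such that for each $H\in\mathcal H$, $G\neq\langle\mathcal H-\{H\}\rangle$ and $[H,\langle\mathcal H-\{H\}\rangle]=1$. $G$ is centrally indecomposable if $\{G\}$ is its only central decomposition. Two groups $G,H$ are isoclinic if there are isomorphisms $f\colon G/Z(G)\to H/Z(H)$ and $\hat f\colon G'\to H'$ with $\bar x f\circ_H \bar y f=(\bar x\circ_G\bar y)\hat f$ for all $x,y\in G$. *)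

theory Defs
  imports "HOL-Algebra.Generated_Groups" "HOL-Algebra.QuotRing" "Jordan_Normal_Form.VS_Connect"
begin

hide_const (open) Polynomial.order

section \<open>Groups of class 2 and their commutation bimaps\<close>

definition p_group :: "nat \<Rightarrow> ('a, 'b) monoid_scheme \<Rightarrow> bool" where
  "p_group p G \<longleftrightarrow> group G \<and> finite (carrier G) \<and> Factorial_Ring.prime p \<and> (\<exists>n. order G = p ^ n)"

definition group_center :: "('a, 'b) monoid_scheme \<Rightarrow> 'a set" where
  "group_center G = {z \<in> carrier G. \<forall>x \<in> carrier G. z \<otimes>\<^bsub>G\<^esub> x = x \<otimes>\<^bsub>G\<^esub> z}"

text \<open>The convention is the one of \<^const>\<open>derived\<close>. In a group of class 2 it agrees with
  \<open>x\<^sup>-\<^sup>1 y\<^sup>-\<^sup>1 x y\<close>.\<close>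

definition commutator :: "('a, 'b) monoid_scheme \<Rightarrow> 'a \<Rightarrow> 'a \<Rightarrow> 'a" where
  "commutator G x y = x \<otimes>\<^bsub>G\<^esub> y \<otimes>\<^bsub>G\<^esub> inv\<^bsub>G\<^esub> x \<otimes>\<^bsub>G\<^esub> inv\<^bsub>G\<^esub> y"

definition nilpotence_class_two :: "('a, 'b) monoid_scheme \<Rightarrow> bool" where
  "nilpotence_class_two G \<longleftrightarrow>
     derived G (carrier G) \<subseteq> group_center G \<and> derived G (carrier G) \<noteq> {\<one>\<^bsub>G\<^esub>}"

abbreviation central_factor :: "('a, 'b) monoid_scheme \<Rightarrow> 'a set monoid" where
  "central_factor G \<equiv> G Mod group_center G"

abbreviation derived_group :: "('a, 'b) monoid_scheme \<Rightarrow> ('a, 'b) monoid_scheme" where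
  "derived_group G \<equiv> G\<lparr>carrier := derived G (carrier G)\<rparr>"

text \<open>For cosets \<open>A\<close>, \<open>B\<close> of the centre, \<open>[x, y]\<close> is the same for all \<open>x \<in> A\<close>, \<open>y \<in> B\<close>.\<close>

definition commutation_bimap :: "('a, 'b) monoid_scheme \<Rightarrow> 'a set \<Rightarrow> 'a set \<Rightarrow> 'a" where
  "commutation_bimap G A B = the_elem {commutator G x y | x y. x \<in> A \<and> y \<in> B}"

section \<open>Centroid and genus\<close>

definition group_End :: "('a, 'b) monoid_scheme \<Rightarrow> ('a \<Rightarrow> 'a) set" where
  "group_End A = hom A A \<inter> extensional (carrier A)"

text \<open>The abelian groups \<open>U\<close>, \<open>V\<close>, \<open>W\<close> are written multiplicatively, so the sum of two
  endomorphisms is their pointwise product. Endomorphisms act on the right: in the product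
  \<open>\<sigma>\<tau>\<close> the map \<open>\<sigma>\<close> is applied first.\<close>

definition centroid ::
  "('u, 'm) monoid_scheme \<Rightarrow> ('v, 'n) monoid_scheme \<Rightarrow> ('w, 'o) monoid_scheme \<Rightarrow>
   ('u \<Rightarrow> 'v \<Rightarrow> 'w) \<Rightarrow> (('u \<Rightarrow> 'u) \<times> ('v \<Rightarrow> 'v) \<times> ('w \<Rightarrow> 'w)) ring" where
  "centroid U V W b =
    \<lparr>carrier = {(s\<^sub>U, s\<^sub>V, s\<^sub>W). s\<^sub>U \<in> group_End U \<and> s\<^sub>V \<in> group_End V \<and> s\<^sub>W \<in> group_End W \<and>
       (\<forall>u \<in> carrier U. \<forall>v \<in> carrier V.
          b (s\<^sub>U u) v = s\<^sub>W (b u v) \<and> s\<^sub>W (b u v) = b u (s\<^sub>V v))},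
     mult = (\<lambda>(s\<^sub>U, s\<^sub>V, s\<^sub>W) (t\<^sub>U, t\<^sub>V, t\<^sub>W).
       (compose (carrier U) t\<^sub>U s\<^sub>U, compose (carrier V) t\<^sub>V s\<^sub>V, compose (carrier W) t\<^sub>W s\<^sub>W)),
     one = (\<lambda>u \<in> carrier U. u, \<lambda>v \<in> carrier V. v, \<lambda>w \<in> carrier W. w),
     zero = (\<lambda>u \<in> carrier U. \<one>\<^bsub>U\<^esub>, \<lambda>v \<in> carrier V. \<one>\<^bsub>V\<^esub>, \<lambda>w \<in> carrier W. \<one>\<^bsub>W\<^esub>),
     add = (\<lambda>(s\<^sub>U, s\<^sub>V, s\<^sub>W) (t\<^sub>U, t\<^sub>V, t\<^sub>W).
       (\<lambda>u \<in> carrier U. s\<^sub>U u \<otimes>\<^bsub>U\<^esub> t\<^sub>U u, \<lambda>v \<in> carrier V. s\<^sub>V v \<otimes>\<^bsub>V\<^esub> t\<^sub>V v,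
        \<lambda>w \<in> carrier W. s\<^sub>W w \<otimes>\<^bsub>W\<^esub> t\<^sub>W w))\<rparr>"

definition group_centroid ::
  "('a, 'b) monoid_scheme \<Rightarrow> (('a set \<Rightarrow> 'a set) \<times> ('a set \<Rightarrow> 'a set) \<times> ('a \<Rightarrow> 'a)) ring" where
  "group_centroid G =
     centroid (central_factor G) (central_factor G) (derived_group G) (commutation_bimap G)"

text \<open>An isomorphism \<open>\<phi>\<close> from \<open>K\<close> to the centroid makes \<open>G'\<close> a \<open>K\<close>-vector space; the fields
  \<^const>\<open>mult\<close> and \<^const>\<open>one\<close> of a module record carry no meaning.\<close>

definition derived_space ::
  "('a, 'b) monoid_scheme \<Rightarrow> ('k \<Rightarrow> ('a set \<Rightarrow> 'a set) \<times> ('a set \<Rightarrow> 'a set) \<times> ('a \<Rightarrow> 'a)) \<Rightarrow>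
   ('k, 'a) module" where
  "derived_space G \<phi> =
    \<lparr>carrier = derived G (carrier G), mult = undefined, one = undefined,
     zero = \<one>\<^bsub>G\<^esub>, add = mult G, smult = (\<lambda>\<alpha> w. snd (snd (\<phi> \<alpha>)) w)\<rparr>"

text \<open>A different choice of \<open>\<phi>\<close> twists the scalars by an automorphism of \<open>K\<close>, which does not change
  the dimension.\<close>

definition has_genus ::
  "nat \<Rightarrow> ('k, 'm) ring_scheme \<Rightarrow> nat \<Rightarrow> ('a, 'b) monoid_scheme \<Rightarrow> bool" where
  "has_genus p K g G \<longleftrightarrow> p_group p G \<and> nilpotence_class_two G \<and>
     (\<exists>\<phi> \<in> ring_iso K (group_centroid G). vectorspace.dim K (derived_space G \<phi>) = g)"

section \<open>Central decompositions and isoclinism\<close>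

definition central_decomposition :: "('a, 'b) monoid_scheme \<Rightarrow> 'a set set \<Rightarrow> bool" where
  "central_decomposition G \<H> \<longleftrightarrow>
     (\<forall>H \<in> \<H>. subgroup H G) \<and> generate G (\<Union>\<H>) = carrier G \<and>
     (\<forall>H \<in> \<H>. carrier G \<noteq> generate G (\<Union>(\<H> - {H})) \<and>
        (\<forall>x \<in> H. \<forall>y \<in> generate G (\<Union>(\<H> - {H})). commutator G x y = \<one>\<^bsub>G\<^esub>))"

definition centrally_indecomposable :: "('a, 'b) monoid_scheme \<Rightarrow> bool" where
  "centrally_indecomposable G \<longleftrightarrow> (\<forall>\<H>. central_decomposition G \<H> \<longleftrightarrow> \<H> = {carrier G})"

definition isoclinic :: "('a, 'b) monoid_scheme \<Rightarrow> ('c, 'd) monoid_scheme \<Rightarrow> bool" where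
  "isoclinic G H \<longleftrightarrow>
     (\<exists>f \<in> iso (central_factor G) (central_factor H). \<exists>g \<in> iso (derived_group G) (derived_group H).
        \<forall>A \<in> carrier (central_factor G). \<forall>B \<in> carrier (central_factor G).
          commutation_bimap H (f A) (f B) = g (commutation_bimap G A B))"

section \<open>Heisenberg groups over \<open>k[x]/(a(x)\<^sup>c)\<close>\<close>

definition quotient_ring :: "'k :: field poly \<Rightarrow> nat \<Rightarrow> 'k poly set ring" where
  "quotient_ring a c = class_ring Quot (PIdl\<^bsub>class_ring\<^esub> (a ^ c))"

text \<open>The library product of matrices needs entries from a type class; here the entries are from
  a ring record.\<close>

definition ring_mat_mult :: "('r, 'm) ring_scheme \<Rightarrow> 'r mat \<Rightarrow> 'r mat \<Rightarrow> 'r mat" where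
  "ring_mat_mult R A B = mat (dim_row A) (dim_col B)
     (\<lambda>(i, j). \<Oplus>\<^bsub>R\<^esub>l \<in> {0..<dim_col A}. A $$ (i, l) \<otimes>\<^bsub>R\<^esub> B $$ (l, j))"

definition heisenberg_mat :: "('r, 'm) ring_scheme \<Rightarrow> 'r \<Rightarrow> 'r \<Rightarrow> 'r \<Rightarrow> 'r mat" where
  "heisenberg_mat R e f w = mat_of_rows_list 3
     [[\<one>\<^bsub>R\<^esub>, e, w],
      [\<zero>\<^bsub>R\<^esub>, \<one>\<^bsub>R\<^esub>, f],
      [\<zero>\<^bsub>R\<^esub>, \<zero>\<^bsub>R\<^esub>, \<one>\<^bsub>R\<^esub>]]"

definition heisenberg_group :: "('r, 'm) ring_scheme \<Rightarrow> 'r mat monoid" where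
  "heisenberg_group R =
    \<lparr>carrier = {heisenberg_mat R e f w | e f w. e \<in> carrier R \<and> f \<in> carrier R \<and> w \<in> carrier R},
     mult = ring_mat_mult R, one = heisenberg_mat R \<zero>\<^bsub>R\<^esub> \<zero>\<^bsub>R\<^esub> \<zero>\<^bsub>R\<^esub>\<rparr>"

text \<open>The \<open>k\<close>-space \<open>[H, H]\<close> for \<open>R = k[x]/(a(x)\<^sup>c)\<close>: its elements have \<open>e = f = 0\<close>, the group
  operation adds the corner entries \<open>w\<close>, and a scalar \<open>\<alpha>\<close> multiplies \<open>w\<close> by the residue class of
  the constant polynomial \<open>\<alpha>\<close>.\<close>

definition heisenberg_derived_space ::
  "'k :: field poly \<Rightarrow> nat \<Rightarrow> ('k, 'k poly set mat) module" where
  "heisenberg_derived_space a c =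
    (let R = quotient_ring a c; H = heisenberg_group R in
    \<lparr>carrier = derived H (carrier H), mult = undefined, one = undefined,
     zero = \<one>\<^bsub>H\<^esub>, add = mult H,
     smult = (\<lambda>\<alpha> X. heisenberg_mat R \<zero>\<^bsub>R\<^esub> \<zero>\<^bsub>R\<^esub>
       ((PIdl\<^bsub>class_ring\<^esub> (a ^ c) +>\<^bsub>class_ring\<^esub> [:\<alpha>:]) \<otimes>\<^bsub>R\<^esub> X $$ (0, 2)))\<rparr>)"

definition has_codim ::
  "('k, 'm) ring_scheme \<Rightarrow> 'v set \<Rightarrow> ('k, 'v, 'n) module_scheme \<Rightarrow> nat \<Rightarrow> bool" where
  "has_codim K L V d \<longleftrightarrow> subspace K L V \<and>
     vectorspace.dim K V = vectorspace.dim K (V\<lparr>carrier := L\<rparr>) + d"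

section \<open>The group \<open>H\<^sup>\<flat>\<close>\<close>

text \<open>The entries are \<open>e 1, \<dots>, e m\<close>, \<open>f 0, \<dots>, f m\<close> and \<open>w 1, w 2\<close>; other values of these
  functions are ignored.\<close>

definition flat_row_block :: "nat \<Rightarrow> (nat \<Rightarrow> 'k :: field) \<Rightarrow> 'k mat" where
  "flat_row_block m e = mat 2 (m + 1) (\<lambda>(i, j).
     if i = 0 then (if j < m then e (j + 1) else 0) else (if j = 0 then 0 else e j))"

definition flat_mat ::
  "nat \<Rightarrow> (nat \<Rightarrow> 'k :: field) \<Rightarrow> (nat \<Rightarrow> 'k) \<Rightarrow> (nat \<Rightarrow> 'k) \<Rightarrow> 'k mat" where
  "flat_mat m e f w =
     four_block_mat
       (four_block_mat (1\<^sub>m 2) (flat_row_block m e) (0\<^sub>m (m + 1) 2) (1\<^sub>m (m + 1)))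
       (mat 2 1 (\<lambda>(i, _). w (i + 1)) @\<^sub>r mat (m + 1) 1 (\<lambda>(i, _). f i))
       (0\<^sub>m 1 (m + 3))
       (1\<^sub>m 1)"

definition flat_group :: "'k :: field itself \<Rightarrow> nat \<Rightarrow> 'k mat monoid" where
  "flat_group _ m =
    \<lparr>carrier = {flat_mat m e f w | e f w. True}, mult = (*), one = 1\<^sub>m (m + 4)\<rparr>"

end

theory Submission
  imports Defs "HOL-Library.Function_Algebras" "HOL-Library.Product_Plus"
begin

text \<open>The commutation bimap of \<open>G\<close> is a pair \<open>(A, B)\<close> of alternating forms on the finite \<open>k\<close>-space
  \<open>V = G/Z(G)\<close> without common radical. An orthogonal decomposition of \<open>(V, A, B)\<close> lifts to a
  central decomposition of \<open>G\<close>, so the pair is indecomposable.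

  If \<open>A - t B\<close> has no polynomial vector in its kernel, a Fitting decomposition shows that \<open>A\<close> or
  \<open>B\<close> is nondegenerate. Say \<open>A\<close> is, and write \<open>B(u, v) = A(T u, v)\<close>. Indecomposability makes \<open>V\<close> a
  primary \<open>k[T]\<close>-module, and \<open>V = k[T] e + k[T] f\<close> is hyperbolic with
  \<open>A(p e, q f) = \<lambda>(p q)\<close> and \<open>B(p e, q f) = \<lambda>(x p q)\<close> for a linear form \<open>\<lambda>\<close> on \<open>k[x]/(a\<^sup>c)\<close>: this is the
  Heisenberg group modulo the common kernel of \<open>\<lambda>\<close> and \<open>\<lambda> \<circ> x\<close>. Otherwise a polynomial kernel
  vector of least degree spans a totally isotropic Kronecker block, which has an isotropic dual
  block and splits off: this is the group \<open>H\<^sup>\<flat>\<close>.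

  All spaces are finite, so dimension counts are replaced by pigeonhole arguments and by the
  Fredholm alternative.\<close>

section \<open>Linear functionals and alternating forms\<close>

text \<open>Over a finite field a regular pencil may degenerate at every rational parameter, so a
  nondegenerate member \<open>s A + t B\<close> cannot be obtained beforehand by changing the basis
  of \<open>G'\<close>. Splitting off the part where \<open>A\<close> is nilpotent relative to
  \<open>B\<close> needs no such member, and indecomposability leaves only one of the two parts.

  The prime 2 is included, so "alternating" is never weakened to "skew". In particular every cyclic
  submodule \<open>k[T] u\<close> is totally isotropic, which is why two generators are needed; they
  become the entries \<open>e\<close> and \<open>f\<close> of the Heisenberg matrices. In these
  generators both forms depend only on the determinant \<open>p q' - p' q\<close>, which is the
  corner entry of a commutator of Heisenberg matrices.

  Isoclinism sees only the bimap. Each target group is therefore described by maps to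
  \<open>V\<close> and to \<open>k \<times> k\<close> that turn its commutator into the same pair
  \<open>(A, B)\<close>, and faithful descriptions of one bimap are compared through their
  values.\<close>

text \<open>The operation \<open>comb y t z\<close> stands for \<open>y + t z\<close>, so that no vector space structure on \<open>Y\<close> has to
  be named.\<close>

lemma functional_combination:
  fixes g :: "'i \<Rightarrow> 'y \<Rightarrow> 'k :: field" and f :: "'y \<Rightarrow> 'k" and comb :: "'y \<Rightarrow> 'k \<Rightarrow> 'y \<Rightarrow> 'y"
  assumes "finite I"
    and "\<And>y t z. y \<in> Y \<Longrightarrow> z \<in> Y \<Longrightarrow> comb y t z \<in> Y"
    and "\<And>i y t z. i \<in> I \<Longrightarrow> y \<in> Y \<Longrightarrow> z \<in> Y \<Longrightarrow> g i (comb y t z) = g i y + t * g i z"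
    and "\<And>y t z. y \<in> Y \<Longrightarrow> z \<in> Y \<Longrightarrow> f (comb y t z) = f y + t * f z"
    and "\<And>y. y \<in> Y \<Longrightarrow> (\<And>i. i \<in> I \<Longrightarrow> g i y = 0) \<Longrightarrow> f y = 0"
  shows "\<exists>c. \<forall>y\<in>Y. f y = (\<Sum>i\<in>I. c i * g i y)"
  using assms
proof (induction I arbitrary: Y rule: finite_induct)
  case empty
  then show ?case by auto
next
  case (insert i0 I Y)
  let ?Y = "{y \<in> Y. g i0 y = 0}"
  have "\<exists>c. \<forall>y\<in>?Y. f y = (\<Sum>i\<in>I. c i * g i y)"
  proof (rule insert.IH)
    fix y t z assume "y \<in> ?Y" "z \<in> ?Y"
    then show "comb y t z \<in> ?Y" using insert.prems(1)[of y z t] insert.prems(2)[of i0 y z t] by simp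
  qed (use insert.prems in blast)+
  then obtain c where c: "\<And>y. y \<in> Y \<Longrightarrow> g i0 y = 0 \<Longrightarrow> f y = (\<Sum>i\<in>I. c i * g i y)"
    by auto
  show ?case
  proof (cases "\<forall>y\<in>Y. g i0 y = 0")
    case True
    then show ?thesis using c insert.hyps by (intro exI[of _ c]) (simp)
  next
    case False
    then obtain z where z: "z \<in> Y" "g i0 z \<noteq> 0" by auto
    \<comment> \<open>\<open>h\<close> vanishes on the kernel of \<open>g i0\<close>, so it is a
      multiple of \<open>g i0\<close>; the factor is read off at \<open>z\<close>. The shift of
      \<open>y\<close> along \<open>z\<close> below lands in that kernel.\<close>
    define h where "h y = f y - (\<Sum>i\<in>I. c i * g i y)" for y
    have "f y = (\<Sum>i\<in>insert i0 I. (c(i0 := h z / g i0 z)) i * g i y)" if y: "y \<in> Y" for y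
    proof -
      let ?t = "- (g i0 y / g i0 z)"
      have Y': "comb y ?t z \<in> Y" using insert.prems y z by blast
      have "g i0 (comb y ?t z) = 0" using insert.prems(2)[of i0 y z ?t] y z by simp
      then have "f (comb y ?t z) = (\<Sum>i\<in>I. c i * g i (comb y ?t z))" using c Y' by blast
      moreover have "f (comb y ?t z) = f y + ?t * f z" using insert.prems y z by blast
      moreover have "(\<Sum>i\<in>I. c i * g i (comb y ?t z)) = (\<Sum>i\<in>I. c i * (g i y + ?t * g i z))"
        using insert.prems(2) y z by (intro sum.cong) auto
      ultimately have "f y + ?t * f z = (\<Sum>i\<in>I. c i * g i y) + ?t * (\<Sum>i\<in>I. c i * g i z)"
        by (simp only: sum_distrib_left sum.distrib distrib_left mult.left_commute)
      then have "f y = (\<Sum>i\<in>I. c i * g i y) + h z / g i0 z * g i0 y"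
        unfolding h_def by (simp add: diff_divide_distrib algebra_simps)
      moreover have "(\<Sum>i\<in>I. (c(i0 := h z / g i0 z)) i * g i y) = (\<Sum>i\<in>I. c i * g i y)"
        using insert.hyps by (intro sum.cong) auto
      ultimately show ?thesis using insert.hyps by simp
    qed
    then show ?thesis by blast
  qed
qed

text \<open>The axiom \<open>A x x = 0\<close> is stronger than skew symmetry in characteristic 2,
  and the isotropy arguments rely on it.\<close>

locale alternating_form = vector_space scale
  for scale :: "'k :: field \<Rightarrow> 'v :: ab_group_add \<Rightarrow> 'v" (infixr \<open>*s\<close> 75) +
  fixes A :: "'v \<Rightarrow> 'v \<Rightarrow> 'k"
  assumes add_left: "A (x + y) z = A x z + A y z"
    and add_right: "A x (y + z) = A x y + A x z"
    and scale_left: "A (c *s x) y = c * A x y"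
    and scale_right: "A x (c *s y) = c * A x y"
    and alternating: "A x x = 0"
begin

lemma skew: "A y x = - A x y"
proof -
  have "0 = A (x + y) (x + y)" by (simp only: alternating)
  also have "\<dots> = A x y + A y x" by (simp only: add_left add_right) (simp add: alternating)
  finally show ?thesis by (metis add.commute eq_neg_iff_add_eq_0)
qed

lemma zero_left: "A 0 y = 0" using scale_left[of 0 0 y] by simp
lemma zero_right: "A y 0 = 0" using scale_right[of y 0 0] by simp
lemma minus_left: "A (- x) y = - A x y" using scale_left[of "-1" x y] by simp
lemma minus_right: "A x (- y) = - A x y" using scale_right[of x "-1" y] by simp
lemma diff_left: "A (x - y) z = A x z - A y z" using add_left[of x "- y" z] minus_left by simp
lemma diff_right: "A x (y - z) = A x y - A x z" using add_right[of x y "- z"] minus_right by simp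
lemma sum_left: "A (\<Sum>i\<in>I. f i) y = (\<Sum>i\<in>I. A (f i) y)"
  by (induction I rule: infinite_finite_induct) (auto simp: zero_left add_left)
lemma sum_right: "A y (\<Sum>i\<in>I. f i) = (\<Sum>i\<in>I. A y (f i))"
  by (induction I rule: infinite_finite_induct) (auto simp: zero_right add_right)

lemmas bilinear = zero_left zero_right minus_left minus_right diff_left diff_right add_left add_right
  scale_left scale_right sum_left sum_right

text \<open>Fredholm alternative. As \<open>X\<close> is a finite set, the functionals
  \<open>A x\<close> with \<open>x\<close> in \<open>X\<close> form a finite family; the resulting
  coefficients are collected in one vector of \<open>X\<close> by bilinearity.\<close>

lemma represent_functional:
  assumes X: "subspace X" "finite X" and Y: "subspace Y"
    and f: "\<And>y z t. y \<in> Y \<Longrightarrow> z \<in> Y \<Longrightarrow> f (y + t *s z) = f y + t * f z"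
    and v: "\<And>y. y \<in> Y \<Longrightarrow> (\<And>x. x \<in> X \<Longrightarrow> A x y = 0) \<Longrightarrow> f y = 0"
  shows "\<exists>x\<in>X. \<forall>y\<in>Y. f y = A x y"
proof -
  have "\<exists>c. \<forall>y\<in>Y. f y = (\<Sum>x\<in>X. c x * A x y)"
    by (rule functional_combination[where comb = "\<lambda>y t z. y + t *s z"])
      (use assms in \<open>auto simp: bilinear subspace_add subspace_scale\<close>)
  then obtain c where "\<And>y. y \<in> Y \<Longrightarrow> f y = (\<Sum>x\<in>X. c x * A x y)" by auto
  then have "\<forall>y\<in>Y. f y = A (\<Sum>x\<in>X. c x *s x) y" by (simp add: bilinear)
  moreover have "(\<Sum>x\<in>X. c x *s x) \<in> X" using X by (intro subspace_sum subspace_scale)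
  ultimately show ?thesis by blast
qed

end

text \<open>The forms live on the whole type, while nondegeneracy and indecomposability concern
  \<open>V\<close> only. Indecomposability is tested on decompositions orthogonal for both forms at
  once, because these are the ones that come from central decompositions.\<close>

locale indecomposable_pencil = vector_space scale + A: alternating_form scale A + B: alternating_form scale B
  for scale :: "'k :: field \<Rightarrow> 'v :: ab_group_add \<Rightarrow> 'v" (infixr \<open>*s\<close> 75)
    and A B :: "'v \<Rightarrow> 'v \<Rightarrow> 'k" +
  fixes V :: "'v set"
  assumes subspace_V: "subspace V" and finite_V: "finite V"
    and nondegenerate: "x \<in> V \<Longrightarrow> (\<And>y. y \<in> V \<Longrightarrow> A x y = 0) \<Longrightarrow> (\<And>y. y \<in> V \<Longrightarrow> B x y = 0) \<Longrightarrow> x = 0"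
    and indecomposable:
      "subspace X \<Longrightarrow> subspace Y \<Longrightarrow> X \<subseteq> V \<Longrightarrow> Y \<subseteq> V \<Longrightarrow> X \<inter> Y = {0} \<Longrightarrow>
       (\<And>v. v \<in> V \<Longrightarrow> \<exists>x\<in>X. \<exists>y\<in>Y. v = x + y) \<Longrightarrow>
       (\<And>x y. x \<in> X \<Longrightarrow> y \<in> Y \<Longrightarrow> A x y = 0 \<and> B x y = 0) \<Longrightarrow> X = {0} \<or> Y = {0}"
begin

lemma swap: "indecomposable_pencil scale B A V"
proof unfold_locales
  show "\<And>x. x \<in> V \<Longrightarrow> (\<And>y. y \<in> V \<Longrightarrow> B x y = 0) \<Longrightarrow> (\<And>y. y \<in> V \<Longrightarrow> A x y = 0) \<Longrightarrow> x = 0"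
    by (rule nondegenerate)
  show "X = {0} \<or> Y = {0}"
    if "subspace X" "subspace Y" "X \<subseteq> V" "Y \<subseteq> V" "X \<inter> Y = {0}"
      "\<And>v. v \<in> V \<Longrightarrow> \<exists>x\<in>X. \<exists>y\<in>Y. v = x + y"
      "\<And>x y. x \<in> X \<Longrightarrow> y \<in> Y \<Longrightarrow> B x y = 0 \<and> A x y = 0" for X Y
    using that(1-6) by (rule indecomposable) (use that(7) in blast)+
qed (rule subspace_V finite_V)+

lemma V_closed [simp, intro]:
  "0 \<in> V" "x \<in> V \<Longrightarrow> y \<in> V \<Longrightarrow> x + y \<in> V" "x \<in> V \<Longrightarrow> y \<in> V \<Longrightarrow> x - y \<in> V"
  "x \<in> V \<Longrightarrow> c *s x \<in> V" "x \<in> V \<Longrightarrow> - x \<in> V" "(\<And>i. i \<in> I \<Longrightarrow> f i \<in> V) \<Longrightarrow> (\<Sum>i\<in>I. f i) \<in> V"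
  using subspace_V
  by (simp_all add: subspace_0 subspace_add subspace_diff subspace_scale subspace_neg subspace_sum)

end

section \<open>Fitting decomposition of a pencil without polynomial kernel vectors\<close>

context indecomposable_pencil
begin

text \<open>A kernel chain is a power series \<open>v(t) = \<Sum> v\<^sub>i t\<^sup>i\<close> in the kernel of \<open>A - t B\<close>.\<close>

definition kernel_chain :: "(nat \<Rightarrow> 'v) \<Rightarrow> bool" where
  "kernel_chain v \<longleftrightarrow> (\<forall>i. v i \<in> V) \<and> (\<forall>z\<in>V. A (v 0) z = 0) \<and>
     (\<forall>i. \<forall>z\<in>V. B (v i) z = A (v (Suc i)) z)"

text \<open>The relation "\<open>A x = B y\<close> on \<open>V\<close>" stands in for the map
  \<open>B^-1 A\<close>, which may fail to exist or to be single valued. A descending chain is an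
  orbit of this relation that has reached 0 after \<open>n\<close> steps.\<close>

definition descending_chain :: "nat \<Rightarrow> (nat \<Rightarrow> 'v) \<Rightarrow> bool" where
  "descending_chain n v \<longleftrightarrow> (\<forall>i. v i \<in> V) \<and> (\<forall>i\<ge>n. v i = 0) \<and>
     (\<forall>i. \<forall>z\<in>V. A (v i) z = B (v (Suc i)) z)"

text \<open>The Fitting null space of the relation: the vectors with some orbit that ends in
  0.\<close>

definition nilpotent_part :: "'v set" where
  "nilpotent_part = {v 0 | v. \<exists>n. descending_chain n v}"

lemma nilpotent_partI: "descending_chain n v \<Longrightarrow> v i \<in> nilpotent_part"
proof -
  assume "descending_chain n v"
  then have "descending_chain n (\<lambda>j. v (i + j))" unfolding descending_chain_def by simp
  then show ?thesis unfolding nilpotent_part_def by (intro CollectI exI[of _ "\<lambda>j. v (i + j)"]) auto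
qed

text \<open>A chain may be prolonged at its start. With \<open>y = 0\<close> this puts the whole
  radical of \<open>A\<close> into the nilpotent part.\<close>

lemma nilpotent_part_predecessor:
  assumes "y \<in> nilpotent_part" "x \<in> V" "\<And>z. z \<in> V \<Longrightarrow> A x z = B y z"
  shows "x \<in> nilpotent_part"
proof -
  obtain n v where v: "descending_chain n v" "y = v 0" using assms(1) unfolding nilpotent_part_def by auto
  have "descending_chain (Suc n) (case_nat x v)"
    using v assms unfolding descending_chain_def by (auto split: nat.split)
  from nilpotent_partI[OF this, of 0] show ?thesis by simp
qed

lemma nilpotent_part_subset: "nilpotent_part \<subseteq> V"
  unfolding nilpotent_part_def descending_chain_def by auto

lemma subspace_nilpotent_part: "subspace nilpotent_part"
proof (rule subspaceI)
  show "0 \<in> nilpotent_part"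
    using nilpotent_partI[of 0 "\<lambda>_. 0" 0] by (simp add: descending_chain_def A.bilinear B.bilinear)
next
  fix x y assume "x \<in> nilpotent_part" "y \<in> nilpotent_part"
  then obtain n v m w where "descending_chain n v" "x = v 0" "descending_chain m w" "y = w 0"
    unfolding nilpotent_part_def by auto
  moreover from this have "descending_chain (max n m) (\<lambda>i. v i + w i)"
    unfolding descending_chain_def by (auto simp: A.bilinear B.bilinear)
  ultimately show "x + y \<in> nilpotent_part" using nilpotent_partI[of _ "\<lambda>i. v i + w i" 0] by simp
next
  fix c x assume "x \<in> nilpotent_part"
  then obtain n v where "descending_chain n v" "x = v 0"
    unfolding nilpotent_part_def by auto
  moreover from this have "descending_chain n (\<lambda>i. c *s v i)"
    unfolding descending_chain_def by (auto simp: A.bilinear B.bilinear)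
  ultimately show "c *s x \<in> nilpotent_part" using nilpotent_partI[of _ "\<lambda>i. c *s v i" 0] by simp
qed

lemma nilpotent_part_image:
  assumes "x \<in> nilpotent_part"
  shows "\<exists>y\<in>nilpotent_part. \<forall>z\<in>V. A x z = B y z"
proof -
  obtain n v where v: "descending_chain n v" "x = v 0" using assms unfolding nilpotent_part_def by auto
  then show ?thesis using nilpotent_partI[OF v(1), of "Suc 0"]
    by (intro bexI[of _ "v (Suc 0)"]) (auto simp: descending_chain_def)
qed

text \<open>A descending chain read backwards satisfies the relations of a kernel chain: its last
  term is killed by \<open>A\<close>, and it stops at \<open>x\<close> because \<open>B x\<close>
  vanishes.\<close>

lemma singular_if_B_kernel:
  assumes "x \<in> nilpotent_part" "x \<noteq> 0" "\<And>z. z \<in> V \<Longrightarrow> B x z = 0"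
  shows "\<exists>v n. kernel_chain v \<and> (\<forall>i\<ge>n. v i = 0) \<and> (\<exists>i. v i \<noteq> 0)"
proof -
  obtain n v where v: "descending_chain n v" "x = v 0" using assms(1) unfolding nilpotent_part_def by auto
  define w where "w i = (if i < n then v (n - Suc i) else 0)" for i
  have n: "n > 0" using v assms(2) by (cases n) (auto simp: descending_chain_def)
  have V: "v i \<in> V" for i using v by (simp add: descending_chain_def)
  have vn: "v n = 0" using v by (simp add: descending_chain_def)
  have rel: "A (v i) z = B (v (Suc i)) z" if "z \<in> V" for i z
    using v that by (simp add: descending_chain_def)
  have "kernel_chain w" unfolding kernel_chain_def
  proof (intro conjI allI ballI)
    show "w i \<in> V" for i using V by (simp add: w_def)
    show "A (w 0) z = 0" if "z \<in> V" for z
      using rel[OF that, of "n - Suc 0"] n vn by (simp add: w_def B.bilinear)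
    show "B (w i) z = A (w (Suc i)) z" if z: "z \<in> V" for i z
    proof -
      consider "Suc i < n" | "Suc i = n" | "i \<ge> n" by linarith
      then show ?thesis
      proof cases
        case 1
        then have "n - Suc i = Suc (n - Suc (Suc i))" by simp
        then show ?thesis using rel[OF z, of "n - Suc (Suc i)"] 1 by (simp add: w_def)
      next
        case 2
        then show ?thesis using assms(3)[OF z] v by (auto simp: w_def A.bilinear)
      qed (simp add: w_def A.bilinear B.bilinear)
    qed
  qed
  moreover have "w (n - Suc 0) \<noteq> 0" using n v assms(2) by (simp add: w_def)
  moreover have "\<forall>i\<ge>n. w i = 0" by (simp add: w_def)
  ultimately show ?thesis by blast
qed

text \<open>The Fitting complement, defined as an orthogonal complement instead of an iterated
  image; that the relation can be run inside it is proved afterwards.\<close>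

definition stable_part :: "'v set" where
  "stable_part = {p \<in> V. \<forall>x\<in>nilpotent_part. B x p = 0}"

lemma subspace_stable_part: "subspace stable_part"
  by (rule subspaceI) (auto simp: stable_part_def B.bilinear)

text \<open>\<open>A x\<close> equals \<open>B y\<close> for some \<open>y\<close> that is again in
  the nilpotent part, so orthogonality for \<open>B\<close> carries over to
  \<open>A\<close>.\<close>

lemma stable_part_A:
  assumes "x \<in> nilpotent_part" "p \<in> stable_part"
  shows "A x p = 0"
  using nilpotent_part_image[OF assms(1)] assms(2) unfolding stable_part_def by auto

text \<open>Two Fredholm alternatives. If \<open>z\<close> is \<open>A\<close>-orthogonal to the
  stable part, then \<open>A z\<close> vanishes on everything \<open>B\<close>-orthogonal to the
  nilpotent part, so \<open>A z = B x\<close> with \<open>x\<close> nilpotent. Hence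
  \<open>z\<close> is nilpotent too, and \<open>B p z = 0\<close>.\<close>

lemma stable_part_image:
  assumes "p \<in> stable_part"
  shows "\<exists>p'\<in>stable_part. \<forall>z\<in>V. B p z = A p' z"
proof (rule A.represent_functional)
  show "finite stable_part" using finite_V by (simp add: stable_part_def)
  fix z assume z: "z \<in> V" "\<And>x. x \<in> stable_part \<Longrightarrow> A x z = 0"
  have "\<exists>x\<in>nilpotent_part. \<forall>y\<in>V. A z y = B x y"
  proof (rule B.represent_functional)
    show "finite nilpotent_part" using finite_V nilpotent_part_subset by (rule finite_subset[rotated])
    fix y assume "y \<in> V" "\<And>x. x \<in> nilpotent_part \<Longrightarrow> B x y = 0"
    then have "y \<in> stable_part" by (simp add: stable_part_def)
    then show "A z y = 0" using z(2) A.skew[of z y] by simp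
  qed (auto simp: subspace_nilpotent_part subspace_V A.bilinear)
  then have "z \<in> nilpotent_part" using nilpotent_part_predecessor z(1) by blast
  then show "B p z = 0" using assms B.skew[of z p] by (simp add: stable_part_def)
qed (auto simp: subspace_stable_part subspace_V B.bilinear)

text \<open>The relation can be solved forever inside the stable part, so \<open>q\<close> starts an
  infinite kernel chain. By finiteness it repeats, and a multiplier of the form
  \<open>1 - t^m\<close> turns it into a polynomial whose constant term is still
  \<open>q\<close>.\<close>

lemma singular_if_stable_kernel:
  assumes q: "q \<in> stable_part" "q \<noteq> 0" "\<And>z. z \<in> V \<Longrightarrow> A q z = 0"
  shows "\<exists>v n. kernel_chain v \<and> (\<forall>i\<ge>n. v i = 0) \<and> (\<exists>i. v i \<noteq> 0)"
proof -
  obtain h where h: "\<And>p. p \<in> stable_part \<Longrightarrow> h p \<in> stable_part \<and> (\<forall>z\<in>V. B p z = A (h p) z)"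
    using stable_part_image by metis
  define u where "u i = (h ^^ i) q" for i
  have u: "u i \<in> stable_part" for i by (induction i) (use q h in \<open>auto simp: u_def\<close>)
  have uV: "u i \<in> V" for i using u by (simp add: stable_part_def)
  have rel: "B (u i) z = A (u (Suc i)) z" if "z \<in> V" for i z
    using h[OF u[of i]] that by (simp add: u_def)
  have "\<not> inj u" using uV finite_V by (meson finite_imageD finite_subset image_subsetI infinite_UNIV_nat)
  then obtain i m where im: "u i = u (i + m)" "m > 0"
    by (metis injI less_imp_add_positive linorder_neqE_nat)
  have per: "u (i + k) = u (i + m + k)" for k
    using im by (simp add: u_def funpow_add funpow_add[of k] add.commute[of _ k])
  text \<open>Since \<open>u\<close> is eventually periodic, \<open>(1 - t\<^sup>m) u(t)\<close> is a polynomial.\<close>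
  define w where "w j = (if j < m then u j else u j - u (j - m))" for j
  have "kernel_chain w" unfolding kernel_chain_def
  proof (intro conjI allI ballI)
    show "w j \<in> V" for j using uV by (simp add: w_def)
    show "A (w 0) z = 0" if "z \<in> V" for z using im(2) q(3)[OF that] by (simp add: w_def u_def)
    show "B (w j) z = A (w (Suc j)) z" if z: "z \<in> V" for j z
    proof -
      consider "Suc j < m" | "Suc j = m" | "j \<ge> m" by linarith
      then show ?thesis
      proof cases
        case 2
        then show ?thesis using rel[OF z, of j] q(3)[OF z] by (auto simp: w_def A.bilinear u_def)
      qed (use rel[OF z] in \<open>auto simp: w_def A.bilinear B.bilinear Suc_diff_le\<close>)
    qed
  qed
  moreover have "w j = 0" if "j \<ge> i + m" for j
    using per[of "j - i - m"] that by (simp add: w_def algebra_simps)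
  moreover have "w 0 \<noteq> 0" using im(2) q(2) by (simp add: w_def u_def)
  ultimately show ?thesis by blast
qed

theorem regular_or_singular:
  assumes "\<And>v n. kernel_chain v \<Longrightarrow> (\<forall>i\<ge>n. v i = 0) \<Longrightarrow> \<forall>i. v i = 0"
  shows "(\<forall>x\<in>V. (\<forall>z\<in>V. A x z = 0) \<longrightarrow> x = 0) \<or> (\<forall>x\<in>V. (\<forall>z\<in>V. B x z = 0) \<longrightarrow> x = 0)"
proof -
  let ?N = nilpotent_part and ?P = stable_part
  have injB: "x = 0" if "x \<in> ?N" "\<And>z. z \<in> V \<Longrightarrow> B x z = 0" for x
    using singular_if_B_kernel[OF that(1) _ that(2)] assms by blast
  have NP: "q = 0" if q: "q \<in> ?N" "q \<in> ?P" for q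
  proof (rule ccontr)
    assume "q \<noteq> 0"
    obtain n v where v: "descending_chain n v" "q = v 0" using q(1) unfolding nilpotent_part_def by auto
    \<comment> \<open>The descending chain of a vector in both parts never leaves the stable part,
      so its last nonzero term is a kernel vector of \<open>A\<close> there.\<close>
    have vP: "v i \<in> ?P" for i
    proof (induction i)
      case (Suc i)
      have "B x (v (Suc i)) = 0" if x: "x \<in> ?N" for x
      proof -
        have xV: "x \<in> V" using x nilpotent_part_subset by blast
        have "B x (v (Suc i)) = - B (v (Suc i)) x" by (rule B.skew)
        also have "B (v (Suc i)) x = A (v i) x" using v xV by (simp add: descending_chain_def)
        also have "\<dots> = - A x (v i)" by (rule A.skew)
        also have "A x (v i) = 0" using stable_part_A x Suc by blast
        finally show ?thesis by simp
      qed
      then show ?case using v by (auto simp: stable_part_def descending_chain_def)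
    qed (use q v in simp)
    let ?l = "GREATEST i. v i \<noteq> 0"
    have bound: "\<forall>i. v i \<noteq> 0 \<longrightarrow> i \<le> n" using v by (auto simp: descending_chain_def) (meson nat_le_linear)
    have l: "v ?l \<noteq> 0" by (rule GreatestI_nat[where k = 0 and b = n]) (use bound v \<open>q \<noteq> 0\<close> in auto)
    have "v (Suc ?l) = 0" using Greatest_le_nat[of "\<lambda>i. v i \<noteq> 0" "Suc ?l" n] bound by fastforce
    then have "A (v ?l) z = 0" if "z \<in> V" for z
      using v that by (simp add: descending_chain_def B.bilinear)
    then show False using singular_if_stable_kernel[OF vP l] assms by blast
  qed
  have "?N = {0} \<or> ?P = {0}"
  proof (rule indecomposable)
    show "?N \<inter> ?P = {0}" using NP subspace_0 subspace_nilpotent_part subspace_stable_part by blast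
    fix w assume w: "w \<in> V"
    \<comment> \<open>Projection of \<open>w\<close> to the nilpotent part along \<open>B\<close>.
      It exists because \<open>B\<close> is nondegenerate on that part, its radical being contained
      in the intersection of the two parts.\<close>
    have "\<exists>x\<in>?N. \<forall>y\<in>?N. B w y = B x y"
    proof (rule B.represent_functional)
      show "finite ?N" using finite_V nilpotent_part_subset by (rule finite_subset[rotated])
      fix y assume y: "y \<in> ?N" "\<And>x. x \<in> ?N \<Longrightarrow> B x y = 0"
      then have "y \<in> ?P" using nilpotent_part_subset by (auto simp: stable_part_def)
      then have "y = 0" using NP y(1) by blast
      then show "B w y = 0" by (simp add: B.bilinear)
    qed (auto simp: subspace_nilpotent_part B.bilinear)
    then obtain x where x: "x \<in> ?N" "\<And>y. y \<in> ?N \<Longrightarrow> B w y = B x y" by blast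
    have "B y (w - x) = 0" if "y \<in> ?N" for y
      using x(2)[OF that] by (simp add: B.bilinear B.skew[of w y] B.skew[of x y])
    then have "w - x \<in> ?P" using x(1) w nilpotent_part_subset by (auto simp: stable_part_def)
    then show "\<exists>x\<in>?N. \<exists>y\<in>?P. w = x + y" using x(1) by (metis add_diff_cancel_left' diff_add_cancel add.commute)
  qed (use nilpotent_part_subset subspace_nilpotent_part subspace_stable_part stable_part_A
      in \<open>auto simp: stable_part_def\<close>)
  then show ?thesis
  proof
    \<comment> \<open>The radical of \<open>A\<close> lies in the nilpotent part, and that of
      \<open>B\<close> in the stable part. Whichever part vanishes, one form is
      nondegenerate.\<close>
    assume N: "?N = {0}"
    have "x = 0" if "x \<in> V" "\<And>z. z \<in> V \<Longrightarrow> A x z = 0" for x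
      using nilpotent_part_predecessor[of 0 x] that N by (auto simp: B.bilinear)
    then show ?thesis by blast
  next
    assume P: "?P = {0}"
    have "x = 0" if "x \<in> V" "\<And>z. z \<in> V \<Longrightarrow> B x z = 0" for x
    proof -
      have "x \<in> ?P" using that nilpotent_part_subset B.skew[of x] by (auto simp: stable_part_def)
      then show ?thesis using P by blast
    qed
    then show ?thesis by blast
  qed
qed

end

section \<open>Regular pencils\<close>

lemma power_decomposition:
  fixes p a :: "'k :: field poly"
  assumes "p \<noteq> 0" "\<not> is_unit a"
  shows "\<exists>j q. p = a ^ j * q \<and> \<not> a dvd q"
  using assms(1)
proof (induction "degree p" arbitrary: p rule: less_induct)
  case less
  show ?case
  proof (cases "a dvd p")
    case True
    then obtain q where q: "p = a * q" by blast
    then have "a \<noteq> 0" "q \<noteq> 0" using less.prems by auto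
    then have "degree q < degree p"
      using assms(2) q by (simp add: degree_mult_eq is_unit_iff_degree)
    then obtain j q' where "q = a ^ j * q'" "\<not> a dvd q'" using less.hyps \<open>q \<noteq> 0\<close> by blast
    then show ?thesis using q by (intro exI[of _ "Suc j"] exI[of _ q']) (simp add: mult.assoc)
  qed (metis mult_1 power_0)
qed

locale regular_pencil = indecomposable_pencil +
  assumes A_nondegenerate: "x \<in> V \<Longrightarrow> (\<And>z. z \<in> V \<Longrightarrow> A x z = 0) \<Longrightarrow> x = 0"
    and nontrivial: "V \<noteq> {0}"
begin

section \<open>The self-adjoint operator T and the module structure over k[x]\<close>

text \<open>The representing vector exists for every \<open>u\<close> of the type, inside or outside
  \<open>V\<close>. So \<open>T u\<close> lies in \<open>V\<close> unconditionally, and linearity of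
  \<open>T\<close> needs no membership assumptions.\<close>

definition T :: "'b \<Rightarrow> 'b" where
  "T u = (SOME w. w \<in> V \<and> (\<forall>z\<in>V. B u z = A w z))"

lemma T_props: "T u \<in> V \<and> (\<forall>z\<in>V. B u z = A (T u) z)"
  unfolding T_def
proof (rule someI_ex)
  have "\<exists>w\<in>V. \<forall>z\<in>V. B u z = A w z"
  proof (rule A.represent_functional)
    fix y assume "y \<in> V" "\<And>x. x \<in> V \<Longrightarrow> A x y = 0"
    then have "y = 0" using A_nondegenerate A.skew[of y] by simp
    then show "B u y = 0" by (simp add: B.bilinear)
  qed (auto simp: subspace_V finite_V B.bilinear)
  then show "\<exists>w. w \<in> V \<and> (\<forall>z\<in>V. B u z = A w z)" by blast
qed

lemma T_V [simp, intro]: "T u \<in> V" and A_T: "z \<in> V \<Longrightarrow> A (T u) z = B u z"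
  using T_props by auto

lemma A_eqI: "x \<in> V \<Longrightarrow> y \<in> V \<Longrightarrow> (\<And>z. z \<in> V \<Longrightarrow> A x z = A y z) \<Longrightarrow> x = y"
  using A_nondegenerate[of "x - y"] by (simp add: A.bilinear)

lemma T_add: "T (x + y) = T x + T y"
  by (rule A_eqI) (auto simp: A_T A.bilinear B.bilinear)

lemma T_scale: "T (c *s x) = c *s T x"
  by (rule A_eqI) (auto simp: A_T A.bilinear B.bilinear)

lemma T_0: "T 0 = 0" using T_scale[of 0 0] by simp

text \<open>The sign from the skew symmetry of \<open>A\<close> cancels the one from
  \<open>B\<close>.\<close>

lemma T_adjoint: "u \<in> V \<Longrightarrow> v \<in> V \<Longrightarrow> A (T u) v = A u (T v)"
  using A.skew[of u "T v"] B.skew[of v u] by (simp add: A_T)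

text \<open>Horner evaluation of \<open>p(T) v\<close>: the variable acts on \<open>V\<close> as
  \<open>T\<close>.\<close>

definition act :: "'a poly \<Rightarrow> 'b \<Rightarrow> 'b" where
  "act p = fold_coeffs (\<lambda>c g v. c *s v + T (g v)) p (\<lambda>_. 0)"

lemma act_0 [simp]: "act 0 v = 0" by (simp add: act_def)

lemma act_pCons [simp]: "act (pCons c p) v = c *s v + T (act p v)"
  by (cases "p = 0 \<and> c = 0") (auto simp: act_def T_0)

lemma act_V [simp, intro]: "v \<in> V \<Longrightarrow> act p v \<in> V"
  by (induction p) auto

lemma act_1 [simp]: "act 1 v = v" by (simp add: one_pCons T_0)

lemma act_add: "act (p + q) v = act p v + act q v"
  by (induction p q rule: poly_induct2) (auto simp: T_add scale_left_distrib)

lemma act_smult: "act (Polynomial.smult c p) v = c *s act p v"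
  by (induction p) (auto simp: T_scale scale_right_distrib)

lemma act_diff: "act (p - q) v = act p v - act q v"
  using act_add[of "p - q" q v] by simp

lemma act_mult: "act (p * q) v = act p (act q v)"
  by (induction p) (auto simp: act_add act_smult)

lemma act_commute: "act p (act q v) = act q (act p v)"
  using act_mult[of p q] act_mult[of q p] by (simp add: mult.commute)

lemma act_T: "T (act p v) = act p (T v)"
  using act_commute[of "[:0, 1:]" p] by (simp add: T_0)

lemma act_add_right: "act p (u + v) = act p u + act p v"
  by (induction p) (auto simp: T_add scale_right_distrib)

lemma act_scale_right: "act p (c *s v) = c *s act p v"
  by (induction p) (auto simp: T_scale scale_right_distrib mult.commute)

lemma act_zero_right [simp]: "act p 0 = 0"
  using act_scale_right[of p 0 0] by simp

lemma act_adjoint: "u \<in> V \<Longrightarrow> v \<in> V \<Longrightarrow> A (act p u) v = A u (act p v)"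
  by (induction p arbitrary: u v) (auto simp: A.bilinear T_adjoint act_T)

text \<open>Of \<open>c + a T + T^2 p(T)\<close> the first term contributes 0 as \<open>A\<close> is
  alternating, the second as \<open>B\<close> is, and the third becomes
  \<open>A (p(T) T u) (T u)\<close> by adjointness. This lowers the degree by two; the additional
  clause about \<open>pCons c p\<close> makes ordinary polynomial induction suffice.\<close>

lemma isotropic_aux:
  "\<forall>u\<in>V. A (act p u) u = 0 \<and> (\<forall>c. A (act (pCons c p) u) u = 0)"
proof (induction p)
  case 0
  then show ?case by (simp add: A.bilinear A.alternating T_0)
next
  case (pCons a p)
  have "A (act (pCons c (pCons a p)) u) u = 0" if u: "u \<in> V" for u c
  proof -
    have "A (act (pCons c (pCons a p)) u) u = A (T (T (act p u))) u"
      using u by (simp add: A.bilinear A.alternating T_add T_scale A_T B.alternating)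
    also have "\<dots> = A (T (act p u)) (T u)" using u by (simp add: T_adjoint)
    also have "\<dots> = A (act p (T u)) (T u)" by (simp add: act_T)
    also have "\<dots> = 0" using pCons.IH by auto
    finally show ?thesis .
  qed
  then show ?case using pCons.IH by blast
qed

lemma isotropic: "u \<in> V \<Longrightarrow> A (act p u) (act q u) = 0"
  using isotropic_aux[of "q * p"] act_adjoint[of "act p u" u q]
    A.skew[of "act p u" "act q u"] by (auto simp: act_mult act_adjoint)

section \<open>Fitting alternative for polynomials in T\<close>

lemma eventually_idempotent: "\<exists>N>0. \<forall>v\<in>V. act (p ^ (2 * N)) v = act (p ^ N) v"
proof -
  define g where "g i = restrict (act (p ^ i)) V" for i :: nat
  have "range g \<subseteq> V \<rightarrow>\<^sub>E V" by (auto simp: g_def)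
  then have "\<not> inj g" using finite_V finite_PiE[OF finite_V, of "\<lambda>_. V"]
    by (meson finite_imageD finite_subset infinite_UNIV_nat)
  then obtain i m where im: "g i = g (i + m)" "m > 0"
    by (metis injI less_imp_add_positive linorder_neqE_nat)
  have period: "act (p ^ (i + k)) v = act (p ^ (i + m + k)) v" if v: "v \<in> V" for k v
  proof -
    have "act (p ^ i) (act (p ^ k) v) = act (p ^ (i + m)) (act (p ^ k) v)"
      using fun_cong[OF im(1), of "act (p ^ k) v"] v by (simp add: g_def)
    then show ?thesis by (simp add: power_add act_mult)
  qed
  have periods: "act (p ^ (i + k + j * m)) v = act (p ^ (i + k)) v" if v: "v \<in> V" for j k v
  proof (induction j)
    case (Suc j)
    then show ?case using period[OF v, of "k + j * m"] by (simp add: algebra_simps)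
  qed simp
  \<comment> \<open>A multiple of the period \<open>m\<close> that is at least the preperiod
    \<open>i\<close>, and positive thanks to \<open>Suc i\<close>.\<close>
  define N where "N = m * Suc i"
  have "i \<le> N" using im(2) unfolding N_def by (cases m) auto
  then have "i + (N - i) + Suc i * m = 2 * N" "i + (N - i) = N" by (simp_all add: N_def)
  then have "act (p ^ (2 * N)) v = act (p ^ N) v" if "v \<in> V" for v
    using periods[OF that, of "N - i" "Suc i"] by (simp add: mult_2)
  then show ?thesis using im(2) by (intro exI[of _ N]) (simp add: N_def)
qed

definition nil :: "'a poly \<Rightarrow> bool" where
  "nil p \<longleftrightarrow> (\<exists>N. \<forall>v\<in>V. act (p ^ N) v = 0)"

text \<open>A suitable power \<open>E\<close> of \<open>p(T)\<close> is idempotent and self-adjoint,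
  so its kernel and image are \<open>A\<close>-orthogonal. Both are stable under \<open>T\<close>,
  hence also \<open>B\<close>-orthogonal, and indecomposability makes \<open>E\<close> zero or the
  identity.\<close>

lemma nil_or_periodic: "nil p \<or> (\<exists>N>0. \<forall>v\<in>V. act (p ^ N) v = v)"
proof -
  obtain N where N: "N > 0" "\<And>v. v \<in> V \<Longrightarrow> act (p ^ (2 * N)) v = act (p ^ N) v"
    using eventually_idempotent by blast
  define E where "E = act (p ^ N)"
  have EE: "E (E v) = E v" if "v \<in> V" for v
    using N(2)[OF that] by (simp add: E_def act_mult flip: power_add mult_2)
      (simp add: power_add act_mult mult_2)
  let ?X = "{v \<in> V. E v = 0}" and ?Y = "{v \<in> V. E v = v}"
  have "?X = {0} \<or> ?Y = {0}"
  proof (rule indecomposable)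
    show "subspace ?X" "subspace ?Y"
      by (auto intro!: subspaceI simp: E_def act_add_right act_scale_right)
    show "?X \<inter> ?Y = {0}" by (auto simp: E_def)
    fix v assume v: "v \<in> V"
    have "E (v - E v) = 0" using EE[OF v] act_add_right[of "p ^ N" "v - E v" "E v"] by (simp add: E_def)
    then show "\<exists>x\<in>?X. \<exists>y\<in>?Y. v = x + y"
      using v EE[OF v] by (intro bexI[of _ "v - E v"] bexI[of _ "E v"]) (auto simp: E_def)
  next
    fix x y assume xy: "x \<in> ?X" "y \<in> ?Y"
    have orth: "A x y = 0" if "x \<in> ?X" "y \<in> ?Y" for x y
      using that act_adjoint[of x y "p ^ N"] by (simp add: E_def A.bilinear)
    have "T x \<in> ?X" using xy by (simp add: E_def T_0 flip: act_T)
    then have "B x y = 0" using orth[of "T x" y] xy by (simp add: A_T)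
    then show "A x y = 0 \<and> B x y = 0" using orth xy by blast
  qed auto
  then show ?thesis
  proof
    assume X: "?X = {0}"
    have "E v = v" if v: "v \<in> V" for v
    proof -
      have "E (v - E v) = 0" using EE[OF v] act_add_right[of "p ^ N" "v - E v" "E v"] by (simp add: E_def)
      then have "v - E v \<in> ?X" using v by (auto simp: E_def)
      then show ?thesis using X by simp
    qed
    then show ?thesis using N(1) by (auto simp: E_def)
  next
    assume Y: "?Y = {0}"
    have "E v = 0" if v: "v \<in> V" for v
    proof -
      have "E v \<in> ?Y" using v EE[OF v] by (auto simp: E_def)
      then show ?thesis using Y by simp
    qed
    then show ?thesis by (auto simp: E_def nil_def)
  qed
qed

lemma exists_nonzero: obtains v where "v \<in> V" "v \<noteq> 0"
  using nontrivial V_closed(1) by blast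

lemma not_nil_and_periodic: "nil p \<Longrightarrow> N > 0 \<Longrightarrow> (\<And>v. v \<in> V \<Longrightarrow> act (p ^ N) v = v) \<Longrightarrow> False"
proof -
  assume "nil p" and N: "N > 0" "\<And>v. v \<in> V \<Longrightarrow> act (p ^ N) v = v"
  then obtain M where M: "\<And>v. v \<in> V \<Longrightarrow> act (p ^ M) v = 0" by (auto simp: nil_def)
  have "act (p ^ (N * k)) v = v" if "v \<in> V" for v k
    by (induction k) (use N that in \<open>auto simp: power_add act_mult\<close>)
  moreover have "act (p ^ (N * M)) v = 0" if "v \<in> V" for v
  proof -
    have "N * M = (N * M - M) + M" using N(1) by (cases N) auto
    then have "p ^ (N * M) = p ^ (N * M - M) * p ^ M" by (metis power_add)
    then show ?thesis using M[OF that] by (simp add: act_mult)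
  qed
  ultimately show False using exists_nonzero by metis
qed

lemma nil_kernel:
  assumes "nil p" "v \<in> V" "v \<noteq> 0"
  shows "\<exists>i. act (p ^ i) v \<noteq> 0 \<and> act p (act (p ^ i) v) = 0"
proof (rule ccontr)
  assume *: "\<not> ?thesis"
  have "act (p ^ i) v \<noteq> 0" for i
    by (induction i) (use * assms in \<open>auto simp: act_mult\<close>)
  then show False using assms by (auto simp: nil_def)
qed

text \<open>Two powers of \<open>T\<close> agree on the finite set \<open>V\<close>; this takes the
  place of a minimal polynomial.\<close>

lemma exists_nil: "\<exists>p. nil p \<and> p \<noteq> 0"
proof -
  define g where "g i = restrict (act (monom 1 i)) V" for i :: nat
  have "range g \<subseteq> V \<rightarrow>\<^sub>E V" by (auto simp: g_def)
  then have "\<not> inj g" using finite_V finite_PiE[OF finite_V, of "\<lambda>_. V"]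
    by (meson finite_imageD finite_subset infinite_UNIV_nat)
  then obtain i j where ij: "g i = g j" "i \<noteq> j" by (auto simp: inj_def)
  let ?p = "monom 1 i - monom 1 j :: 'a poly"
  have "act ?p v = 0" if "v \<in> V" for v
    using fun_cong[OF ij(1), of v] that by (simp add: g_def act_diff)
  then have "nil ?p" by (auto simp: nil_def intro!: exI[of _ 1])
  moreover have "coeff ?p i \<noteq> 0" using ij(2) by simp
  then have "?p \<noteq> 0" by (metis coeff_0)
  ultimately show ?thesis by blast
qed

text \<open>A nonzero nil polynomial of least degree works. By the alternative "nil or periodic",
  being nil behaves like membership in a prime ideal, and division with remainder supplies a
  generator.\<close>

lemma exists_irreducible_nil:
  obtains a where "irreducible a" "nil a" "\<And>p. nil p \<Longrightarrow> a dvd p"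
proof -
  obtain a where a: "nil a" "a \<noteq> 0" and min: "\<And>q. nil q \<Longrightarrow> q \<noteq> 0 \<Longrightarrow> degree a \<le> degree q"
    using exists_nil ex_has_least_nat[of "\<lambda>p. nil p \<and> p \<noteq> 0" _ degree] by metis
  have "a dvd p" if p: "nil p" for p
  proof -
    define r where "r = p mod a"
    obtain v where v: "v \<in> V" "v \<noteq> 0" using exists_nonzero by blast
    obtain i where i: "act (a ^ i) v \<noteq> 0" "act a (act (a ^ i) v) = 0"
      using nil_kernel[OF a(1) v] by blast
    define u where "u = act (a ^ i) v"
    have u: "u \<in> V" "u \<noteq> 0" using i v by (auto simp: u_def)
    obtain j where j: "act (p ^ j) u \<noteq> 0" "act p (act (p ^ j) u) = 0"
      using nil_kernel[OF p u] by blast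
    \<comment> \<open>\<open>a\<close> and \<open>p\<close> commute and are both nil, so they have a
      common kernel vector. The remainder \<open>r\<close> kills it too, so \<open>r\<close> cannot
      be periodic.\<close>
    define w where "w = act (p ^ j) u"
    have aw: "act a w = 0" using i(2) by (simp add: w_def act_commute[of a] flip: u_def)
    have "r = p - p div a * a" unfolding r_def by (simp add: minus_div_mult_eq_mod)
    then have rw: "act r w = 0" using aw j(2) by (simp add: act_diff act_mult w_def)
    have "nil r"
    proof (rule ccontr)
      assume "\<not> nil r"
      then obtain N where "N > 0" "act (r ^ N) w = w"
        using nil_or_periodic[of r] u by (auto simp: w_def)
      then have "w = 0" using rw by (cases N) (auto simp: act_mult act_commute[of r])
      then show False using j by (simp add: w_def)
    qed
    then have "r = 0" using min[of r] degree_mod_less'[OF a(2), of p] unfolding r_def by linarith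
    then show ?thesis by (simp add: r_def mod_eq_0_iff_dvd)
  qed
  moreover have "irreducible a"
  proof (rule irreducibleI)
    show "\<not> is_unit a"
    proof
      assume "is_unit a"
      then obtain b where b: "1 = a * b" by (auto elim: dvdE)
      obtain v where v: "v \<in> V" "v \<noteq> 0" using exists_nonzero by blast
      then obtain i where i: "act (a ^ i) v \<noteq> 0" "act a (act (a ^ i) v) = 0"
        using nil_kernel[OF a(1)] by blast
      have "act (a ^ i) v = act (b * a) (act (a ^ i) v)" using b by (simp add: mult.commute)
      also have "\<dots> = 0" using i by (simp add: act_mult)
      finally show False using i by simp
    qed
    fix g h assume gh: "a = g * h"
    have unit: "is_unit h" if "a = g * h" "nil g" for g h
    proof -
      have nz: "g \<noteq> 0" "h \<noteq> 0" using that a(2) by auto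
      then have "degree a = degree g + degree h" using that(1) degree_mult_eq by blast
      then show ?thesis using min[OF that(2)] nz is_unit_iff_degree by auto
    qed
    \<comment> \<open>Otherwise both factors are periodic, and so is their product \<open>a\<close>,
      with exponent \<open>M * N\<close>.\<close>
    have "nil g \<or> nil h"
    proof (rule ccontr)
      assume "\<not> (nil g \<or> nil h)"
      then obtain M N where M: "M > 0" "\<And>v. v \<in> V \<Longrightarrow> act (g ^ M) v = v"
        and N: "N > 0" "\<And>v. v \<in> V \<Longrightarrow> act (h ^ N) v = v"
        using nil_or_periodic by metis
      have 1: "act (g ^ (M * k)) v = v" if "v \<in> V" for v k
        by (induction k) (use M that in \<open>auto simp: power_add act_mult\<close>)
      have 2: "act (h ^ (N * k)) v = v" if "v \<in> V" for v k
        by (induction k) (use N that in \<open>auto simp: power_add act_mult\<close>)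
      have "act (a ^ (M * N)) v = v" if "v \<in> V" for v
        using 1[OF that, of N] 2[OF that, of M] by (simp add: gh power_mult_distrib act_mult mult.commute[of M])
      then show False using not_nil_and_periodic[OF a(1), of "M * N"] M N by simp
    qed
    then show "is_unit g \<or> is_unit h" using unit[of g h] unit[of h g] gh by (auto simp: mult.commute)
  qed (rule a)
  ultimately show ?thesis using that a by blast
qed

text \<open>The generators are chosen with \<open>A (act (a\<^sup>c\<^sup>-\<^sup>1) e) f \<noteq> 0\<close>. This makes the pairing of the two
  isotropic submodules \<open>k[T] e\<close> and \<open>k[T] f\<close> perfect, because \<open>a\<^sup>c\<^sup>-\<^sup>1\<close> lies in every nonzero ideal
  of \<open>k[x]/(a\<^sup>c)\<close>.\<close>

theorem hyperbolic_generators: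
  obtains a c e f where "irreducible a" "c > 0" "e \<in> V" "f \<in> V" "\<And>v. v \<in> V \<Longrightarrow> act (a ^ c) v = 0"
    "V = {act p e + act q f | p q. True}"
proof -
  obtain a where a: "irreducible a" "nil a" "\<And>p. nil p \<Longrightarrow> a dvd p"
    using exists_irreducible_nil by metis
  define c where "c = (LEAST N. \<forall>v\<in>V. act (a ^ N) v = 0)"
  have c: "\<forall>v\<in>V. act (a ^ c) v = 0"
    unfolding c_def by (rule LeastI_ex) (use a(2) in \<open>simp add: nil_def\<close>)
  have c0: "c > 0" using c exists_nonzero by (cases c) auto
  have "\<not> (\<forall>v\<in>V. act (a ^ (c - 1)) v = 0)"
    using not_less_Least[of "c - 1" "\<lambda>N. \<forall>v\<in>V. act (a ^ N) v = 0"] c0 by (simp add: c_def)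
  then obtain e where e: "e \<in> V" "act (a ^ (c - 1)) e \<noteq> 0" by blast
  then obtain f where f: "f \<in> V" "A (act (a ^ (c - 1)) e) f \<noteq> 0"
    using A_nondegenerate[of "act (a ^ (c - 1)) e"] by auto
  \<comment> \<open>The factor \<open>p'\<close> is prime to \<open>a\<close>, hence invertible on
    \<open>V\<close>. If \<open>a\<close> divided \<open>p\<close> fewer than \<open>c\<close>
    times, a multiple of \<open>p\<close> would act as \<open>a ^ (c - 1)\<close>, on which the
    functional is nonzero at \<open>e\<close>.\<close>
  have perfect: "act p v = 0" if p: "\<And>s. A (act (p * s) e) f = 0" and v: "v \<in> V" for p v
  proof (cases "p = 0")
    case False
    obtain j p' where p': "p = a ^ j * p'" "\<not> a dvd p'"
      using power_decomposition[OF False, of a] a(1) irreducible_not_unit by blast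
    have "\<not> nil p'" using a(3) p'(2) by blast
    then obtain N where N: "N > 0" "\<And>v. v \<in> V \<Longrightarrow> act (p' ^ N) v = v" using nil_or_periodic by blast
    have "c \<le> j"
    proof (rule ccontr)
      assume "\<not> c \<le> j"
      then have "a ^ (c - 1) = a ^ j * a ^ (c - 1 - j)" by (simp flip: power_add)
      moreover have "p' ^ N = p' * p' ^ (N - 1)" using N(1) by (cases N) auto
      ultimately have "a ^ (c - 1) * p' ^ N = p * (a ^ (c - 1 - j) * p' ^ (N - 1))"
        using p'(1) by (simp add: mult_ac)
      then have "A (act (a ^ (c - 1) * p' ^ N) e) f = 0" using p by simp
      then show False using f N(2) e by (simp add: act_mult)
    qed
    then have "p = p' * a ^ (j - c) * a ^ c" using p'(1) by (simp add: mult.assoc mult.commute flip: power_add)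
    then show ?thesis using c v by (simp add: act_mult)
  qed simp
  \<comment> \<open>\<open>X\<close> is stable under all of \<open>k[T]\<close>. This is what makes
    its \<open>A\<close>-orthogonal complement \<open>Y\<close> orthogonal for \<open>B\<close> as
    well.\<close>
  define X where "X = {act p e + act q f | p q. True}"
  define Y where "Y = {v \<in> V. \<forall>x\<in>X. A x v = 0}"
  have XI: "act p e + act q f \<in> X" for p q by (auto simp: X_def)
  have X_act: "act r x \<in> X" if "x \<in> X" for r x
    using that XI by (auto simp: X_def act_add_right simp flip: act_mult)
  have X_V: "X \<subseteq> V" using e f by (auto simp: X_def)
  have sX: "subspace X"
  proof (rule subspaceI)
    show "0 \<in> X" using XI[of 0 0] by simp
    fix x y assume "x \<in> X" "y \<in> X"
    then obtain p q p' q' where "x = act p e + act q f" "y = act p' e + act q' f" by (auto simp: X_def)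
    then show "x + y \<in> X" using XI[of "p + p'" "q + q'"] by (simp add: act_add algebra_simps)
  next
    fix k x assume "x \<in> X"
    then show "k *s x \<in> X" using X_act[of x "[:k:]"] by (simp add: T_0)
  qed
  have sY: "subspace Y" by (rule subspaceI) (auto simp: Y_def A.bilinear)
  have XY: "x = 0" if "x \<in> X" "x \<in> Y" for x
  proof -
    obtain p q where x: "x = act p e + act q f" using \<open>x \<in> X\<close> by (auto simp: X_def)
    have orth: "A y x = 0" if "y \<in> X" for y using \<open>x \<in> Y\<close> that by (simp add: Y_def)
    \<comment> \<open>Pairing \<open>x\<close> with \<open>k[T] f\<close> isolates the coefficient
      of \<open>e\<close>, since \<open>k[T] f\<close> is isotropic; pairing with
      \<open>k[T] e\<close> below isolates that of \<open>f\<close>.\<close>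
    have "A (act (p * s) e) f = 0" for s
    proof -
      have "A (act s f) x = 0" using orth XI[of 0 s] by simp
      then have "A (act s f) (act p e) = 0" using f e isotropic[of f s q] by (simp add: x A.bilinear)
      then show ?thesis using A.skew[of "act s f" "act p e"] e f
        by (simp add: act_mult act_commute[of p s] act_adjoint)
    qed
    then have "act p e = 0" using perfect e by blast
    moreover have "A (act (q * s) e) f = 0" for s
    proof -
      have "A (act s e) x = 0" using orth XI[of s 0] by simp
      then have "A (act s e) (act q f) = 0" using f e isotropic[of e s p] by (simp add: x A.bilinear)
      then show ?thesis using e f by (simp add: act_mult act_adjoint)
    qed
    then have "act q f = 0" using perfect f by blast
    ultimately show ?thesis using x by simp
  qed
  have decomp: "\<exists>x\<in>X. \<exists>y\<in>Y. v = x + y" if v: "v \<in> V" for v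
  proof -
    have "\<exists>x\<in>X. \<forall>y\<in>X. A v y = A x y"
    proof (rule A.represent_functional)
      show "finite X" using X_V finite_V finite_subset by blast
      fix y assume "y \<in> X" "\<And>x. x \<in> X \<Longrightarrow> A x y = 0"
      then have "y = 0" using XY X_V by (auto simp: Y_def)
      then show "A v y = 0" by (simp add: A.bilinear)
    qed (auto simp: sX A.bilinear)
    then obtain x where x: "x \<in> X" "\<And>y. y \<in> X \<Longrightarrow> A v y = A x y" by blast
    have "v - x \<in> Y" using x v X_V by (auto simp: Y_def A.bilinear A.skew[of v] A.skew[of x])
    then show ?thesis using x(1) by (metis add.commute diff_add_cancel)
  qed
  have "X = {0} \<or> Y = {0}"
  proof (rule indecomposable)
    show "X \<inter> Y = {0}" using XY subspace_0[OF sX] subspace_0[OF sY] by blast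
    fix x y assume xy: "x \<in> X" "y \<in> Y"
    then have "A (T x) y = 0" using X_act[of x "[:0, 1:]"] by (simp add: Y_def T_0)
    then show "A x y = 0 \<and> B x y = 0" using xy by (simp add: A_T Y_def)
  qed (use decomp sX sY X_V in \<open>auto simp: Y_def\<close>)
  moreover have "X \<noteq> {0}"
    using XI[of "a ^ (c - 1)" 0] e by auto
  ultimately have "Y = {0}" by blast
  then have "v \<in> X" if "v \<in> V" for v using decomp[OF that] by auto
  then show ?thesis using that[of a c e f] a(1) c c0 e f X_V by (auto simp: X_def)
qed

text \<open>Isotropy removes the two diagonal terms and leaves a determinant. Since \<open>B\<close>
  is \<open>A\<close> with \<open>T\<close> applied to one argument, it only inserts a factor
  \<open>x\<close>.\<close>

lemma hyperbolic_form:
  assumes "e \<in> V" "f \<in> V"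
  shows "A (act p e + act q f) (act p' e + act q' f) = A (act (p * q' - p' * q) e) f"
    and "B (act p e + act q f) (act p' e + act q' f) = A (act (pCons 0 (p * q' - p' * q)) e) f"
proof -
  show *: "A (act p e + act q f) (act p' e + act q' f) = A (act (p * q' - p' * q) e) f" for p q p' q'
  proof -
    have "A (act q f) (act p' e) = - A (act (p' * q) e) f"
      using assms A.skew[of "act p' e" "act q f"] by (simp add: act_mult act_commute[of p'] act_adjoint)
    moreover have "A (act p e) (act q' f) = A (act (p * q') e) f"
      using assms by (simp add: act_mult act_commute[of p] act_adjoint)
    ultimately show ?thesis
      using assms by (simp add: A.bilinear isotropic act_diff)
  qed
  have "B (act p e + act q f) (act p' e + act q' f)
      = A (act (pCons 0 p) e + act (pCons 0 q) f) (act p' e + act q' f)"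
    using assms by (simp add: A_T T_add flip: A_T)
  also have "\<dots> = A (act (pCons 0 (p * q' - p' * q)) e) f"
    unfolding * by (simp add: algebra_simps mult_pCons_left mult_pCons_right)
  finally show "B (act p e + act q f) (act p' e + act q' f) = A (act (pCons 0 (p * q' - p' * q)) e) f" .
qed

end

section \<open>Singular pencils\<close>

text \<open>The number \<open>m\<close> is the degree of \<open>v(t)\<close>, the smallest degree of
  a nonzero polynomial kernel vector: a minimal index in the sense of Kronecker.\<close>

locale minimal_kernel_chain = indecomposable_pencil +
  fixes v :: "nat \<Rightarrow> 'b" and m :: nat
  assumes chain: "kernel_chain v" and support: "i > m \<Longrightarrow> v i = 0" and nonzero: "\<exists>i. v i \<noteq> 0"
    and minimal: "kernel_chain w \<Longrightarrow> (\<And>i. i \<ge> m \<Longrightarrow> w i = 0) \<Longrightarrow> w i = 0"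
begin

lemma v_V [simp, intro]: "v i \<in> V"
  and A_v0: "z \<in> V \<Longrightarrow> A (v 0) z = 0"
  and B_v: "z \<in> V \<Longrightarrow> B (v i) z = A (v (Suc i)) z"
  using chain by (auto simp: kernel_chain_def)

lemma v_m: "v m \<noteq> 0"
proof
  assume "v m = 0"
  then have "v i = 0" if "i \<ge> m" for i using support[of i] that by (cases "i = m") auto
  then show False using minimal[OF chain] nonzero by blast
qed

text \<open>A constant kernel vector would lie in the radical of both forms.\<close>

lemma m_pos: "m > 0"
proof (rule ccontr)
  assume "\<not> m > 0"
  then have "B (v 0) z = 0" if "z \<in> V" for z using that support[of "Suc 0"] by (simp add: B_v A.bilinear)
  then have "v 0 = 0" using nondegenerate A_v0 by blast
  then show False using v_m \<open>\<not> m > 0\<close> by simp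
qed

text \<open>A linear relation among these functionals would produce a kernel polynomial of smaller
  degree than \<open>v\<close>.\<close>

lemma independent_functionals:
  assumes c: "\<And>z. z \<in> V \<Longrightarrow> (\<Sum>i<m. c i * A (v (Suc i)) z) = 0" and "i < m"
  shows "c i = 0"
proof (rule ccontr)
  assume "c i \<noteq> 0"
  define i0 where "i0 = (LEAST i. c i \<noteq> 0)"
  have i0: "c i0 \<noteq> 0" unfolding i0_def using \<open>c i \<noteq> 0\<close> by (rule LeastI)
  have below: "c j = 0" if "j < i0" for j using that not_less_Least i0_def by blast
  have "i0 \<le> i" unfolding i0_def using \<open>c i \<noteq> 0\<close> by (rule Least_le)
  \<comment> \<open>A combination of left shifts of \<open>v\<close>. The relation makes
    \<open>A\<close> vanish on its first term, and every shift drops at least one term, so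
    \<open>w\<close> ends before \<open>m\<close>.\<close>
  define w where "w s = (\<Sum>i<m. c i *s v (Suc i + s))" for s
  have "kernel_chain w"
    unfolding kernel_chain_def using c by (auto simp: w_def A.bilinear B.bilinear B_v)
  moreover have "w s = 0" if "s \<ge> m" for s
    unfolding w_def using that by (intro sum.neutral) (auto simp: support)
  \<comment> \<open>At this index the coefficients below \<open>i0\<close> vanish and the terms
    above \<open>i0\<close> lie beyond the end of \<open>v\<close>, leaving
    \<open>c i0 *s v m\<close>.\<close>
  ultimately have "w (m - Suc i0) = 0" by (rule minimal)
  moreover have "w (m - Suc i0) = (\<Sum>i<m. if i = i0 then c i0 *s v m else 0)"
    unfolding w_def
  proof (intro sum.cong refl)
    fix j
    consider "j < i0" | "j = i0" | "j > i0" by linarith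
    then show "c j *s v (Suc j + (m - Suc i0)) = (if j = i0 then c i0 *s v m else 0)"
      by cases (use below \<open>i0 \<le> i\<close> \<open>i < m\<close> in \<open>simp_all add: support\<close>)
  qed
  ultimately show False using i0 v_m \<open>i0 \<le> i\<close> \<open>i < m\<close> by simp
qed

definition F :: "'b set" where
  "F = {\<Sum>i\<le>m. p i *s v i | p. True}"

lemma FI: "(\<Sum>i\<le>m. p i *s v i) \<in> F" by (auto simp: F_def)

text \<open>On \<open>F\<close> both forms are expressed by the same \<open>m\<close> functionals:
  \<open>A\<close> loses the coefficient of \<open>v 0\<close>, and \<open>B\<close> that of
  \<open>v m\<close>. The coefficients differ by an index shift.\<close>

lemma A_F: "z \<in> V \<Longrightarrow> A (\<Sum>i\<le>m. p i *s v i) z = (\<Sum>i<m. p (Suc i) * A (v (Suc i)) z)"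
  by (simp add: A.bilinear sum.atMost_shift A_v0)

lemma B_F: "z \<in> V \<Longrightarrow> B (\<Sum>i\<le>m. p i *s v i) z = (\<Sum>i<m. p i * A (v (Suc i)) z)"
  by (simp add: B.bilinear B_v support A.zero_left flip: lessThan_Suc_atMost)

lemma subspace_F: "subspace F"
proof (rule subspaceI)
  show "0 \<in> F" using FI[of "\<lambda>_. 0"] by simp
  fix x y assume "x \<in> F" "y \<in> F"
  then obtain p q where "x = (\<Sum>i\<le>m. p i *s v i)" "y = (\<Sum>i\<le>m. q i *s v i)" by (auto simp: F_def)
  then show "x + y \<in> F" using FI[of "\<lambda>i. p i + q i"] by (simp add: scale_left_distrib sum.distrib)
next
  fix c x assume "x \<in> F"
  then obtain p where "x = (\<Sum>i\<le>m. p i *s v i)" by (auto simp: F_def)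
  then show "c *s x \<in> F" using FI[of "\<lambda>i. c * p i"] by (simp add: scale_sum_right)
qed

lemma F_V: "x \<in> F \<Longrightarrow> x \<in> V" by (auto simp: F_def)

lemma v_F: "i \<le> m \<Longrightarrow> v i \<in> F"
  using FI[of "\<lambda>j. if j = i then 1 else 0"] by (simp add: if_distrib[of "\<lambda>c. c *s _"] cong: if_cong)

text \<open>A kernel chain modulo \<open>F\<close> of length at most \<open>m - 1\<close> lifts to a kernel chain, which may be chosen
  of length at most \<open>m\<close> after subtracting shifts of \<open>v\<close>. So it vanishes modulo \<open>F\<close>.\<close>

lemma chain_modulo_F:
  assumes y: "\<And>j. y j \<in> V" "y 0 = 0" "\<And>j. j \<ge> m \<Longrightarrow> y j = 0"
    and rel: "\<And>j. j < m \<Longrightarrow> \<exists>c. \<forall>z\<in>V. A (y (Suc j)) z - B (y j) z = (\<Sum>i<m. c i * A (v (Suc i)) z)"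
  shows "y j \<in> F"
proof -
  have rel': "\<exists>c. \<forall>z\<in>V. A (y (Suc j)) z - B (y j) z = (\<Sum>i<m. c i * A (v (Suc i)) z)" for j
  proof (cases "j < m")
    case False
    then show ?thesis using y(3) by (intro exI[of _ "\<lambda>_. 0"]) (simp add: A.bilinear B.bilinear)
  qed (rule rel)
  \<comment> \<open>Each term of \<open>y\<close> is corrected by an element of \<open>F\<close> so
    that the chain relation holds exactly and no longer only modulo \<open>F\<close>.\<close>
  have "\<exists>y'. \<forall>n. (y' n - y n \<in> F \<and> (n = 0 \<longrightarrow> y' n = 0)) \<and> (\<forall>z\<in>V. A (y' (Suc n)) z = B (y' n) z)"
  proof (rule dependent_nat_choice)
    show "\<exists>x. x - y 0 \<in> F \<and> (0 = (0 :: nat) \<longrightarrow> x = 0)" using y(2) subspace_0[OF subspace_F] by simp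
    fix x n assume x: "x - y n \<in> F \<and> (n = 0 \<longrightarrow> x = 0)"
    then obtain p where "x - y n = (\<Sum>i\<le>m. p i *s v i)" by (auto simp: F_def)
    then have p: "x = y n + (\<Sum>i\<le>m. p i *s v i)" by (simp add: algebra_simps)
    obtain c where c: "\<And>z. z \<in> V \<Longrightarrow> A (y (Suc n)) z - B (y n) z = (\<Sum>i<m. c i * A (v (Suc i)) z)"
      using rel' by blast
    \<comment> \<open>The shift matches \<open>B\<close> of the previous correction, and subtracting
      \<open>c i\<close> cancels the error. The coefficient of \<open>v 0\<close> is free, as
      \<open>A\<close> kills \<open>v 0\<close>, and is set to 0.\<close>
    define q where "q i = (case i of 0 \<Rightarrow> 0 | Suc i \<Rightarrow> p i - c i)" for i
    let ?x = "y (Suc n) + (\<Sum>i\<le>m. q i *s v i)"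
    have "A ?x z = B x z" if z: "z \<in> V" for z
      using c[OF z] z unfolding p A.add_left B.add_left A_F[OF z] B_F[OF z]
      by (simp add: q_def left_diff_distrib sum_subtractf algebra_simps)
    then show "\<exists>x'. (x' - y (Suc n) \<in> F \<and> (Suc n = 0 \<longrightarrow> x' = 0)) \<and> (\<forall>z\<in>V. A x' z = B x z)"
      by (intro exI[of _ ?x]) (simp add: FI)
  qed
  then obtain y' where y'F: "\<And>n. y' n - y n \<in> F" and y'0: "y' 0 = 0"
    and y'rel: "\<And>n z. z \<in> V \<Longrightarrow> A (y' (Suc n)) z = B (y' n) z" by blast
  have y'V: "y' n \<in> V" for n using V_closed(2)[OF F_V[OF y'F[of n]] y(1)[of n]] by simp
  obtain p where p: "y' m = (\<Sum>i\<le>m. p i *s v i)" using y'F[of m] y(3)[of m] by (auto simp: F_def)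
  define w where "w k = (if k < m then 0 else v (k - m))" for k
  have w_V: "w k \<in> V" for k by (simp add: w_def)
  have w_rel: "B (w k) z = A (w (Suc k)) z" if z: "z \<in> V" for k z
  proof -
    consider "Suc k < m" | "Suc k = m" | "k \<ge> m" by linarith
    then show ?thesis
      by cases (use z in \<open>auto simp: w_def A.bilinear B.bilinear B_v A_v0 Suc_diff_le\<close>)
  qed
  have w_A: "A (w i) z = 0" if "i \<le> m" "z \<in> V" for i z
    using that by (auto simp: w_def A.bilinear A_v0)
  \<comment> \<open>\<open>w\<close> is \<open>v\<close> delayed by \<open>m\<close> places. At
    index \<open>m\<close> the subtracted sum is precisely the expansion of \<open>y' m\<close>, so
    \<open>d m = 0\<close>.\<close>
  define d where "d j = y' j - (\<Sum>i\<le>m. p i *s w (i + j))" for j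
  have d_m: "d m = 0" by (simp add: d_def p w_def)
  have d_rel: "B (d j) z = A (d (Suc j)) z" if "z \<in> V" for j z
    using that by (simp add: d_def A.bilinear B.bilinear y'rel w_rel)
  \<comment> \<open>As \<open>d m = 0\<close>, cutting at \<open>m\<close> keeps the chain relation,
    and minimality applies.\<close>
  define u where "u j = (if j < m then d j else 0)" for j
  have "kernel_chain u" unfolding kernel_chain_def
  proof (intro conjI allI ballI)
    show "u j \<in> V" for j by (simp add: u_def d_def y'V w_V)
    show "A (u 0) z = 0" if "z \<in> V" for z
      using that by (simp add: u_def d_def A.bilinear y'0 w_A)
    show "B (u j) z = A (u (Suc j)) z" if z: "z \<in> V" for j z
    proof -
      consider "Suc j < m" | "Suc j = m" | "j \<ge> m" by linarith
      then show ?thesis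
      proof cases
        case 2
        then show ?thesis using d_rel[OF z, of j] d_m by (auto simp: u_def A.bilinear)
      qed (use d_rel[OF z, of j] in \<open>auto simp: u_def A.bilinear B.bilinear\<close>)
    qed
  qed
  then have u0: "u j = 0" for j by (rule minimal) (simp add: u_def)
  show "y j \<in> F"
  proof (cases "j < m")
    case True
    then have "y' j = (\<Sum>i\<le>m. p i *s w (i + j))" using u0[of j] by (simp add: u_def d_def)
    moreover have "w (i + j) \<in> F" if "i \<le> m" for i
      using that True subspace_0[OF subspace_F] v_F[of "i + j - m"] by (auto simp: w_def)
    ultimately have "y' j \<in> F" by (auto intro!: subspace_sum subspace_scale subspace_F)
    then have "y' j - (y' j - y j) \<in> F" using y'F subspace_diff[OF subspace_F] by blast
    then show ?thesis by simp
  next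
    case False
    then show ?thesis using y(3)[of j] subspace_0[OF subspace_F] by simp
  qed
qed

text \<open>The conditions on \<open>e\<close> form a linear system; \<open>(c, y)\<close> ranges over the linear combinations of its
  equations, and it is solvable because every combination that vanishes identically has right hand
  side \<open>\<Sum> c\<^sub>j\<^sub>j = 0\<close>.\<close>

lemma exists_dual_chain:
  "\<exists>e. (\<forall>j. e j \<in> V) \<and> (\<forall>i<m. \<forall>j<m. A (v (Suc i)) (e j) = (if i = j then 1 else 0)) \<and>
     (\<forall>j. Suc j < m \<longrightarrow> (\<forall>x\<in>V. A (e j) x = B (e (Suc j)) x))"
proof -
  define I where "I = {..<m} \<rightarrow>\<^sub>E V"
  \<comment> \<open>\<open>c i j\<close> multiplies the equation for
    \<open>A (v (Suc i)) (e j)\<close>. For \<open>0 < k < m\<close>, \<open>y k\<close> is the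
    vector at which the relation between \<open>e (k - 1)\<close> and \<open>e k\<close> is tested;
    no relation exists for \<open>k = 0\<close> or \<open>k \<ge> m\<close>, hence the
    zeros.\<close>
  define Y where "Y = {(c :: nat \<Rightarrow> nat \<Rightarrow> 'a, y). (\<forall>j. y j \<in> V) \<and> y 0 = 0 \<and> (\<forall>j\<ge>m. y j = 0)}"
  define g where "g e = (\<lambda>(c, y). \<Sum>j<m. (\<Sum>i<m. c i j * A (v (Suc i)) (e j))
      - (A (y (Suc j)) (e j) - B (y j) (e j)))" for e
  define f where "f = (\<lambda>(c :: nat \<Rightarrow> nat \<Rightarrow> 'a, y :: nat \<Rightarrow> 'b). \<Sum>j<m. c j j)"
  define comb where "comb = (\<lambda>(c :: nat \<Rightarrow> nat \<Rightarrow> 'a, y :: nat \<Rightarrow> 'b) t (c', y').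
      ((\<lambda>i j. c i j + t * c' i j), (\<lambda>j. y j + t *s y' j)))"
  have "finite I" using finite_V by (auto simp: I_def intro: finite_PiE)
  have "\<exists>k. \<forall>\<tau>\<in>Y. f \<tau> = (\<Sum>e\<in>I. k e * g e \<tau>)"
  proof (rule functional_combination[where comb = comb])
    show "comb \<tau> t \<rho> \<in> Y" if "\<tau> \<in> Y" "\<rho> \<in> Y" for \<tau> t \<rho>
      using that by (auto simp: Y_def comb_def)
    show "g e (comb \<tau> t \<rho>) = g e \<tau> + t * g e \<rho>" for e \<tau> t \<rho>
      by (cases \<tau>; cases \<rho>) (simp add: g_def comb_def A.bilinear B.bilinear algebra_simps sum.distrib
          sum_subtractf sum_distrib_left)
    show "f (comb \<tau> t \<rho>) = f \<tau> + t * f \<rho>" for \<tau> t \<rho>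
      by (cases \<tau>; cases \<rho>) (simp add: f_def comb_def sum.distrib sum_distrib_left)
    fix \<tau> assume \<tau>: "\<tau> \<in> Y" and vanish: "\<And>e. e \<in> I \<Longrightarrow> g e \<tau> = 0"
    obtain c y where cy: "\<tau> = (c, y)" by (cases \<tau>)
    have y: "y j \<in> V" "y 0 = 0" "j \<ge> m \<Longrightarrow> y j = 0" for j using \<tau> by (auto simp: Y_def cy)
    have rel: "A (y (Suc j)) x - B (y j) x = (\<Sum>i<m. c i j * A (v (Suc i)) x)"
      if j: "j < m" and x: "x \<in> V" for j x
    proof -
      \<comment> \<open>Families concentrated at one index separate the equations for different
        \<open>j\<close>.\<close>
      define e where "e = (\<lambda>k\<in>{..<m}. if k = j then x else 0)"
      have "e \<in> I" using x by (auto simp: I_def e_def)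
      then have "0 = g e \<tau>" using vanish by simp
      also have "\<dots> = (\<Sum>k<m. if k = j then (\<Sum>i<m. c i j * A (v (Suc i)) x)
          - (A (y (Suc j)) x - B (y j) x) else 0)"
        unfolding g_def cy prod.case by (intro sum.cong refl) (auto simp: e_def A.bilinear B.bilinear)
      also have "\<dots> = (\<Sum>i<m. c i j * A (v (Suc i)) x) - (A (y (Suc j)) x - B (y j) x)"
        using j by simp
      finally show ?thesis by simp
    qed
    have "y j \<in> F" for j by (rule chain_modulo_F) (use y rel in auto)
    \<comment> \<open>The zero coefficients are chosen wherever \<open>y j = 0\<close>, so that the
      boundary terms of the telescoping trace below vanish.\<close>
    then have "\<exists>p. y j = (\<Sum>i\<le>m. p i *s v i) \<and> (y j = 0 \<longrightarrow> p = (\<lambda>_. 0))" for j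
    proof (cases "y j = 0")
      case True
      then show ?thesis by (intro exI[of _ "\<lambda>_. 0"]) simp
    qed (auto simp: F_def)
    then obtain P where P: "\<And>j. y j = (\<Sum>i\<le>m. P j i *s v i)" "\<And>j. y j = 0 \<Longrightarrow> P j = (\<lambda>_. 0)"
      by metis
    have "c i j = P (Suc j) (Suc i) - P j i" if "i < m" "j < m" for i j
    proof -
      have "(P (Suc j) (Suc i) - P j i) - c i j = 0"
      proof (rule independent_functionals[of "\<lambda>i. (P (Suc j) (Suc i) - P j i) - c i j"])
        fix z assume z: "z \<in> V"
        have "A (y (Suc j)) z = (\<Sum>i<m. P (Suc j) (Suc i) * A (v (Suc i)) z)"
          by (subst P(1)) (rule A_F[OF z])
        moreover have "B (y j) z = (\<Sum>i<m. P j i * A (v (Suc i)) z)" by (subst P(1)) (rule B_F[OF z])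
        ultimately show "(\<Sum>i<m. (P (Suc j) (Suc i) - P j i - c i j) * A (v (Suc i)) z) = 0"
          using rel[OF that(2) z] by (simp add: left_diff_distrib sum_subtractf)
      qed (rule that)
      then show ?thesis by simp
    qed
    then have "f \<tau> = (\<Sum>j<m. P (Suc j) (Suc j) - P j j)" by (simp add: f_def cy)
    also have "\<dots> = P m m - P 0 0" by (rule sum_lessThan_telescope)
    also have "\<dots> = 0" using P(2)[of 0] P(2)[of m] y(2) y(3)[of m] by simp
    finally show "f \<tau> = 0" .
  qed (rule \<open>finite I\<close>)
  then obtain k where k: "\<And>\<tau>. \<tau> \<in> Y \<Longrightarrow> f \<tau> = (\<Sum>e\<in>I. k e * g e \<tau>)" by blast
  define e where "e j = (if j < m then \<Sum>e'\<in>I. k e' *s e' j else 0)" for j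
  have eV: "e j \<in> V" for j by (auto simp: e_def I_def intro!: V_closed)
  have system: "f (c, y) = (\<Sum>j<m. (\<Sum>i<m. c i j * A (v (Suc i)) (e j))
      - (A (y (Suc j)) (e j) - B (y j) (e j)))" if "(c, y) \<in> Y" for c y
  proof -
    have "(\<Sum>e'\<in>I. k e' * g e' (c, y)) = (\<Sum>j<m. \<Sum>e'\<in>I. k e' *
        ((\<Sum>i<m. c i j * A (v (Suc i)) (e' j)) - (A (y (Suc j)) (e' j) - B (y j) (e' j))))"
      unfolding g_def by (simp add: sum_distrib_left) (rule sum.swap)
    also have "\<dots> = (\<Sum>j<m. (\<Sum>i<m. c i j * A (v (Suc i)) (e j))
      - (A (y (Suc j)) (e j) - B (y j) (e j)))"
    proof (intro sum.cong refl)
      fix j assume j: "j \<in> {..<m}"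
      have "(\<Sum>i<m. c i j * A (v (Suc i)) (e j)) = (\<Sum>e'\<in>I. \<Sum>i<m. k e' * (c i j * A (v (Suc i)) (e' j)))"
        using j by (subst sum.swap) (simp add: e_def A.bilinear sum_distrib_left mult.left_commute)
      then show "(\<Sum>e'\<in>I. k e' *
        ((\<Sum>i<m. c i j * A (v (Suc i)) (e' j)) - (A (y (Suc j)) (e' j) - B (y j) (e' j)))) =
        (\<Sum>i<m. c i j * A (v (Suc i)) (e j)) - (A (y (Suc j)) (e j) - B (y j) (e j))"
        using j by (simp add: e_def A.bilinear B.bilinear right_diff_distrib sum_subtractf sum_distrib_left)
    qed
    finally show ?thesis using k[OF that] by simp
  qed
  have "A (v (Suc i)) (e j) = (if i = j then 1 else 0)" if ij: "i < m" "j < m" for i j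
  proof -
    \<comment> \<open>A unit vector in \<open>Y\<close> picks out a single equation of the system;
      the vector \<open>?y\<close> below does the same for the chain relation.\<close>
    let ?c = "\<lambda>i' j'. if j' = j then if i' = i then 1 else 0 else (0 :: 'a)"
    have "f (?c, \<lambda>_. 0) = (\<Sum>j'<m. \<Sum>i'<m. ?c i' j' * A (v (Suc i')) (e j'))"
      by (subst system) (auto simp: Y_def A.bilinear B.bilinear)
    also have "\<dots> = (\<Sum>j'<m. if j' = j then (\<Sum>i'<m. if i' = i then A (v (Suc i')) (e j') else 0) else 0)"
      by (intro sum.cong refl) (auto simp: if_distrib[of "\<lambda>c. c * _"] cong: if_cong)
    also have "\<dots> = A (v (Suc i)) (e j)" using ij by simp
    finally show ?thesis using ij by (simp add: f_def) (auto simp: if_distrib cong: if_cong)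
  qed
  moreover have "A (e j) x = B (e (Suc j)) x" if j: "Suc j < m" and x: "x \<in> V" for j x
  proof -
    let ?y = "\<lambda>k. if k = Suc j then x else 0"
    have "f (\<lambda>_ _. 0, ?y) = (\<Sum>k<m. - (A (?y (Suc k)) (e k) - B (?y k) (e k)))"
      using j x by (subst system) (auto simp: Y_def)
    also have "\<dots> = (\<Sum>k<m. (if k = Suc j then B x (e k) else 0) - (if k = j then A x (e k) else 0))"
      by (intro sum.cong refl) (auto simp: A.bilinear B.bilinear)
    also have "\<dots> = B x (e (Suc j)) - A x (e j)" using j by (simp add: sum_subtractf)
    finally show ?thesis by (simp add: f_def A.skew[of "e j"] B.skew[of "e (Suc j)"])
  qed
  ultimately show ?thesis using eV by blast
qed

text \<open>The chain relation and skew symmetry move one step from the first index to the second,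
  until the first index is 0.\<close>

lemma isotropic_v: "A (v i) (v j) = 0" "B (v i) (v j) = 0"
proof -
  have *: "A (v i) (v j) = 0" for i j
  proof (induction i arbitrary: j)
    case (Suc i)
    have "A (v (Suc i)) (v j) = - B (v j) (v i)" using B.skew[of "v j" "v i"] by (simp add: B_v)
    also have "\<dots> = A (v i) (v (Suc j))" using A.skew[of "v i" "v (Suc j)"] by (simp add: B_v)
    finally show ?case using Suc by simp
  qed (simp add: A_v0)
  show "A (v i) (v j) = 0" "B (v i) (v j) = 0" by (simp_all add: * B_v)
qed

text \<open>The chain \<open>v\<close> and its dual chain span a block with both halves isotropic.
  \<open>A\<close> pairs \<open>a j\<close> with \<open>p (Suc j)\<close> and \<open>B\<close> pairs
  it with \<open>p j\<close>, the same shift as between the two rows of \<open>e\<close> in the flat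
  matrices. The block is a summand orthogonal to its complement, which indecomposability
  kills.\<close>

theorem flat_generators:
  obtains e where "\<And>j. e j \<in> V"
    "V = {(\<Sum>j<m. a j *s e j) + (\<Sum>i\<le>m. p i *s v i) | a p. True}"
    "\<And>a p a' p'. A ((\<Sum>j<m. a j *s e j) + (\<Sum>i\<le>m. p i *s v i)) ((\<Sum>j<m. a' j *s e j) + (\<Sum>i\<le>m. p' i *s v i))
       = (\<Sum>j<m. p (Suc j) * a' j - a j * p' (Suc j))"
    "\<And>a p a' p'. B ((\<Sum>j<m. a j *s e j) + (\<Sum>i\<le>m. p i *s v i)) ((\<Sum>j<m. a' j *s e j) + (\<Sum>i\<le>m. p' i *s v i))
       = (\<Sum>j<m. p j * a' j - a j * p' j)"
proof -
  obtain e where e: "\<And>j. e j \<in> V"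
    and dual: "\<And>i j. i < m \<Longrightarrow> j < m \<Longrightarrow> A (v (Suc i)) (e j) = (if i = j then 1 else 0)"
    and e_rel: "\<And>j x. Suc j < m \<Longrightarrow> x \<in> V \<Longrightarrow> A (e j) x = B (e (Suc j)) x"
    using exists_dual_chain by blast
  define s where "s a p = (\<Sum>j<m. a j *s e j) + (\<Sum>i\<le>m. p i *s v i)" for a p
  have sV: "s a p \<in> V" for a p using e by (auto simp: s_def)
  \<comment> \<open>The two indices approach each other in steps of two. They end at
    \<open>A (e i) (e i)\<close> or at
    \<open>A (e i) (e (Suc i)) = B (e (Suc i)) (e (Suc i))\<close>, both zero by
    alternation.\<close>
  have A_ee': "i + d < m \<Longrightarrow> A (e i) (e (i + d)) = 0" for i d
  proof (induction d arbitrary: i rule: induct_nat_012)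
    case 1
    then show ?case using e_rel[of i "e (Suc i)"] e by (simp add: B.alternating)
  next
    case (ge2 d)
    have "A (e i) (e (i + Suc (Suc d))) = - B (e (i + Suc (Suc d))) (e (Suc i))"
      using e_rel[of i "e (i + Suc (Suc d))"] e ge2.prems B.skew[of "e (Suc i)"] by simp
    also have "\<dots> = - A (e (Suc i + d)) (e (Suc i))"
      using e_rel[of "Suc i + d" "e (Suc i)"] e ge2.prems by simp
    also have "\<dots> = A (e (Suc i)) (e (Suc i + d))" using A.skew[of "e (Suc i + d)" "e (Suc i)"] by simp
    also have "\<dots> = 0" using ge2.IH(1)[of "Suc i"] ge2.prems by simp
    finally show ?case .
  qed (simp add: A.alternating)
  have A_ee: "A (e i) (e j) = 0" if "i < m" "j < m" for i j
    using A_ee'[of i "j - i"] A_ee'[of j "i - j"] A.skew[of "e i" "e j"] that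
    by (cases "i \<le> j") auto
  have B_ee: "B (e i) (e j) = 0" if "i < m" "j < m" for i j
  proof (cases i)
    case 0
    then show ?thesis using e_rel[of "j - 1" "e i"] A_ee[of "j - 1" i] e that B.skew[of "e i" "e j"]
      by (cases j) (auto simp: B.alternating)
  next
    case (Suc i')
    then show ?thesis using e_rel[of i' "e j"] A_ee[of i' j] e that by simp
  qed
  have A_ve: "A (v i) (e j) = (if i = Suc j then 1 else 0)" if "j < m" "i \<le> m" for i j
    using that dual[of "i - 1" j] A_v0 e by (cases i) auto
  have B_ve: "B (v i) (e j) = (if i = j then 1 else 0)" if "j < m" "i \<le> m" for i j
    using that dual[of i j] e support[of "Suc i"] by (cases "i = m") (auto simp: B_v A.bilinear)
  have A_ev: "A (e j) (v i) = (if i = Suc j then -1 else 0)" if "j < m" "i \<le> m" for i j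
    using A_ve[OF that] A.skew[of "e j" "v i"] by simp
  have B_ev: "B (e j) (v i) = (if i = j then -1 else 0)" if "j < m" "i \<le> m" for i j
    using B_ve[OF that] B.skew[of "e j" "v i"] by simp
  have A_vs: "A (v i) (s a p) = (case i of 0 \<Rightarrow> 0 | Suc j \<Rightarrow> a j)" if "i \<le> m" for i a p
  proof -
    have "A (v i) (s a p) = (\<Sum>j<m. a j * A (v i) (e j))"
      by (simp add: s_def A.bilinear isotropic_v)
    also have "\<dots> = (\<Sum>j<m. if i = Suc j then a j else 0)"
      using that by (intro sum.cong refl) (simp add: A_ve)
    finally show ?thesis using that by (cases i) auto
  qed
  have B_vs: "B (v i) (s a p) = (if i < m then a i else 0)" if "i \<le> m" for i a p
  proof -
    have "B (v i) (s a p) = (\<Sum>j<m. a j * B (v i) (e j))"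
      by (simp add: s_def B.bilinear isotropic_v)
    also have "\<dots> = (\<Sum>j<m. if i = j then a j else 0)"
      using that by (intro sum.cong refl) (simp add: B_ve)
    finally show ?thesis by auto
  qed
  have A_es: "A (e j) (s a p) = - p (Suc j)" if "j < m" for j a p
  proof -
    have "A (e j) (s a p) = (\<Sum>i\<le>m. p i * A (e j) (v i))"
      using that by (simp add: s_def A.bilinear A_ee)
    also have "\<dots> = (\<Sum>i\<le>m. if i = Suc j then - p i else 0)"
      using that by (intro sum.cong refl) (simp add: A_ev)
    finally show ?thesis using that by simp
  qed
  have B_es: "B (e j) (s a p) = - p j" if "j < m" for j a p
  proof -
    have "B (e j) (s a p) = (\<Sum>i\<le>m. p i * B (e j) (v i))"
      using that by (simp add: s_def B.bilinear B_ee)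
    also have "\<dots> = (\<Sum>i\<le>m. if i = j then - p i else 0)"
      using that by (intro sum.cong refl) (simp add: B_ev)
    finally show ?thesis using that by simp
  qed
  have A_ss: "A (s a p) (s a' p') = (\<Sum>j<m. p (Suc j) * a' j - a j * p' (Suc j))" for a p a' p'
  proof -
    have "A (s a p) (s a' p') = (\<Sum>j<m. a j * A (e j) (s a' p')) + (\<Sum>i\<le>m. p i * A (v i) (s a' p'))"
      by (subst s_def) (simp add: A.add_left A.sum_left A.scale_left)
    also have "(\<Sum>i\<le>m. p i * A (v i) (s a' p')) = (\<Sum>j<m. p (Suc j) * a' j)"
      unfolding sum.atMost_shift by (simp add: A_vs)
    also have "(\<Sum>j<m. a j * A (e j) (s a' p')) = (\<Sum>j<m. - (a j * p' (Suc j)))"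
      by (simp add: A_es)
    finally show ?thesis by (simp add: sum_subtractf sum_negf)
  qed
  have B_ss: "B (s a p) (s a' p') = (\<Sum>j<m. p j * a' j - a j * p' j)" for a p a' p'
  proof -
    have "B (s a p) (s a' p') = (\<Sum>j<m. a j * B (e j) (s a' p')) + (\<Sum>i\<le>m. p i * B (v i) (s a' p'))"
      by (subst s_def) (simp add: B.add_left B.sum_left B.scale_left)
    also have "(\<Sum>i\<le>m. p i * B (v i) (s a' p')) = (\<Sum>j<m. p j * a' j)"
      by (simp add: B_vs flip: lessThan_Suc_atMost)
    also have "(\<Sum>j<m. a j * B (e j) (s a' p')) = (\<Sum>j<m. - (a j * p' j))"
      by (simp add: B_es)
    finally show ?thesis by (simp add: sum_subtractf sum_negf)
  qed
  define X where "X = {s a p | a p. True}"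
  define U where "U = {u \<in> V. \<forall>x\<in>X. A x u = 0 \<and> B x u = 0}"
  have s_add: "s a p + s a' p' = s (\<lambda>j. a j + a' j) (\<lambda>i. p i + p' i)" for a p a' p'
    by (simp add: s_def scale_left_distrib sum.distrib)
  have s_scale: "c *s s a p = s (\<lambda>j. c * a j) (\<lambda>i. c * p i)" for c a p
    by (simp add: s_def scale_right_distrib scale_sum_right)
  have s_0: "s (\<lambda>_. 0) (\<lambda>_. 0) = 0" by (simp add: s_def)
  have sX: "subspace X"
    by (rule subspaceI) (auto simp: X_def s_add s_scale, metis s_0, blast+)
  have sU: "subspace U" by (rule subspaceI) (auto simp: U_def A.bilinear B.bilinear)
  have v_s: "v i = s (\<lambda>_. 0) (\<lambda>k. if k = i then 1 else 0)" if "i \<le> m" for i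
    using that by (simp add: s_def if_distrib[of "\<lambda>c. c *s _"] cong: if_cong)
  have e_s: "e j = s (\<lambda>k. if k = j then 1 else 0) (\<lambda>_. 0)" if "j < m" for j
    using that by (simp add: s_def if_distrib[of "\<lambda>c. c *s _"] cong: if_cong)
  have vX: "i \<le> m \<Longrightarrow> v i \<in> X" for i using v_s X_def by blast
  have eX: "j < m \<Longrightarrow> e j \<in> X" for j using e_s X_def by blast
  have decomp: "\<exists>x\<in>X. \<exists>u\<in>U. w = x + u" if w: "w \<in> V" for w
  proof -
    \<comment> \<open>First \<open>w\<close> is made orthogonal to all \<open>v i\<close> by
      subtracting a combination of the \<open>e j\<close>; then \<open>p\<close> corrects it against
      the \<open>e j\<close> without disturbing this, because the \<open>v i\<close> are
      isotropic.\<close>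
    define a where "a j = A (v (Suc j)) w" for j
    define w1 where "w1 = w - s a (\<lambda>_. 0)"
    have w1V: "w1 \<in> V" using w sV by (simp add: w1_def)
    \<comment> \<open>Only \<open>B (e 0)\<close> needs its own condition: for \<open>j > 0\<close>,
      \<open>B (e j)\<close> equals \<open>A (e (j - 1))\<close> on \<open>V\<close>.\<close>
    define p where "p i = (case i of 0 \<Rightarrow> B (e 0) w1 | Suc j \<Rightarrow> A (e j) w1)" for i
    define u where "u = w1 + s (\<lambda>_. 0) p"
    have A_v: "A (v i) u = 0" if "i \<le> m" for i
      using that w by (auto simp: u_def w1_def A.bilinear A_vs a_def A_v0 split: nat.split)
    have B_v': "B (v i) u = 0" if "i \<le> m" for i
      using that A_v[of "Suc i"] support[of "Suc i"] w1V sV by (cases "i = m") (auto simp: B_v A.bilinear u_def)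
    have A_e: "A (e j) u = 0" if "j < m" for j
      using that by (simp add: u_def A.add_right A_es p_def)
    have B_e: "B (e j) u = 0" if "j < m" for j
      using that e_rel[of "j - 1" w1] w1V by (cases j) (auto simp: u_def B.add_right B_es p_def)
    have "A (s a' p') u = 0 \<and> B (s a' p') u = 0" for a' p'
      unfolding s_def A.add_left A.sum_left A.scale_left B.add_left B.sum_left B.scale_left
      by (simp add: A_v B_v' A_e B_e)
    then have "u \<in> U" using w1V sV by (auto simp: U_def X_def u_def)
    moreover have "s a (\<lambda>i. - p i) + s (\<lambda>_. 0) p = s a (\<lambda>_. 0)" by (simp add: s_add)
    then have "w = s a (\<lambda>i. - p i) + u" by (simp add: u_def w1_def algebra_simps)
    ultimately show "\<exists>x\<in>X. \<exists>u\<in>U. w = x + u" unfolding X_def by blast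
  qed
  have "X = {0} \<or> U = {0}"
  proof (rule indecomposable)
    have "x = 0" if "x \<in> X" "x \<in> U" for x
    proof -
      obtain a p where x: "x = s a p" using \<open>x \<in> X\<close> by (auto simp: X_def)
      have orth: "A y x = 0 \<and> B y x = 0" if "y \<in> X" for y using \<open>x \<in> U\<close> that by (simp add: U_def)
      have "a j = 0" if "j < m" for j using orth[OF vX[of j]] B_vs[of j a p] that x by simp
      moreover have "p i = 0" if "i \<le> m" for i
        using orth[OF eX[of "i - 1"]] orth[OF eX[of i]] A_es[of "i - 1" a p] B_es[of i a p] that x m_pos
        by (cases "i = m") auto
      ultimately show ?thesis by (simp add: x s_def)
    qed
    then show "X \<inter> U = {0}" using subspace_0[OF sX] subspace_0[OF sU] by blast
  qed (use decomp sX sU sV in \<open>auto simp: U_def X_def\<close>)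
  moreover have "X \<noteq> {0}" using vX[of m] v_m by auto
  ultimately have U: "U = {0}" by blast
  have "V \<subseteq> X" using decomp U by fastforce
  then have "V = {s a p | a p. True}" using sV by (auto simp: X_def)
  then show ?thesis using that[of e] e A_ss B_ss unfolding s_def by blast
qed

end

section \<open>Groups with a given commutation bimap\<close>

text \<open>In a faithful model \<open>\<alpha>\<close> induces \<open>H/Z(H) \<cong> U\<close>, and \<open>\<omega>\<close> embeds \<open>H'\<close> into an additive group, so that
  the commutation bimap becomes \<open>b\<close>.\<close>

locale bimap_model = group H for H (structure) +
  fixes U :: "'u :: ab_group_add set" and b :: "'u \<Rightarrow> 'u \<Rightarrow> 'w :: ab_group_add"
    and \<alpha> Z and \<omega> :: "'a \<Rightarrow> 'w"
  assumes \<alpha>_image: "\<alpha> ` carrier H = U"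
    and \<alpha>_mult: "x \<in> carrier H \<Longrightarrow> y \<in> carrier H \<Longrightarrow> \<alpha> (x \<otimes> y) = \<alpha> x + \<alpha> y"
    and subgroup_Z: "subgroup Z H"
    and commutator_Z: "x \<in> carrier H \<Longrightarrow> y \<in> carrier H \<Longrightarrow> commutator H x y \<in> Z"
    and \<alpha>_Z: "z \<in> Z \<Longrightarrow> \<alpha> z = 0"
    and \<omega>_mult: "z \<in> Z \<Longrightarrow> z' \<in> Z \<Longrightarrow> \<omega> (z \<otimes> z') = \<omega> z + \<omega> z'"
    and \<omega>_commutator: "x \<in> carrier H \<Longrightarrow> y \<in> carrier H \<Longrightarrow> \<omega> (commutator H x y) = b (\<alpha> x) (\<alpha> y)"
begin

lemma commutator_closed [simp]:
  "x \<in> carrier H \<Longrightarrow> y \<in> carrier H \<Longrightarrow> commutator H x y \<in> carrier H"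
  by (simp add: commutator_def)

lemma Z_carrier: "z \<in> Z \<Longrightarrow> z \<in> carrier H"
  using subgroup.mem_carrier[OF subgroup_Z] .

lemma \<alpha>_one: "\<alpha> \<one> = 0" using \<alpha>_mult[of \<one> \<one>] by simp

lemma \<alpha>_inv: "x \<in> carrier H \<Longrightarrow> \<alpha> (inv x) = - \<alpha> x"
  using \<alpha>_mult[of "inv x" x] by (simp add: \<alpha>_one eq_neg_iff_add_eq_0)

lemma \<alpha>_U [simp, intro]: "x \<in> carrier H \<Longrightarrow> \<alpha> x \<in> U"
  using \<alpha>_image by blast

lemma \<omega>_one: "\<omega> \<one> = 0"
  using \<omega>_mult[of \<one> \<one>] subgroup.one_closed[OF subgroup_Z] by simp

lemma \<omega>_inv: "z \<in> Z \<Longrightarrow> \<omega> (inv z) = - \<omega> z"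
  using \<omega>_mult[of "inv z" z] subgroup.m_inv_closed[OF subgroup_Z, of z] Z_carrier[of z]
  by (simp add: \<omega>_one eq_neg_iff_add_eq_0)

lemma derived_subset: "derived H (carrier H) \<subseteq> Z"
  unfolding derived_def
  by (rule generate_subgroup_incl[OF _ subgroup_Z]) (use commutator_Z in \<open>auto simp: commutator_def\<close>)

lemma derived_induct [consumes 1, case_names commutator mult inv]:
  assumes "z \<in> derived H (carrier H)"
    and "\<And>x y. x \<in> carrier H \<Longrightarrow> y \<in> carrier H \<Longrightarrow> P (commutator H x y)"
    and "\<And>z z'. z \<in> derived H (carrier H) \<Longrightarrow> z' \<in> derived H (carrier H) \<Longrightarrow> P z \<Longrightarrow> P z' \<Longrightarrow> P (z \<otimes> z')"
    and "\<And>z. z \<in> derived H (carrier H) \<Longrightarrow> P z \<Longrightarrow> P (inv z)"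
  shows "P z"
  using assms(1) unfolding derived_def
proof (induction rule: generate.induct)
  case one
  then show ?case using assms(2)[of \<one> \<one>] by (simp add: commutator_def)
next
  case (incl h)
  then show ?case using assms(2) by (auto simp: commutator_def)
next
  case (inv h)
  then have "P h" "h \<in> derived H (carrier H)"
    using assms(2) by (auto simp: commutator_def derived_def intro: generate.incl)
  then show ?case using assms(4) by blast
next
  case (eng h1 h2)
  then show ?case using assms(3) by (auto simp: derived_def)
qed

lemma commutator_derived: "x \<in> carrier H \<Longrightarrow> y \<in> carrier H \<Longrightarrow> commutator H x y \<in> derived H (carrier H)"
  unfolding derived_def commutator_def by (rule generate.incl) blast

end

text \<open>The values on the derived subgroup form the additive group generated by the values of
  \<open>b\<close>, which is the same for every model of \<open>b\<close>.\<close>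

lemma derived_value_transfer:
  assumes "bimap_model G U b \<alpha> Z \<omega>" "bimap_model H U b \<beta> Y \<eta>" "z \<in> derived G (carrier G)"
  shows "\<exists>w\<in>derived H (carrier H). \<eta> w = \<omega> z"
proof -
  interpret G: bimap_model G U b \<alpha> Z \<omega> by fact
  interpret H: bimap_model H U b \<beta> Y \<eta> by fact
  have lift: "\<exists>y\<in>carrier H. \<beta> y = \<alpha> x" if "x \<in> carrier G" for x
    using G.\<alpha>_U[OF that] unfolding H.\<alpha>_image[symmetric] by (metis imageE)
  show ?thesis
    using assms(3)
  proof (induction rule: G.derived_induct)
    case (commutator x x')
    then obtain y y' where "y \<in> carrier H" "\<beta> y = \<alpha> x" "y' \<in> carrier H" "\<beta> y' = \<alpha> x'"
      using lift[OF commutator(1)] lift[OF commutator(2)] by blast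
    then show ?case
      using commutator by (intro bexI[of _ "commutator H y y'"])
        (auto simp: G.\<omega>_commutator H.\<omega>_commutator H.commutator_derived)
  next
    case (mult z z')
    then obtain w w' where w: "w \<in> derived H (carrier H)" "\<eta> w = \<omega> z" "w' \<in> derived H (carrier H)" "\<eta> w' = \<omega> z'"
      by blast
    moreover have "w \<otimes>\<^bsub>H\<^esub> w' \<in> derived H (carrier H)"
      using w H.derived_is_subgroup[of "carrier H"] by (simp add: subgroup.m_closed)
    ultimately show ?case using mult G.derived_subset H.derived_subset
      by (intro bexI[of _ "w \<otimes>\<^bsub>H\<^esub> w'"]) (auto simp: G.\<omega>_mult H.\<omega>_mult subset_iff)
  next
    case (inv z)
    then obtain w where w: "w \<in> derived H (carrier H)" "\<eta> w = \<omega> z" by blast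
    moreover have "inv\<^bsub>H\<^esub> w \<in> derived H (carrier H)"
      using w H.derived_is_subgroup[of "carrier H"] by (simp add: subgroup.m_inv_closed)
    ultimately show ?case using inv G.derived_subset H.derived_subset
      by (intro bexI[of _ "inv\<^bsub>H\<^esub> w"]) (auto simp: G.\<omega>_inv H.\<omega>_inv subset_iff)
  qed
qed

text \<open>Nondegeneracy of \<open>b\<close> makes the kernel of \<open>\<alpha>\<close> exactly
  the centre, and injectivity of \<open>\<omega>\<close> makes the derived subgroup determined by
  its values.\<close>

locale faithful_bimap_model = bimap_model +
  assumes \<omega>_inj: "inj_on \<omega> Z"
    and b_nondegenerate: "u \<in> U \<Longrightarrow> (\<And>v. v \<in> U \<Longrightarrow> b u v = 0) \<Longrightarrow> u = 0"
begin

abbreviation coset :: "'a \<Rightarrow> 'a set" where "coset x \<equiv> group_center H #> x"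

lemma commutator_eq_iff:
  assumes "x \<in> carrier H" "y \<in> carrier H" "x' \<in> carrier H" "y' \<in> carrier H"
  shows "commutator H x y = commutator H x' y' \<longleftrightarrow> b (\<alpha> x) (\<alpha> y) = b (\<alpha> x') (\<alpha> y')"
  using inj_on_eq_iff[OF \<omega>_inj commutator_Z commutator_Z, of x y x' y'] assms by (simp add: \<omega>_commutator)

lemma commute_iff:
  assumes "x \<in> carrier H" "y \<in> carrier H"
  shows "x \<otimes> y = y \<otimes> x \<longleftrightarrow> b (\<alpha> x) (\<alpha> y) = 0"
proof -
  have "commutator H x y = (x \<otimes> y) \<otimes> inv (y \<otimes> x)"
    using assms by (simp add: commutator_def inv_mult_group m_assoc)
  then have "x \<otimes> y = y \<otimes> x \<longleftrightarrow> commutator H x y = \<one>"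
    using assms inv_solve_right'[of \<one> "x \<otimes> y" "y \<otimes> x"] by simp
  also have "\<dots> \<longleftrightarrow> \<omega> (commutator H x y) = \<omega> \<one>"
    using inj_on_eq_iff[OF \<omega>_inj commutator_Z subgroup.one_closed[OF subgroup_Z]] assms by simp
  finally show ?thesis using assms by (simp add: \<omega>_one \<omega>_commutator)
qed

lemma b_zero_left: "v \<in> U \<Longrightarrow> b 0 v = 0"
proof -
  assume "v \<in> U"
  then obtain y where "y \<in> carrier H" "v = \<alpha> y" using \<alpha>_image by blast
  then show ?thesis using commute_iff[of \<one> y] by (simp add: \<alpha>_one)
qed

lemma center_eq: "group_center H = {x \<in> carrier H. \<alpha> x = 0}"
proof -
  have "(\<forall>y\<in>carrier H. x \<otimes> y = y \<otimes> x) \<longleftrightarrow> \<alpha> x = 0" if x: "x \<in> carrier H" for x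
  proof
    assume "\<forall>y\<in>carrier H. x \<otimes> y = y \<otimes> x"
    then have "b (\<alpha> x) v = 0" if "v \<in> U" for v using that x commute_iff[of x] \<alpha>_image by blast
    then show "\<alpha> x = 0" using b_nondegenerate x by blast
  next
    assume "\<alpha> x = 0"
    then show "\<forall>y\<in>carrier H. x \<otimes> y = y \<otimes> x" using x commute_iff[of x] b_zero_left by auto
  qed
  then show ?thesis unfolding group_center_def by blast
qed

lemma normal_center: "group_center H \<lhd> H"
proof (rule normal_invI)
  show "subgroup (group_center H) H"
    by (rule subgroup.intro) (auto simp: center_eq \<alpha>_one \<alpha>_inv \<alpha>_mult)
  show "x \<otimes> h \<otimes> inv x \<in> group_center H" if "x \<in> carrier H" "h \<in> group_center H" for x h
    using that by (auto simp: center_eq \<alpha>_mult \<alpha>_inv)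
qed

lemma coset_eq:
  assumes x: "x \<in> carrier H"
  shows "coset x = {y \<in> carrier H. \<alpha> y = \<alpha> x}"
proof
  show "coset x \<subseteq> {y \<in> carrier H. \<alpha> y = \<alpha> x}"
    using x by (auto simp: r_coset_def center_eq \<alpha>_mult)
  show "{y \<in> carrier H. \<alpha> y = \<alpha> x} \<subseteq> coset x"
  proof
    fix y assume y: "y \<in> {y \<in> carrier H. \<alpha> y = \<alpha> x}"
    then have "y \<otimes> inv x \<in> group_center H" using x by (simp add: center_eq \<alpha>_mult \<alpha>_inv)
    moreover have "y = y \<otimes> inv x \<otimes> x" using x y by (simp add: m_assoc)
    ultimately show "y \<in> coset x" by (auto simp: r_coset_def)
  qed
qed

lemma central_factor_carrier: "carrier (central_factor H) = coset ` carrier H"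
  by (rule carrier_FactGroup)

lemma coset_mult:
  "x \<in> carrier H \<Longrightarrow> y \<in> carrier H \<Longrightarrow>
    (coset x) \<otimes>\<^bsub>central_factor H\<^esub> (coset y) = coset (x \<otimes> y)"
  using normal.rcos_sum[OF normal_center] by simp

lemma commutation_bimap_coset:
  assumes x: "x \<in> carrier H" and y: "y \<in> carrier H"
  shows "commutation_bimap H (coset x) (coset y) = commutator H x y"
proof -
  have "{commutator H x' y' | x' y'. x' \<in> coset x \<and> y' \<in> coset y} = {commutator H x y}"
  proof (intro equalityI subsetI)
    fix c assume "c \<in> {commutator H x' y' | x' y'. x' \<in> coset x \<and> y' \<in> coset y}"
    then show "c \<in> {commutator H x y}"
      using commutator_eq_iff[OF _ _ x y] by (auto simp: coset_eq x y)
  next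
    fix c assume "c \<in> {commutator H x y}"
    then show "c \<in> {commutator H x' y' | x' y'. x' \<in> coset x \<and> y' \<in> coset y}"
      using x y unfolding coset_eq[OF x] coset_eq[OF y] by blast
  qed
  then show ?thesis by (simp add: commutation_bimap_def)
qed

end

text \<open>Cosets of the centres are matched by their common value in \<open>U\<close>, and
  elements of the derived subgroups by their common value under \<open>\<omega>\<close> and
  \<open>\<eta>\<close>.\<close>

theorem faithful_models_isoclinic:
  assumes "faithful_bimap_model G U b \<alpha> Z \<omega>" "faithful_bimap_model H U b \<beta> Y \<eta>"
  shows "isoclinic G H"
proof -
  interpret G: faithful_bimap_model G U b \<alpha> Z \<omega> by fact
  interpret H: faithful_bimap_model H U b \<beta> Y \<eta> by fact
  define f where "f C = {y \<in> carrier H. \<beta> y \<in> \<alpha> ` C}" for C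
  have f: "f (G.coset x) = H.coset y"
    if "x \<in> carrier G" "y \<in> carrier H" "\<beta> y = \<alpha> x" for x y
    unfolding f_def G.coset_eq[OF that(1)] H.coset_eq[OF that(2)] using that by auto
  have ex_H: "\<exists>y\<in>carrier H. \<beta> y = \<alpha> x" if "x \<in> carrier G" for x
    using G.\<alpha>_U[OF that] unfolding H.\<alpha>_image[symmetric] by (metis imageE)
  have ex_G: "\<exists>x\<in>carrier G. \<beta> y = \<alpha> x" if "y \<in> carrier H" for y
    using H.\<alpha>_U[OF that] unfolding G.\<alpha>_image[symmetric] by (metis imageE)
  have f_iso: "f \<in> iso (central_factor G) (central_factor H)"
  proof (rule isoI)
    have "f (A \<otimes>\<^bsub>central_factor G\<^esub> B) = f A \<otimes>\<^bsub>central_factor H\<^esub> f B \<and> f A \<in> carrier (central_factor H)"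
      if A: "A \<in> carrier (central_factor G)" and B: "B \<in> carrier (central_factor G)" for A B
    proof -
      obtain x x' where x: "x \<in> carrier G" "A = G.coset x"
        and x': "x' \<in> carrier G" "B = G.coset x'"
        using A B unfolding G.central_factor_carrier by blast
      obtain y y' where y: "y \<in> carrier H" "\<beta> y = \<alpha> x" and y': "y' \<in> carrier H" "\<beta> y' = \<alpha> x'"
        using ex_H[OF x(1)] ex_H[OF x'(1)] by blast
      have "f (A \<otimes>\<^bsub>central_factor G\<^esub> B) = H.coset (y \<otimes>\<^bsub>H\<^esub> y')"
        unfolding x(2) x'(2) G.coset_mult[OF x(1) x'(1)]
        by (rule f) (use x x' y y' in \<open>simp_all add: G.\<alpha>_mult H.\<alpha>_mult\<close>)
      then show ?thesis
        using f[OF x(1) y] f[OF x'(1) y'] H.coset_mult[OF y(1) y'(1)] x(2) x'(2) y(1)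
        by (simp add: H.central_factor_carrier)
    qed
    then show "f \<in> hom (central_factor G) (central_factor H)" unfolding hom_def by blast
    show "bij_betw f (carrier (central_factor G)) (carrier (central_factor H))"
    proof (rule bij_betw_imageI)
      show "inj_on f (carrier (central_factor G))"
      proof (rule inj_onI)
        fix A B assume "A \<in> carrier (central_factor G)" "B \<in> carrier (central_factor G)" and eq: "f A = f B"
        then obtain x x' where x: "x \<in> carrier G" "A = G.coset x"
          and x': "x' \<in> carrier G" "B = G.coset x'"
          unfolding G.central_factor_carrier by blast
        obtain y where y: "y \<in> carrier H" "\<beta> y = \<alpha> x" using ex_H x(1) by blast
        have "y \<in> f A" unfolding x(2) f[OF x(1) y] H.coset_eq[OF y(1)] using y by simp
        then have "y \<in> f B" using eq by simp
        then have "\<alpha> x = \<alpha> x'" using y x' by (auto simp: f_def G.coset_eq)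
        then show "A = B" using x x' by (simp add: G.coset_eq)
      qed
      show "f ` carrier (central_factor G) = carrier (central_factor H)"
        unfolding G.central_factor_carrier H.central_factor_carrier image_image
      proof (intro equalityI subsetI)
        fix C assume "C \<in> (\<lambda>x. f (G.coset x)) ` carrier G"
        then show "C \<in> H.coset ` carrier H" using f ex_H by blast
      next
        fix C assume "C \<in> H.coset ` carrier H"
        then show "C \<in> (\<lambda>x. f (G.coset x)) ` carrier G" using f ex_G by blast
      qed
    qed
  qed
  note eta_ex = derived_value_transfer[OF G.bimap_model_axioms H.bimap_model_axioms]
  note omega_ex = derived_value_transfer[OF H.bimap_model_axioms G.bimap_model_axioms]
  \<comment> \<open>The inverse of \<open>\<eta>\<close> after \<open>\<omega>\<close>: a value
    exists by the transfer of derived values, and is unique because \<open>\<eta>\<close> is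
    injective on \<open>Y\<close>.\<close>
  define g where "g z = (SOME w. w \<in> derived H (carrier H) \<and> \<eta> w = \<omega> z)" for z
  have g: "g z \<in> derived H (carrier H) \<and> \<eta> (g z) = \<omega> z" if "z \<in> derived G (carrier G)" for z
    unfolding g_def by (rule someI_ex) (use eta_ex[OF that] in blast)
  have g_eq: "g z = w" if "z \<in> derived G (carrier G)" "w \<in> derived H (carrier H)" "\<eta> w = \<omega> z" for z w
  proof (rule inj_onD[OF H.\<omega>_inj])
    show "\<eta> (g z) = \<eta> w" using g[OF that(1)] that(3) by simp
    show "g z \<in> Y" "w \<in> Y" using g[OF that(1)] that(2) H.derived_subset by blast+
  qed
  have g_iso: "g \<in> iso (derived_group G) (derived_group H)"
  proof (rule isoI)
    show "g \<in> hom (derived_group G) (derived_group H)"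
    proof (rule homI)
      show "g z \<in> carrier (derived_group H)" if "z \<in> carrier (derived_group G)" for z
        using g[of z] that by simp
      fix z z' assume "z \<in> carrier (derived_group G)" "z' \<in> carrier (derived_group G)"
      then have z: "z \<in> derived G (carrier G)" "z' \<in> derived G (carrier G)" by simp_all
      note gz = g[OF z(1)] g[OF z(2)]
      have m: "z \<otimes>\<^bsub>G\<^esub> z' \<in> derived G (carrier G)"
        using z G.derived_is_subgroup[of "carrier G"] by (simp add: subgroup.m_closed)
      have m': "g z \<otimes>\<^bsub>H\<^esub> g z' \<in> derived H (carrier H)"
        using gz H.derived_is_subgroup[of "carrier H"] by (simp add: subgroup.m_closed)
      have "g (z \<otimes>\<^bsub>G\<^esub> z') = g z \<otimes>\<^bsub>H\<^esub> g z'"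
      proof (rule g_eq[OF m m'])
        have "z \<in> Z" "z' \<in> Z" "g z \<in> Y" "g z' \<in> Y" using z gz G.derived_subset H.derived_subset by blast+
        then show "\<eta> (g z \<otimes>\<^bsub>H\<^esub> g z') = \<omega> (z \<otimes>\<^bsub>G\<^esub> z')" using gz by (simp add: G.\<omega>_mult H.\<omega>_mult)
      qed
      then show "g (z \<otimes>\<^bsub>derived_group G\<^esub> z') = g z \<otimes>\<^bsub>derived_group H\<^esub> g z'" by simp
    qed
    have "inj_on g (derived G (carrier G))"
    proof (rule inj_onI)
      fix z z' assume z: "z \<in> derived G (carrier G)" "z' \<in> derived G (carrier G)" "g z = g z'"
      then have "\<omega> z = \<omega> z'" using g[OF z(1)] g[OF z(2)] by simp
      moreover have "z \<in> Z" "z' \<in> Z" using z G.derived_subset by blast+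
      ultimately show "z = z'" by (rule inj_onD[OF G.\<omega>_inj])
    qed
    moreover have "g ` derived G (carrier G) = derived H (carrier H)"
    proof (intro equalityI subsetI)
      fix w assume w: "w \<in> derived H (carrier H)"
      then obtain z where "z \<in> derived G (carrier G)" "\<eta> w = \<omega> z" using omega_ex by metis
      then show "w \<in> g ` derived G (carrier G)" using g_eq[of z w] w by blast
    next
      fix w assume "w \<in> g ` derived G (carrier G)"
      then obtain z where "z \<in> derived G (carrier G)" "w = g z" by blast
      then show "w \<in> derived H (carrier H)" using g[of z] by simp
    qed
    ultimately show "bij_betw g (carrier (derived_group G)) (carrier (derived_group H))"
      by (simp add: bij_betw_def)
  qed
  have "commutation_bimap H (f A) (f B) = g (commutation_bimap G A B)"
    if A: "A \<in> carrier (central_factor G)" and B: "B \<in> carrier (central_factor G)" for A B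
  proof -
    obtain x x' where x: "x \<in> carrier G" "A = G.coset x"
      and x': "x' \<in> carrier G" "B = G.coset x'"
      using A B unfolding G.central_factor_carrier by blast
    obtain y y' where y: "y \<in> carrier H" "\<beta> y = \<alpha> x" and y': "y' \<in> carrier H" "\<beta> y' = \<alpha> x'"
      using ex_H[OF x(1)] ex_H[OF x'(1)] by blast
    have "g (commutator G x x') = commutator H y y'"
      by (rule g_eq) (simp_all add: G.commutator_derived H.commutator_derived
          G.\<omega>_commutator H.\<omega>_commutator x(1) x'(1) y y')
    then show ?thesis
      unfolding x(2) x'(2) f[OF x(1) y] f[OF x'(1) y']
        G.commutation_bimap_coset[OF x(1) x'(1)] H.commutation_bimap_coset[OF y(1) y'(1)] by simp
  qed
  then show ?thesis unfolding isoclinic_def using f_iso g_iso by blast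
qed

section \<open>The group \<open>H\<^sup>\<flat>\<close>\<close>

lemma (in group) commutator_eqI:
  assumes "x \<in> carrier G" "y \<in> carrier G" "c \<in> carrier G" "c \<otimes> (y \<otimes> x) = x \<otimes> y"
  shows "commutator G x y = c"
proof -
  have "commutator G x y = (x \<otimes> y) \<otimes> inv (y \<otimes> x)"
    using assms by (simp add: commutator_def inv_mult_group m_assoc)
  also have "\<dots> = c" using assms(1-3) unfolding assms(4)[symmetric] by (simp add: m_assoc)
  finally show ?thesis .
qed

text \<open>With the last row and column split off, the remaining block is additive in
  \<open>e\<close>, and acts on the last column by adding a bilinear term to
  \<open>w\<close>.\<close>

definition flat_left :: "nat \<Rightarrow> (nat \<Rightarrow> 'k :: field) \<Rightarrow> 'k mat" where
  "flat_left m e = four_block_mat (1\<^sub>m 2) (flat_row_block m e) (0\<^sub>m (m + 1) 2) (1\<^sub>m (m + 1))"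

definition flat_right :: "nat \<Rightarrow> (nat \<Rightarrow> 'k :: field) \<Rightarrow> (nat \<Rightarrow> 'k) \<Rightarrow> 'k mat" where
  "flat_right m f w = mat 2 1 (\<lambda>(i, _). w (i + 1)) @\<^sub>r mat (m + 1) 1 (\<lambda>(i, _). f i)"

text \<open>Row \<open>i\<close> (1 or 2) of the \<open>e\<close>-block times the column
  \<open>f\<close>; the second row is shifted by one place, which accounts for
  \<open>j + i - 1\<close>.\<close>

definition flat_dot :: "nat \<Rightarrow> (nat \<Rightarrow> 'k :: field) \<Rightarrow> (nat \<Rightarrow> 'k) \<Rightarrow> nat \<Rightarrow> 'k" where
  "flat_dot m e f i = (\<Sum>j<m. e (j + 1) * f (j + i - 1))"

lemma flat_row_block_carrier [simp]: "flat_row_block m e \<in> carrier_mat 2 (Suc m)"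
  by (simp add: flat_row_block_def)

lemma flat_left_carrier [simp]: "flat_left m e \<in> carrier_mat (m + 3) (m + 3)"
  unfolding flat_left_def using four_block_carrier_mat[of "1\<^sub>m 2" 2 2 "1\<^sub>m (m + 1)" "m + 1" "m + 1"]
  by (simp add: numeral_3_eq_3)

lemma flat_right_carrier [simp]: "flat_right m f w \<in> carrier_mat (m + 3) (Suc 0)"
  unfolding flat_right_def append_rows_def by (rule carrier_matI) simp_all

lemma flat_mat_blocks: "flat_mat m e f w = four_block_mat (flat_left m e) (flat_right m f w) (0\<^sub>m 1 (m + 3)) (1\<^sub>m 1)"
  by (simp add: flat_mat_def flat_left_def flat_right_def)

lemma flat_mat_carrier [simp]: "flat_mat m e f w \<in> carrier_mat (m + 4) (m + 4)"
  unfolding flat_mat_blocks using four_block_carrier_mat[OF flat_left_carrier[of m e], of "1\<^sub>m 1" 1 1]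
  by (simp add: numeral_eq_Suc)

lemma flat_left_mult: "flat_left m e * flat_left m e' = flat_left m (\<lambda>i. e i + e' i)"
proof -
  have "flat_left m e * flat_left m e' =
    four_block_mat (1\<^sub>m 2 * 1\<^sub>m 2 + flat_row_block m e * 0\<^sub>m (m + 1) 2)
      (1\<^sub>m 2 * flat_row_block m e' + flat_row_block m e * 1\<^sub>m (m + 1))
      (0\<^sub>m (m + 1) 2 * 1\<^sub>m 2 + 1\<^sub>m (m + 1) * 0\<^sub>m (m + 1) 2)
      (0\<^sub>m (m + 1) 2 * flat_row_block m e' + 1\<^sub>m (m + 1) * 1\<^sub>m (m + 1))"
    unfolding flat_left_def by (rule mult_four_block_mat[where ?nr1.0 = 2 and ?n1.0 = 2 and ?n2.0 = "m + 1" and ?nr2.0 = "m + 1"]) auto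
  also have "\<dots> = flat_left m (\<lambda>i. e i + e' i)"
    unfolding flat_left_def
    by (rule arg_cong4[where f = four_block_mat])
      (auto simp: flat_row_block_def intro!: eq_matI)
  finally show ?thesis .
qed

lemma flat_left_right:
  "flat_left m e * flat_right m f w = flat_right m f (\<lambda>i. w i + flat_dot m e f i)"
proof -
  let ?W = "mat 2 1 (\<lambda>(i, _). w (i + 1))" and ?f = "mat (m + 1) 1 (\<lambda>(i, _). f i)"
  have "flat_left m e * flat_right m f w =
    four_block_mat (1\<^sub>m 2 * ?W + flat_row_block m e * ?f)
      (1\<^sub>m 2 * 0\<^sub>m 2 0 + flat_row_block m e * 0\<^sub>m (m + 1) 0)
      (0\<^sub>m (m + 1) 2 * ?W + 1\<^sub>m (m + 1) * ?f)
      (0\<^sub>m (m + 1) 2 * 0\<^sub>m 2 0 + 1\<^sub>m (m + 1) * 0\<^sub>m (m + 1) 0)"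
    \<comment> \<open>Appending rows is a block matrix whose right-hand blocks have no
      columns.\<close>
    unfolding flat_left_def flat_right_def append_rows_def
    by (subst mult_four_block_mat[where ?nr1.0 = 2 and ?n1.0 = 2 and ?n2.0 = "m + 1" and ?nr2.0 = "m + 1"]) auto
  also have "\<dots> = flat_right m f (\<lambda>i. w i + flat_dot m e f i)"
  proof -
    have "flat_row_block m e * ?f = mat 2 1 (\<lambda>(i, _). flat_dot m e f (i + 1))" (is "?L = ?R")
    proof (rule eq_matI)
      fix i j assume "i < dim_row ?R" "j < dim_col ?R"
      then have ij: "i < 2" "j = 0" by simp_all
      then have "?L $$ (i, j) = (\<Sum>k<Suc m. (if i = 0 then if k < m then e (k + 1) else 0 else if k = 0 then 0 else e k) * f k)"
        by (simp add: scalar_prod_def flat_row_block_def atLeast0LessThan)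
      also have "\<dots> = flat_dot m e f (i + 1)"
      proof (cases "i = 0")
        case False
        then have "i = 1" using ij by simp
        then show ?thesis by (simp add: flat_dot_def sum.lessThan_Suc_shift del: sum.lessThan_Suc)
      qed (simp add: flat_dot_def)
      finally show "?L $$ (i, j) = ?R $$ (i, j)" using ij by simp
    qed (simp_all add: flat_row_block_def)
    then have "1\<^sub>m 2 * ?W + flat_row_block m e * ?f = mat 2 1 (\<lambda>(i, _). w (i + 1) + flat_dot m e f (i + 1))"
      by (auto intro!: eq_matI)
    moreover have "0\<^sub>m (m + 1) 2 * ?W + 1\<^sub>m (m + 1) * ?f = ?f" by (auto intro!: eq_matI)
    ultimately show ?thesis
      unfolding flat_right_def append_rows_def
      by (intro arg_cong4[where f = four_block_mat]) (auto intro!: eq_matI simp: flat_row_block_def)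
  qed
  finally show ?thesis .
qed

lemma flat_mat_mult:
  "flat_mat m e f w * flat_mat m e' f' w' =
    flat_mat m (\<lambda>i. e i + e' i) (\<lambda>i. f i + f' i) (\<lambda>i. w i + w' i + flat_dot m e f' i)"
proof -
  have "flat_mat m e f w * flat_mat m e' f' w' =
    four_block_mat (flat_left m e * flat_left m e' + flat_right m f w * 0\<^sub>m 1 (m + 3))
      (flat_left m e * flat_right m f' w' + flat_right m f w * 1\<^sub>m 1)
      (0\<^sub>m 1 (m + 3) * flat_left m e' + 1\<^sub>m 1 * 0\<^sub>m 1 (m + 3))
      (0\<^sub>m 1 (m + 3) * flat_right m f' w' + 1\<^sub>m 1 * 1\<^sub>m 1)"
    unfolding flat_mat_blocks
    by (rule mult_four_block_mat[where ?nr1.0 = "m + 3" and ?n1.0 = "m + 3" and ?n2.0 = 1 and ?nr2.0 = 1]) auto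
  also have "\<dots> = flat_mat m (\<lambda>i. e i + e' i) (\<lambda>i. f i + f' i) (\<lambda>i. w i + w' i + flat_dot m e f' i)"
    unfolding flat_mat_blocks flat_left_mult flat_left_right
  proof (rule arg_cong4[where f = four_block_mat])
    show "flat_left m (\<lambda>i. e i + e' i) + flat_right m f w * 0\<^sub>m 1 (m + 3) = flat_left m (\<lambda>i. e i + e' i)"
      using right_mult_zero_mat[OF flat_right_carrier[of m f w]] right_add_zero_mat[OF flat_left_carrier] by simp
    show "flat_right m f' (\<lambda>i. w' i + flat_dot m e f' i) + flat_right m f w * 1\<^sub>m 1 =
        flat_right m (\<lambda>i. f i + f' i) (\<lambda>i. w i + w' i + flat_dot m e f' i)"
      using right_mult_one_mat[OF flat_right_carrier[of m f w]]
      by (auto intro!: eq_matI simp: flat_right_def append_rows_def)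
    show "0\<^sub>m 1 (m + 3) * flat_left m e' + 1\<^sub>m 1 * 0\<^sub>m 1 (m + 3) = 0\<^sub>m 1 (m + 3)"
      using left_mult_zero_mat[OF flat_left_carrier[of m e'], of 1] by simp
    show "0\<^sub>m 1 (m + 3) * flat_right m f' w' + 1\<^sub>m 1 * 1\<^sub>m 1 = 1\<^sub>m 1"
      using left_mult_zero_mat[OF flat_right_carrier[of m f' w'], of 1] by simp
  qed
  finally show ?thesis .
qed

lemma flat_mat_one: "flat_mat m (\<lambda>_. 0) (\<lambda>_. 0) (\<lambda>_. 0) = (1\<^sub>m (m + 4) :: 'k :: field mat)"
  by (rule eq_matI) (auto simp: flat_mat_blocks flat_left_def flat_right_def append_rows_def flat_row_block_def)

lemma flat_mat_entries:
  "j < m \<Longrightarrow> flat_mat m e f w $$ (0, Suc (Suc j)) = e (Suc j)"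
  "i \<le> m \<Longrightarrow> flat_mat m e f w $$ (Suc (Suc i), m + 3) = f i"
  "flat_mat m e f w $$ (0, m + 3) = w 1"
  "flat_mat m e f w $$ (1, m + 3) = w 2"
  by (simp_all add: flat_mat_blocks flat_left_def flat_right_def append_rows_def flat_row_block_def numeral_2_eq_2)

text \<open>The parameters are functions on all of \<open>nat\<close>, so different parameters may
  give the same matrix.\<close>

lemma flat_mat_eqI:
  assumes "\<And>j. j < m \<Longrightarrow> e (j + 1) = e' (j + 1)" "\<And>i. i \<le> m \<Longrightarrow> f i = f' i" "w 1 = w' 1" "w 2 = w' 2"
  shows "flat_mat m e f w = flat_mat m e' f' w'"
proof -
  have "flat_row_block m e = flat_row_block m e'"
  proof (rule eq_matI)
    fix i j assume "i < dim_row (flat_row_block m e')" "j < dim_col (flat_row_block m e')"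
    then show "flat_row_block m e $$ (i, j) = flat_row_block m e' $$ (i, j)"
      using assms(1)[of j] assms(1)[of "j - 1"] by (auto simp: flat_row_block_def)
  qed (simp_all add: flat_row_block_def)
  moreover have "mat 2 1 (\<lambda>(i, _). w (i + 1)) = mat 2 1 (\<lambda>(i, _). w' (i + 1))"
    using assms(3,4) by (auto intro!: eq_matI simp: numeral_2_eq_2 less_Suc_eq)
  moreover have "mat (m + 1) 1 (\<lambda>(i, _). f i) = mat (m + 1) 1 (\<lambda>(i, _). f' i)"
    using assms(2) by (auto intro!: eq_matI)
  ultimately show ?thesis by (simp add: flat_mat_def)
qed

lemma group_flat: "group (flat_group TYPE('k :: field) m)"
proof (rule groupI)
  let ?H = "flat_group TYPE('k) m"
  fix x y z assume "x \<in> carrier (?H)" "y \<in> carrier (?H)"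
    "z \<in> carrier (?H)"
  then show "x \<otimes>\<^bsub>?H\<^esub> y \<otimes>\<^bsub>?H\<^esub> z =
      x \<otimes>\<^bsub>?H\<^esub> (y \<otimes>\<^bsub>?H\<^esub> z)"
    by (auto simp: flat_group_def intro!: assoc_mult_mat[where n\<^sub>1 = "m + 4" and n\<^sub>2 = "m + 4" and n\<^sub>3 = "m + 4" and n\<^sub>4 = "m + 4"])
next
  let ?H = "flat_group TYPE('k) m"
  fix x assume "x \<in> carrier (?H)"
  then obtain e f w where x: "x = flat_mat m e f w" by (auto simp: flat_group_def)
  have "flat_mat m (\<lambda>i. - e i) (\<lambda>i. - f i) (\<lambda>i. - w i + flat_dot m e f i) * x = 1\<^sub>m (m + 4)"
    unfolding x flat_mat_mult flat_mat_one[symmetric]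
    by (rule flat_mat_eqI) (auto simp: flat_dot_def sum_negf)
  then show "\<exists>y\<in>carrier (?H). y \<otimes>\<^bsub>?H\<^esub> x = \<one>\<^bsub>?H\<^esub>"
    by (auto simp: flat_group_def)
next
  let ?H = "flat_group TYPE('k) m"
  show "\<one>\<^bsub>?H\<^esub> \<in> carrier (?H)"
    unfolding flat_group_def flat_mat_one[symmetric] by auto
  fix x y assume x: "x \<in> carrier (?H)" and y: "y \<in> carrier (?H)"
  then obtain e f w e' f' w' where "x = flat_mat m e f w" "y = flat_mat m e' f' w'"
    by (auto simp: flat_group_def)
  then show "x \<otimes>\<^bsub>?H\<^esub> y \<in> carrier (?H)"
    unfolding flat_group_def by (simp add: flat_mat_mult) (rule exI, rule exI, rule exI, rule refl)
  show "\<one>\<^bsub>?H\<^esub> \<otimes>\<^bsub>?H\<^esub> x = x"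
    using x left_mult_one_mat[OF flat_mat_carrier] by (auto simp: flat_group_def)
qed

context minimal_kernel_chain
begin

theorem flat_model:
  "\<exists>\<alpha> Z \<omega>. bimap_model (flat_group TYPE('a) m) V (\<lambda>x y. (A x y, B x y)) \<alpha> Z \<omega> \<and> inj_on \<omega> Z"
proof -
  obtain e where e: "\<And>j. e j \<in> V"
    and V: "V = {(\<Sum>j<m. a j *s e j) + (\<Sum>i\<le>m. p i *s v i) | a p. True}"
    and A: "\<And>a p a' p'. A ((\<Sum>j<m. a j *s e j) + (\<Sum>i\<le>m. p i *s v i)) ((\<Sum>j<m. a' j *s e j) + (\<Sum>i\<le>m. p' i *s v i))
       = (\<Sum>j<m. p (Suc j) * a' j - a j * p' (Suc j))"
    and B: "\<And>a p a' p'. B ((\<Sum>j<m. a j *s e j) + (\<Sum>i\<le>m. p i *s v i)) ((\<Sum>j<m. a' j *s e j) + (\<Sum>i\<le>m. p' i *s v i))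
       = (\<Sum>j<m. p j * a' j - a j * p' j)"
    by (rule flat_generators) blast
  define H where "H = flat_group TYPE('a) m"
  interpret H: group H unfolding H_def by (rule group_flat)
  have H_carrier: "carrier H = {flat_mat m e f w | e f w. True}" and H_mult: "mult H = (*)"
    and H_one: "\<one>\<^bsub>H\<^esub> = flat_mat m (\<lambda>_. 0) (\<lambda>_. 0) (\<lambda>_. 0)"
    by (simp_all add: H_def flat_group_def flat_mat_one)
  \<comment> \<open>The minus sign reconciles the order of the terms in the commutator,
    \<open>x f' - x' f\<close>, with the values of the forms on the generators,
    \<open>p a' - a p'\<close>.\<close>
  define \<alpha> where "\<alpha> X = (\<Sum>j<m. (- (X $$ (0, Suc (Suc j)))) *s e j) + (\<Sum>i\<le>m. X $$ (Suc (Suc i), m + 3) *s v i)" for X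
  define Z :: "'a mat set" where "Z = {flat_mat m (\<lambda>_. 0) (\<lambda>_. 0) w | w. True}"
  \<comment> \<open>The coordinates are exchanged: \<open>A\<close> involves
    \<open>p (Suc j)\<close> and so belongs to the second row, \<open>B\<close> to the
    first.\<close>
  define \<omega> :: "'a mat \<Rightarrow> 'a \<times> 'a" where "\<omega> X = (X $$ (1, m + 3), X $$ (0, m + 3))" for X
  have \<alpha>: "\<alpha> (flat_mat m x f w) = (\<Sum>j<m. (- x (Suc j)) *s e j) + (\<Sum>i\<le>m. f i *s v i)" for x f w
    unfolding \<alpha>_def by (intro arg_cong2[where f = "(+)"] sum.cong refl) (simp_all add: flat_mat_entries)
  have \<omega>: "\<omega> (flat_mat m x f w) = (w 2, w 1)" for x f w
    using flat_mat_entries(3,4)[of m x f w] by (simp add: \<omega>_def)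
  have comm: "commutator H (flat_mat m x f w) (flat_mat m x' f' w') =
      flat_mat m (\<lambda>_. 0) (\<lambda>_. 0) (\<lambda>i. flat_dot m x f' i - flat_dot m x' f i)" for x f w x' f' w'
    by (rule H.commutator_eqI)
      (auto simp: H_carrier H_mult flat_mat_mult algebra_simps flat_dot_def intro!: flat_mat_eqI)
  have "bimap_model H V (\<lambda>x y. (A x y, B x y)) \<alpha> Z \<omega>"
  proof (intro bimap_model.intro bimap_model_axioms.intro H.is_group)
    show "\<alpha> ` carrier H = V"
    proof (intro equalityI subsetI)
      fix u assume "u \<in> V"
      then obtain a p where u: "u = (\<Sum>j<m. a j *s e j) + (\<Sum>i\<le>m. p i *s v i)" unfolding V by blast
      have "u = \<alpha> (flat_mat m (\<lambda>i. - a (i - 1)) p (\<lambda>_. 0))" by (simp add: \<alpha> u)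
      then show "u \<in> \<alpha> ` carrier H" by (auto simp: H_carrier)
    qed (auto simp: H_carrier \<alpha> e)
    show "\<alpha> (x \<otimes>\<^bsub>H\<^esub> y) = \<alpha> x + \<alpha> y" if "x \<in> carrier H" "y \<in> carrier H" for x y
      using that by (auto simp: H_carrier H_mult flat_mat_mult \<alpha> scale_left_distrib sum.distrib
          scale_left_diff_distrib sum_subtractf sum_negf)
    show "subgroup Z H"
    proof (rule H.subgroupI)
      show "inv\<^bsub>H\<^esub> a \<in> Z" if a: "a \<in> Z" for a
      proof -
        obtain w where w: "a = flat_mat m (\<lambda>_. 0) (\<lambda>_. 0) w" using a by (auto simp: Z_def)
        have "inv\<^bsub>H\<^esub> a = flat_mat m (\<lambda>_. 0) (\<lambda>_. 0) (\<lambda>i. - w i)"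
          by (rule H.inv_equality) (auto simp: w H_mult flat_mat_mult H_one H_carrier flat_dot_def)
        then show ?thesis by (auto simp: Z_def)
      qed
    qed (auto simp: Z_def H_carrier H_mult flat_mat_mult)
    show "commutator H x y \<in> Z" if "x \<in> carrier H" "y \<in> carrier H" for x y
      using that by (auto simp: H_carrier comm Z_def)
    show "\<alpha> z = 0" if "z \<in> Z" for z using that by (auto simp: Z_def \<alpha>)
    show "\<omega> (z \<otimes>\<^bsub>H\<^esub> z') = \<omega> z + \<omega> z'" if "z \<in> Z" "z' \<in> Z" for z z'
      using that by (auto simp: Z_def H_mult flat_mat_mult \<omega> flat_dot_def)
    show "\<omega> (commutator H x y) = (A (\<alpha> x) (\<alpha> y), B (\<alpha> x) (\<alpha> y))" if "x \<in> carrier H" "y \<in> carrier H" for x y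
    proof -
      obtain c f w c' f' w' where xy: "x = flat_mat m c f w" "y = flat_mat m c' f' w'"
        using \<open>x \<in> carrier H\<close> \<open>y \<in> carrier H\<close> unfolding H_carrier by blast
      show ?thesis unfolding xy comm \<omega> \<alpha> A B
        by (simp add: flat_dot_def sum_subtractf sum_negf mult.commute)
    qed
  qed
  moreover have "inj_on \<omega> Z"
    by (rule inj_onI) (auto simp: Z_def \<omega> intro!: flat_mat_eqI)
  ultimately show ?thesis unfolding H_def by blast
qed

end

section \<open>Heisenberg groups\<close>

lemma (in abelian_monoid) finsum_three:
  assumes "\<And>i. i < 3 \<Longrightarrow> f i \<in> carrier G"
  shows "(\<Oplus>l \<in> {0..<3::nat}. f l) = f 0 \<oplus> (f 1 \<oplus> f 2)"
proof -
  have "{0..<3} = {0, 1, 2 :: nat}" by auto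
  moreover have "f 0 \<in> carrier G" "f 1 \<in> carrier G" "f 2 \<in> carrier G" using assms by auto
  ultimately show ?thesis by simp
qed

lemma heisenberg_mat_dim [simp]:
  "dim_row (heisenberg_mat R e f w) = 3" "dim_col (heisenberg_mat R e f w) = 3"
  by (simp_all add: heisenberg_mat_def mat_of_rows_list_def)

lemma heisenberg_mat_entries:
  "heisenberg_mat R e f w $$ (0, 0) = \<one>\<^bsub>R\<^esub>" "heisenberg_mat R e f w $$ (0, Suc 0) = e"
  "heisenberg_mat R e f w $$ (0, 2) = w" "heisenberg_mat R e f w $$ (Suc 0, 0) = \<zero>\<^bsub>R\<^esub>"
  "heisenberg_mat R e f w $$ (Suc 0, Suc 0) = \<one>\<^bsub>R\<^esub>" "heisenberg_mat R e f w $$ (Suc 0, 2) = f"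
  "heisenberg_mat R e f w $$ (2, 0) = \<zero>\<^bsub>R\<^esub>" "heisenberg_mat R e f w $$ (2, Suc 0) = \<zero>\<^bsub>R\<^esub>"
  "heisenberg_mat R e f w $$ (2, 2) = \<one>\<^bsub>R\<^esub>"
  by (simp_all add: heisenberg_mat_def mat_of_rows_list_def numeral_2_eq_2 numeral_3_eq_3)

lemma heisenberg_mat_inject:
  "heisenberg_mat R e f w = heisenberg_mat R e' f' w' \<longleftrightarrow> e = e' \<and> f = f' \<and> w = w'"
  by (metis heisenberg_mat_entries(2,3,6))

lemma (in ring) heisenberg_mat_mult:
  assumes "e \<in> carrier R" "f \<in> carrier R" "w \<in> carrier R" "e' \<in> carrier R" "f' \<in> carrier R" "w' \<in> carrier R"
  shows "ring_mat_mult R (heisenberg_mat R e f w) (heisenberg_mat R e' f' w') =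
    heisenberg_mat R (e \<oplus> e') (f \<oplus> f') (w \<oplus> w' \<oplus> e \<otimes> f')" (is "?L = ?R")
proof (rule eq_matI)
  fix i j assume "i < dim_row ?R" "j < dim_col ?R"
  then have ij: "i < 3" "j < 3" by simp_all
  have three: "n = 0 \<or> n = Suc 0 \<or> n = 2" if "n < 3" for n :: nat using that by auto
  have closed: "heisenberg_mat R e f w $$ (i, l) \<otimes> heisenberg_mat R e' f' w' $$ (l, j) \<in> carrier R"
    if "l < 3" for l
    using three[OF ij(1)] three[OF ij(2)] three[OF that] assms by (auto simp: heisenberg_mat_entries)
  have "?L $$ (i, j) = (\<Oplus>l \<in> {0..<3}. heisenberg_mat R e f w $$ (i, l) \<otimes> heisenberg_mat R e' f' w' $$ (l, j))"
    using ij by (simp add: ring_mat_mult_def)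
  also have "\<dots> = heisenberg_mat R e f w $$ (i, 0) \<otimes> heisenberg_mat R e' f' w' $$ (0, j) \<oplus>
      (heisenberg_mat R e f w $$ (i, 1) \<otimes> heisenberg_mat R e' f' w' $$ (1, j) \<oplus>
       heisenberg_mat R e f w $$ (i, 2) \<otimes> heisenberg_mat R e' f' w' $$ (2, j))"
    by (rule finsum_three) (rule closed)
  also have "\<dots> = ?R $$ (i, j)"
    using three[OF ij(1)] three[OF ij(2)] assms by (elim disjE) (simp_all add: heisenberg_mat_entries a_ac)
  finally show "?L $$ (i, j) = ?R $$ (i, j)" .
qed (simp_all add: ring_mat_mult_def)

section \<open>Heisenberg groups computed with polynomial representatives\<close>

definition residue :: "'k :: field poly \<Rightarrow> nat \<Rightarrow> 'k poly \<Rightarrow> 'k poly set" where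
  "residue a c p = PIdl\<^bsub>class_ring\<^esub> (a ^ c) +>\<^bsub>class_ring\<^esub> p"

lemma cring_class_ring: "cring (class_ring :: 'r :: comm_ring_1 ring)"
  by (rule class_cring.cring_axioms)

lemma ideal_power: "ideal (PIdl\<^bsub>class_ring\<^esub> (a ^ c)) (class_ring :: 'k :: field poly ring)"
  by (rule cring.cgenideal_ideal[OF cring_class_ring]) simp

lemma cring_quotient_ring: "cring (quotient_ring a c)"
  unfolding quotient_ring_def by (rule ideal.quotient_is_cring[OF ideal_power cring_class_ring])

lemma residue_hom: "residue a c \<in> Ring.ring_hom class_ring (quotient_ring a c)"
  unfolding quotient_ring_def residue_def[abs_def] by (rule ideal.rcos_ring_hom[OF ideal_power])

lemma residue_simps:
  "residue a c p \<oplus>\<^bsub>quotient_ring a c\<^esub> residue a c q = residue a c (p + q)"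
  "residue a c p \<otimes>\<^bsub>quotient_ring a c\<^esub> residue a c q = residue a c (p * q)"
  "\<one>\<^bsub>quotient_ring a c\<^esub> = residue a c 1"
  "residue a c p \<in> carrier (quotient_ring a c)"
  using ring_hom_add[OF residue_hom[of a c], of p q] ring_hom_mult[OF residue_hom[of a c], of p q]
    ring_hom_one[OF residue_hom[of a c]] ring_hom_closed[OF residue_hom[of a c], of p] by simp_all

lemma residue_zero: "\<zero>\<^bsub>quotient_ring a c\<^esub> = residue a c 0"
proof -
  interpret cring "quotient_ring a c" by (rule cring_quotient_ring)
  have "residue a c 0 \<oplus>\<^bsub>quotient_ring a c\<^esub> residue a c 0 = residue a c 0" by (simp add: residue_simps)
  then show ?thesis using residue_simps(4) add.r_cancel_one by metis
qed

lemma quotient_ring_carrier: "carrier (quotient_ring a c) = range (residue a c)"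
  by (auto simp: quotient_ring_def FactRing_def A_RCOSETS_def' residue_def)

lemma residue_eq_iff: "residue a c p = residue a c q \<longleftrightarrow> a ^ c dvd p - q"
proof -
  have "residue a c p = residue a c q \<longleftrightarrow> p \<ominus>\<^bsub>class_ring\<^esub> q \<in> PIdl\<^bsub>class_ring\<^esub> (a ^ c)"
    unfolding residue_def
    using ring.quotient_eq_iff_same_a_r_cos[OF cring.axioms(1)[OF cring_class_ring] ideal_power, of p q a c]
    by simp
  then show ?thesis by (auto simp: class_ring_simps cgenideal_def dvd_def mult.commute)
qed

text \<open>Representatives in \<open>k[x]\<close> replace cosets, and equality of matrices becomes
  divisibility by \<open>a ^ c\<close>.\<close>

definition heis :: "'k :: field poly \<Rightarrow> nat \<Rightarrow> 'k poly \<Rightarrow> 'k poly \<Rightarrow> 'k poly \<Rightarrow> 'k poly set mat" where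
  "heis a c p q r = heisenberg_mat (quotient_ring a c) (residue a c p) (residue a c q) (residue a c r)"

lemma heis_eq_iff:
  "heis a c p q r = heis a c p' q' r' \<longleftrightarrow> a ^ c dvd p - p' \<and> a ^ c dvd q - q' \<and> a ^ c dvd r - r'"
  by (simp add: heis_def heisenberg_mat_inject residue_eq_iff)

lemma heisenberg_carrier:
  "carrier (heisenberg_group (quotient_ring a c)) = {heis a c p q r | p q r. True}"
  by (fastforce simp: heisenberg_group_def heis_def quotient_ring_carrier)

lemma heisenberg_mult:
  "heis a c p q r \<otimes>\<^bsub>heisenberg_group (quotient_ring a c)\<^esub> heis a c p' q' r' =
    heis a c (p + p') (q + q') (r + r' + p * q')"
  using ring.heisenberg_mat_mult[OF cring.axioms(1)[OF cring_quotient_ring[of a c]]]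
  by (simp add: heisenberg_group_def heis_def residue_simps)

lemma heis_closed [simp]: "heis a c p q r \<in> carrier (heisenberg_group (quotient_ring a c))"
  unfolding heisenberg_carrier by blast

lemma heisenberg_one: "\<one>\<^bsub>heisenberg_group (quotient_ring a c)\<^esub> = heis a c 0 0 0"
  by (simp add: heisenberg_group_def heis_def residue_zero)

lemma group_heisenberg: "group (heisenberg_group (quotient_ring a c))"
proof (rule groupI)
  let ?H = "heisenberg_group (quotient_ring a c)"
  fix x assume "x \<in> carrier ?H"
  then obtain p q r where x: "x = heis a c p q r" by (auto simp: heisenberg_carrier)
  have "heis a c (- p) (- q) (- r + p * q) \<otimes>\<^bsub>?H\<^esub> x = \<one>\<^bsub>?H\<^esub>"
    by (simp add: x heisenberg_mult heisenberg_one)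
  then show "\<exists>y\<in>carrier ?H. y \<otimes>\<^bsub>?H\<^esub> x = \<one>\<^bsub>?H\<^esub>" using heis_closed by blast
next
  let ?H = "heisenberg_group (quotient_ring a c)"
  fix x y assume "x \<in> carrier ?H" "y \<in> carrier ?H"
  then obtain p q r p' q' r' where "x = heis a c p q r" "y = heis a c p' q' r'"
    unfolding heisenberg_carrier by blast
  then show "x \<otimes>\<^bsub>?H\<^esub> y \<in> carrier ?H" by (simp add: heisenberg_mult)
qed (auto simp: heisenberg_carrier[THEN eqset_imp_iff] heisenberg_mult heisenberg_one algebra_simps)

lemma heisenberg_commutator:
  "commutator (heisenberg_group (quotient_ring a c)) (heis a c p q r) (heis a c p' q' r') =
    heis a c 0 0 (p * q' - p' * q)"
  by (rule group.commutator_eqI[OF group_heisenberg])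
    (simp_all add: heisenberg_mult algebra_simps)

lemma subgroup_heisenberg_corner: "subgroup (range (heis a c 0 0)) (heisenberg_group (quotient_ring a c))"
proof (rule group.subgroupI[OF group_heisenberg])
  let ?H = "heisenberg_group (quotient_ring a c)"
  fix x assume "x \<in> range (heis a c 0 0)"
  then obtain r where x: "x = heis a c 0 0 r" by blast
  have "inv\<^bsub>?H\<^esub> x = heis a c 0 0 (- r)"
    by (rule group.inv_equality[OF group_heisenberg])
      (auto simp: x heisenberg_carrier heisenberg_mult heisenberg_one)
  then show "inv\<^bsub>?H\<^esub> x \<in> range (heis a c 0 0)" by simp
qed (auto simp: heisenberg_carrier heisenberg_mult)

lemma heisenberg_derived:
  "derived (heisenberg_group (quotient_ring a c)) (carrier (heisenberg_group (quotient_ring a c))) =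
    range (heis a c 0 0)"
proof
  let ?H = "heisenberg_group (quotient_ring a c)"
  interpret group ?H by (rule group_heisenberg)
  have "x \<otimes>\<^bsub>?H\<^esub> y \<otimes>\<^bsub>?H\<^esub> inv\<^bsub>?H\<^esub> x \<otimes>\<^bsub>?H\<^esub> inv\<^bsub>?H\<^esub> y \<in> range (heis a c 0 0)"
    if xy: "x \<in> carrier ?H" "y \<in> carrier ?H" for x y
  proof -
    obtain p q r p' q' r' where "x = heis a c p q r" "y = heis a c p' q' r'"
      using xy unfolding heisenberg_carrier by blast
    then show ?thesis by (simp add: heisenberg_commutator flip: commutator_def)
  qed
  then show "derived ?H (carrier ?H) \<subseteq> range (heis a c 0 0)"
    unfolding derived_def by (intro generate_subgroup_incl[OF _ subgroup_heisenberg_corner]) blast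
  show "range (heis a c 0 0) \<subseteq> derived ?H (carrier ?H)"
  proof
    fix x assume "x \<in> range (heis a c 0 0)"
    then obtain r where "x = heis a c 0 0 r" by blast
    \<comment> \<open>Every corner matrix is a single commutator, so no products are needed.\<close>
    then have x: "x = commutator ?H (heis a c 1 0 0) (heis a c 0 r 0)" by (simp add: heisenberg_commutator)
    have "heis a c 1 0 0 \<in> carrier ?H" "heis a c 0 r 0 \<in> carrier ?H" by (auto simp: heisenberg_carrier)
    then show "x \<in> derived ?H (carrier ?H)"
      unfolding x derived_def commutator_def by (intro generate.incl) blast
  qed
qed

text \<open>Dividing by the kernel of \<open>\<omega>\<close> on \<open>Z\<close> makes
  \<open>\<omega>\<close> injective, and \<open>\<alpha>\<close> descends because it is trivial on
  \<open>Z\<close>.\<close>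

lemma (in bimap_model) quotient_model:
  defines "L \<equiv> {z \<in> Z. \<omega> z = 0}"
  shows "\<exists>\<alpha>' Z' \<omega>'. bimap_model (H Mod L) U b \<alpha>' Z' \<omega>' \<and> inj_on \<omega>' Z'"
proof -
  have Z_mult: "z \<otimes> z' \<in> Z" if "z \<in> Z" "z' \<in> Z" for z z'
    using that subgroup.m_closed[OF subgroup_Z] by blast
  have Z_inv: "inv z \<in> Z" if "z \<in> Z" for z
    using that subgroup.m_inv_closed[OF subgroup_Z] by blast
  have sL: "subgroup L H"
    by (rule subgroup.intro)
      (use Z_carrier subgroup.one_closed[OF subgroup_Z] in
        \<open>auto simp: L_def Z_mult Z_inv \<omega>_mult \<omega>_inv \<omega>_one\<close>)
  have b_zero: "b u 0 = 0" if u: "u \<in> U" for u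
  proof -
    obtain x where x: "x \<in> carrier H" "u = \<alpha> x" using u unfolding \<alpha>_image[symmetric] by (rule imageE)
    have "b u 0 = \<omega> (commutator H x \<one>)" using x by (simp add: \<omega>_commutator \<alpha>_one)
    also have "\<dots> = 0" using x by (simp add: commutator_def \<omega>_one)
    finally show ?thesis .
  qed
  interpret L: normal L H
  proof (rule normal_invI[OF sL])
    fix x h assume x: "x \<in> carrier H" and h: "h \<in> L"
    then have h: "h \<in> Z" "\<omega> h = 0" "h \<in> carrier H" using Z_carrier by (auto simp: L_def)
    \<comment> \<open>Normality: the commutator factor has \<open>\<omega>\<close>-value
      \<open>b (\<alpha> x) 0 = 0\<close>, so it lies in \<open>L\<close>.\<close>
    have "x \<otimes> h \<otimes> inv x = commutator H x h \<otimes> h" using x h by (simp add: commutator_def m_assoc)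
    then show "x \<otimes> h \<otimes> inv x \<in> L"
      using x h by (simp add: L_def Z_mult commutator_Z \<omega>_mult \<omega>_commutator \<alpha>_Z b_zero)
  qed
  interpret Q: group "H Mod L" by (rule L.factorgroup_is_group)
  define \<alpha>' where "\<alpha>' C = the_elem (\<alpha> ` C)" for C
  define \<omega>' where "\<omega>' C = the_elem (\<omega> ` C)" for C
  define Z' where "Z' = (\<lambda>z. L #> z) ` Z"
  have \<alpha>': "\<alpha>' (L #> x) = \<alpha> x" if "x \<in> carrier H" for x
    unfolding \<alpha>'_def
  proof (rule the_elem_image_unique)
    show "L #> x \<noteq> {}" using rcos_self[OF that sL] by blast
    show "\<alpha> y = \<alpha> x" if "y \<in> L #> x" for y
      using that \<open>x \<in> carrier H\<close> Z_carrier by (auto simp: r_coset_def L_def \<alpha>_mult \<alpha>_Z)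
  qed
  have \<omega>': "\<omega>' (L #> z) = \<omega> z" if "z \<in> Z" for z
    unfolding \<omega>'_def
  proof (rule the_elem_image_unique)
    show "L #> z \<noteq> {}" using rcos_self[OF Z_carrier[OF that] sL] by blast
    show "\<omega> y = \<omega> z" if "y \<in> L #> z" for y
      using that \<open>z \<in> Z\<close> by (auto simp: r_coset_def L_def \<omega>_mult)
  qed
  have Q_carrier: "carrier (H Mod L) = (\<lambda>x. L #> x) ` carrier H" by (rule carrier_FactGroup)
  have Q_mult: "(L #> x) \<otimes>\<^bsub>H Mod L\<^esub> (L #> y) = L #> (x \<otimes> y)" if "x \<in> carrier H" "y \<in> carrier H" for x y
    using L.rcos_sum[OF that] by simp
  have Q_inv: "inv\<^bsub>H Mod L\<^esub> (L #> x) = L #> inv x" if "x \<in> carrier H" for x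
    using L.inv_FactGroup[of "L #> x"] L.rcos_inv[OF that] that by (simp add: Q_carrier)
  have Q_comm: "commutator (H Mod L) (L #> x) (L #> y) = L #> commutator H x y"
    if "x \<in> carrier H" "y \<in> carrier H" for x y
    using that by (simp only: commutator_def Q_inv Q_mult m_closed inv_closed)
  have "bimap_model (H Mod L) U b \<alpha>' Z' \<omega>'"
  proof (intro bimap_model.intro bimap_model_axioms.intro Q.is_group)
    show "\<alpha>' ` carrier (H Mod L) = U"
      unfolding Q_carrier image_image \<alpha>_image[symmetric] by (rule image_cong[OF refl]) (rule \<alpha>')
    show "subgroup Z' (H Mod L)"
    proof (rule Q.subgroupI)
      show "Z' \<noteq> {}" using subgroup.one_closed[OF subgroup_Z] by (auto simp: Z'_def)
      show "inv\<^bsub>H Mod L\<^esub> C \<in> Z'" if "C \<in> Z'" for C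
        using that Z_carrier Z_inv by (auto simp: Z'_def Q_inv)
      show "C \<otimes>\<^bsub>H Mod L\<^esub> D \<in> Z'" if CD: "C \<in> Z'" "D \<in> Z'" for C D
      proof -
        obtain z z' where z: "z \<in> Z" "z' \<in> Z" "C = L #> z" "D = L #> z'" using CD unfolding Z'_def by blast
        then show ?thesis using Z_mult[of z z'] by (simp only: Q_mult Z_carrier Z'_def) blast
      qed
    qed (use Z_carrier in \<open>auto simp: Z'_def Q_carrier\<close>)
    show "\<alpha>' (C \<otimes>\<^bsub>H Mod L\<^esub> D) = \<alpha>' C + \<alpha>' D" if CD: "C \<in> carrier (H Mod L)" "D \<in> carrier (H Mod L)" for C D
    proof -
      obtain x y where xy: "x \<in> carrier H" "y \<in> carrier H" "C = L #> x" "D = L #> y"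
        using CD unfolding Q_carrier image_iff by blast
      show ?thesis unfolding xy(3,4) Q_mult[OF xy(1,2)] using xy(1,2) by (simp add: \<alpha>' \<alpha>_mult)
    qed
    show "commutator (H Mod L) C D \<in> Z'" if CD: "C \<in> carrier (H Mod L)" "D \<in> carrier (H Mod L)" for C D
    proof -
      obtain x y where xy: "x \<in> carrier H" "y \<in> carrier H" "C = L #> x" "D = L #> y"
        using CD unfolding Q_carrier by blast
      then show ?thesis using commutator_Z[OF xy(1,2)] by (simp add: Q_comm Z'_def)
    qed
    show "\<omega>' (commutator (H Mod L) C D) = b (\<alpha>' C) (\<alpha>' D)"
      if CD: "C \<in> carrier (H Mod L)" "D \<in> carrier (H Mod L)" for C D
    proof -
      obtain x y where xy: "x \<in> carrier H" "y \<in> carrier H" "C = L #> x" "D = L #> y"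
        using CD unfolding Q_carrier by blast
      then show ?thesis by (simp add: Q_comm \<omega>' \<alpha>' commutator_Z \<omega>_commutator)
    qed
    show "\<alpha>' C = 0" if "C \<in> Z'" for C using that Z_carrier by (auto simp: Z'_def \<alpha>' \<alpha>_Z)
    show "\<omega>' (C \<otimes>\<^bsub>H Mod L\<^esub> D) = \<omega>' C + \<omega>' D" if CD: "C \<in> Z'" "D \<in> Z'" for C D
    proof -
      obtain z z' where z: "z \<in> Z" "z' \<in> Z" "C = L #> z" "D = L #> z'" using CD unfolding Z'_def by blast
      show ?thesis unfolding z(3,4) Q_mult[OF Z_carrier[OF z(1)] Z_carrier[OF z(2)]]
        using z(1,2) by (simp add: \<omega>' Z_mult \<omega>_mult)
    qed
  qed
  moreover have "inj_on \<omega>' Z'"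
  proof (rule inj_onI)
    fix C D assume CD: "C \<in> Z'" "D \<in> Z'" and eq: "\<omega>' C = \<omega>' D"
    obtain z z' where z: "z \<in> Z" "z' \<in> Z" "C = L #> z" "D = L #> z'" using CD(1,2) unfolding Z'_def by blast
    have "\<omega> z = \<omega> z'" using eq z by (simp add: \<omega>')
    then have "z \<otimes> inv z' \<in> L" using z by (simp add: L_def Z_mult Z_inv \<omega>_mult \<omega>_inv)
    moreover have "z = (z \<otimes> inv z') \<otimes> z'" using z Z_carrier by (simp add: m_assoc)
    ultimately have "z \<in> L #> z'" by (auto simp: r_coset_def)
    then show "C = D" using repr_independence[OF _ _ sL, of z z'] z Z_carrier by simp
  qed
  ultimately show ?thesis by blast
qed

section \<open>Dimension and codimension of the corner subgroup\<close>

lemma (in vectorspace) dim_zero_space: "vectorspace.dim K (V\<lparr>carrier := {\<zero>\<^bsub>V\<^esub>}\<rparr>) = 0"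
proof -
  have "subspace K {\<zero>\<^bsub>V\<^esub>} V"
    unfolding subspace_def
    by (intro conjI vectorspace_axioms submodule.intro module_axioms) auto
  then interpret Z: vectorspace K "V\<lparr>carrier := {\<zero>\<^bsub>V\<^esub>}\<rparr>" by (rule subspace_is_vs)
  have "Z.dim \<le> card ({} :: 'c set)"
    by (rule Z.gen_ge_dim) (auto simp: Z.span_def Z.lincomb_def)
  then show ?thesis by simp
qed

lemma (in linear_map) dim_iso:
  assumes "V.fin_dim" "T ` carrier V = carrier W" "\<And>v. v \<in> carrier V \<Longrightarrow> T v = \<zero>\<^bsub>W\<^esub> \<Longrightarrow> v = \<zero>\<^bsub>V\<^esub>"
  shows "W.fin_dim" "W.dim = V.dim"
proof -
  have "kerT = {\<zero>\<^bsub>V\<^esub>}" using assms(3) by (auto simp: ker_def)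
  moreover have "W.vs imT = W" using assms(2) by (simp add: im_def)
  ultimately show "W.dim = V.dim" using rank_nullity_main(1)[OF assms(1)] V.dim_zero_space by simp
  show "W.fin_dim" using rank_nullity_main(2)[OF assms(1,2)] .
qed

lemma (in linear_map) kernel_codim:
  assumes "V.fin_dim" "T ` carrier V = carrier W"
  shows "has_codim K {v \<in> carrier V. T v = \<zero>\<^bsub>W\<^esub>} V W.dim"
proof -
  have ker: "kerT = {v \<in> carrier V. T v = \<zero>\<^bsub>W\<^esub>}" by (simp add: ker_def)
  moreover have "W.vs imT = W" using assms(2) by (simp add: im_def)
  ultimately show ?thesis
    using rank_nullity_main(1)[OF assms(1)] kerT_is_subspace by (simp add: has_codim_def)
qed

lemma linear_mapI:
  assumes "vectorspace K V" "vectorspace K W" "\<And>v. v \<in> carrier V \<Longrightarrow> T v \<in> carrier W"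
    and "\<And>u v. u \<in> carrier V \<Longrightarrow> v \<in> carrier V \<Longrightarrow> T (u \<oplus>\<^bsub>V\<^esub> v) = T u \<oplus>\<^bsub>W\<^esub> T v"
    and "\<And>r v. r \<in> carrier K \<Longrightarrow> v \<in> carrier V \<Longrightarrow> T (r \<odot>\<^bsub>V\<^esub> v) = r \<odot>\<^bsub>W\<^esub> T v"
  shows "linear_map K V W T"
  using assms by (auto simp: linear_map_def mod_hom_def mod_hom_axioms_def LinearCombinations.module_hom_def vectorspace_def)

lemma heisenberg_space_simps:
  "carrier (heisenberg_derived_space a c) = range (heis a c 0 0)"
  "heis a c 0 0 r \<oplus>\<^bsub>heisenberg_derived_space a c\<^esub> heis a c 0 0 s = heis a c 0 0 (r + s)"
  "\<zero>\<^bsub>heisenberg_derived_space a c\<^esub> = heis a c 0 0 0"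
  "k \<odot>\<^bsub>heisenberg_derived_space a c\<^esub> heis a c 0 0 r = heis a c 0 0 (Polynomial.smult k r)"
proof -
  show "k \<odot>\<^bsub>heisenberg_derived_space a c\<^esub> heis a c 0 0 r = heis a c 0 0 (Polynomial.smult k r)"
    by (simp add: heisenberg_derived_space_def Let_def heis_def heisenberg_mat_entries residue_zero
        residue_simps flip: residue_def)
qed (simp_all add: heisenberg_derived_space_def Let_def heisenberg_derived heisenberg_mult heisenberg_one)

lemma vectorspace_heisenberg: "vectorspace class_ring (heisenberg_derived_space (a :: 'k :: field poly) c)"
proof (rule vs_criteria)
  let ?M = "heisenberg_derived_space a c"
  show "\<forall>v\<in>carrier (?M). \<exists>neg_v\<in>carrier (?M).
      v \<oplus>\<^bsub>?M\<^esub> neg_v = \<zero>\<^bsub>?M\<^esub>"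
  proof
    fix v assume "v \<in> carrier (?M)"
    then obtain r where v: "v = heis a c 0 0 r" by (auto simp: heisenberg_space_simps)
    have "v \<oplus>\<^bsub>?M\<^esub> heis a c 0 0 (- r) = \<zero>\<^bsub>?M\<^esub>"
      by (simp add: v heisenberg_space_simps)
    then show "\<exists>neg_v\<in>carrier (?M).
      v \<oplus>\<^bsub>?M\<^esub> neg_v = \<zero>\<^bsub>?M\<^esub>"
      unfolding heisenberg_space_simps(1) by blast
  qed
qed (auto simp: class_field heisenberg_space_simps algebra_simps smult_add_left smult_add_right)

text \<open>Division with remainder by \<open>a ^ c\<close>, of degree \<open>m\<close>, identifies
  the corner entries with the coefficient vectors of polynomials of degree below
  \<open>m\<close>.\<close>

lemma heisenberg_space_dim:
  assumes "a \<noteq> 0"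
  shows "vectorspace.fin_dim class_ring (heisenberg_derived_space (a :: 'k :: field poly) c)"
    and "vectorspace.dim class_ring (heisenberg_derived_space a c) = c * Polynomial.degree a"
proof -
  let ?M = "heisenberg_derived_space a c"
  define m where "m = c * Polynomial.degree a"
  have deg: "Polynomial.degree (a ^ c) = m" using assms by (simp add: m_def degree_power_eq)
  have ac: "a ^ c \<noteq> 0" using assms by simp
  define P where "P v = (\<Sum>i<m. Polynomial.monom (v $ i) i)" for v :: "'k vec"
  define S where "S v = heis a c 0 0 (P v)" for v
  have coeff_P: "Polynomial.coeff (P v) i = (if i < m then v $ i else 0)" for v i
    by (simp add: P_def coeff_sum)
  interpret vec_space "TYPE('k)" m .
  have S: "linear_map class_ring V (?M) S"
  proof (rule linear_mapI)
    show "vectorspace class_ring V" by (rule vec_vs)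
    show "vectorspace class_ring (?M)" by (rule vectorspace_heisenberg)
    show "S v \<in> carrier (?M)" for v by (simp add: S_def heisenberg_space_simps)
    fix u v :: "'k vec" assume uv: "u \<in> carrier V" "v \<in> carrier V"
    have "P (u + v) = P u + P v" using uv by (intro poly_eqI) (auto simp: coeff_P)
    then show "S (u \<oplus>\<^bsub>V\<^esub> v) = S u \<oplus>\<^bsub>?M\<^esub> S v"
      by (simp add: S_def heisenberg_space_simps module_vec_simps)
  next
    fix k and v :: "'k vec" assume v: "v \<in> carrier V"
    have "P (k \<cdot>\<^sub>v v) = Polynomial.smult k (P v)" using v by (intro poly_eqI) (auto simp: coeff_P)
    then show "S (k \<odot>\<^bsub>V\<^esub> v) = k \<odot>\<^bsub>?M\<^esub> S v"
      by (simp add: S_def heisenberg_space_simps module_vec_simps)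
  qed
  have surj: "S ` carrier V = carrier (?M)"
  proof (intro equalityI subsetI)
    fix x assume "x \<in> carrier (?M)"
    then obtain r where x: "x = heis a c 0 0 r" by (auto simp: heisenberg_space_simps)
    define v where "v = vec m (Polynomial.coeff (r mod a ^ c))"
    have "Polynomial.coeff (r mod a ^ c) i = 0" if "i \<ge> m" for i
    proof (cases "r mod a ^ c = 0")
      case False
      then show ?thesis using degree_mod_less[OF ac, of r] deg that by (intro coeff_eq_0) auto
    qed simp
    then have "P v = r mod a ^ c" by (intro poly_eqI) (simp add: coeff_P v_def)
    then have "S v = x" using dvd_minus_mod[of "a ^ c" r] dvd_diff_commute[of "a ^ c" r "r mod a ^ c"]
      by (simp add: S_def x heis_eq_iff)
    moreover have "v \<in> carrier V" by (simp add: v_def)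
    ultimately show "x \<in> S ` carrier V" by blast
  qed (auto simp: S_def heisenberg_space_simps)
  have inj: "v = \<zero>\<^bsub>V\<^esub>" if v: "v \<in> carrier V" and S0: "S v = \<zero>\<^bsub>?M\<^esub>" for v
  proof -
    have "a ^ c dvd P v" using S0 by (simp add: S_def heisenberg_space_simps heis_eq_iff)
    moreover have "Polynomial.degree (P v) < m" if "P v \<noteq> 0"
    proof -
      have "Polynomial.coeff (P v) (Polynomial.degree (P v)) \<noteq> 0" using that by simp
      then show ?thesis unfolding coeff_P by (auto split: if_splits)
    qed
    ultimately have "P v = 0" using dvd_imp_degree_le[of "a ^ c" "P v"] deg by fastforce
    then have "v $ i = 0" if "i < m" for i using coeff_P[of v i] that by simp
    then show ?thesis using v by (auto simp: module_vec_simps)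
  qed
  interpret S: linear_map class_ring V "?M" S by (rule S)
  show "vectorspace.fin_dim class_ring (?M)"
    using S.dim_iso(1)[OF fin_dim surj inj] by simp
  show "vectorspace.dim class_ring (?M) = c * Polynomial.degree a"
    using S.dim_iso(2)[OF fin_dim surj inj] dim_is_n by (simp add: m_def)
qed

context regular_pencil
begin

text \<open>The full Heisenberg group already models \<open>(A, B)\<close> on \<open>V\<close>, by
  \<open>(\<Lambda>, \<Lambda> x)\<close> on the corner entry. Only injectivity is missing, and the
  quotient by the kernel of that pair provides it; linear independence of the forms gives
  codimension 2.\<close>

theorem heisenberg_model:
  assumes forms: "\<forall>s t. (\<forall>x\<in>V. \<forall>y\<in>V. s * A x y + t * B x y = 0) \<longrightarrow> s = 0 \<and> t = 0"
  shows "\<exists>(a :: 'a poly) c L \<alpha> Z \<omega>. Factorial_Ring.irreducible a \<and> c > 0 \<and>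
    vectorspace.dim class_ring (heisenberg_derived_space a c) = c * Polynomial.degree a \<and>
    has_codim class_ring L (heisenberg_derived_space a c) 2 \<and>
    bimap_model (heisenberg_group (quotient_ring a c) Mod L) V (\<lambda>x y. (A x y, B x y)) \<alpha> Z \<omega> \<and> inj_on \<omega> Z"
proof -
  have independent: "s = 0 \<and> t = 0" if "\<And>x y. x \<in> V \<Longrightarrow> y \<in> V \<Longrightarrow> s * A x y + t * B x y = 0" for s t
    using forms that by blast
  obtain a c e f where a: "Factorial_Ring.irreducible a" and c: "c > 0" and e: "e \<in> V" and f: "f \<in> V"
    and kill: "\<And>v. v \<in> V \<Longrightarrow> act (a ^ c) v = 0" and V: "V = {act p e + act q f | p q. True}"
    by (rule hyperbolic_generators) (rule that)
  have V_exp: "\<exists>p q. u = act p e + act q f" if u: "u \<in> V" for u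
    using equalityD1[OF V] u by blast
  define \<Lambda> where "\<Lambda> r = A (act r e) f" for r
  have \<Lambda>_add: "\<Lambda> (r + s) = \<Lambda> r + \<Lambda> s" and \<Lambda>_smult: "\<Lambda> (Polynomial.smult k r) = k * \<Lambda> r" for r s k
    by (simp_all add: \<Lambda>_def act_add act_smult A.bilinear)
  have \<Lambda>x_add: "\<Lambda> (pCons 0 (r + s)) = \<Lambda> (pCons 0 r) + \<Lambda> (pCons 0 s)" for r s
    using \<Lambda>_add[of "pCons 0 r" "pCons 0 s"] by simp
  have \<Lambda>x_smult: "\<Lambda> (pCons 0 (Polynomial.smult k r)) = k * \<Lambda> (pCons 0 r)" for k r
    using \<Lambda>_smult[of k "pCons 0 r"] by simp
  have act_cong: "act p v = act q v" if "a ^ c dvd p - q" "v \<in> V" for p q v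
  proof -
    obtain s where "p - q = a ^ c * s" using \<open>a ^ c dvd p - q\<close> by (rule dvdE)
    then have "p = q + s * a ^ c" by (simp add: algebra_simps)
    then show ?thesis using kill[OF that(2)] by (simp add: act_add act_mult)
  qed
  define H where "H = heisenberg_group (quotient_ring a c)"
  define Z where "Z = range (heis a c 0 0)"
  \<comment> \<open>Independence of the chosen representatives holds because \<open>a ^ c\<close>
    kills \<open>V\<close>, so \<open>act p v\<close> depends only on the residue of
    \<open>p\<close>.\<close>
  define \<alpha> where "\<alpha> X = (SOME u. \<exists>p q r. X = heis a c p q r \<and> u = act p e + act q f)" for X
  define \<omega> where "\<omega> X = (SOME u. \<exists>r. X = heis a c 0 0 r \<and> u = (\<Lambda> r, \<Lambda> (pCons 0 r)))" for X
  have \<alpha>: "\<alpha> (heis a c p q r) = act p e + act q f" for p q r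
    unfolding \<alpha>_def
  proof (rule some_equality)
    fix u assume "\<exists>p' q' r'. heis a c p q r = heis a c p' q' r' \<and> u = act p' e + act q' f"
    then obtain p' q' r' where "heis a c p q r = heis a c p' q' r'" and u: "u = act p' e + act q' f" by blast
    then have "a ^ c dvd p - p'" "a ^ c dvd q - q'" by (simp_all add: heis_eq_iff)
    then show "u = act p e + act q f" using act_cong[OF _ e] act_cong[OF _ f] u by simp
  qed (intro exI conjI; rule refl)
  have \<omega>: "\<omega> (heis a c 0 0 r) = (\<Lambda> r, \<Lambda> (pCons 0 r))" for r
    unfolding \<omega>_def
  proof (rule some_equality)
    fix u assume "\<exists>s. heis a c 0 0 r = heis a c 0 0 s \<and> u = (\<Lambda> s, \<Lambda> (pCons 0 s))"
    then obtain s where "heis a c 0 0 r = heis a c 0 0 s" and u: "u = (\<Lambda> s, \<Lambda> (pCons 0 s))" by blast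
    then have "act r e = act s e" using act_cong[OF _ e] by (simp add: heis_eq_iff)
    then show "u = (\<Lambda> r, \<Lambda> (pCons 0 r))" by (simp add: u \<Lambda>_def)
  qed (intro exI conjI; rule refl)
  have H_carrier: "carrier H = {heis a c p q r | p q r. True}"
    and H_mult: "heis a c p q r \<otimes>\<^bsub>H\<^esub> heis a c p' q' r' = heis a c (p + p') (q + q') (r + r' + p * q')"
    and H_commutator: "commutator H (heis a c p q r) (heis a c p' q' r') = heis a c 0 0 (p * q' - p' * q)"
    for p q r p' q' r'
    by (simp_all add: H_def heisenberg_carrier heisenberg_mult heisenberg_commutator)
  have form: "(A (\<alpha> x) (\<alpha> y), B (\<alpha> x) (\<alpha> y)) = \<omega> (commutator H x y)"
    if xy: "x \<in> carrier H" "y \<in> carrier H" for x y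
  proof -
    obtain p q r p' q' r' where "x = heis a c p q r" "y = heis a c p' q' r'"
      using xy unfolding H_carrier by blast
    then show ?thesis
      by (simp only: \<alpha> hyperbolic_form[OF e f] H_commutator \<omega> \<Lambda>_def)
  qed
  have "bimap_model H V (\<lambda>x y. (A x y, B x y)) \<alpha> Z \<omega>"
  proof (intro bimap_model.intro bimap_model_axioms.intro)
    show "Group.group H" unfolding H_def by (rule group_heisenberg)
    show "subgroup Z H" unfolding H_def Z_def by (rule subgroup_heisenberg_corner)
    show "\<alpha> ` carrier H = V"
    proof (intro equalityI subsetI)
      fix u assume "u \<in> V"
      then obtain p q where "u = act p e + act q f" using V_exp by blast
      then have "u = \<alpha> (heis a c p q 0)" by (simp add: \<alpha>)
      then show "u \<in> \<alpha> ` carrier H" unfolding H_carrier by blast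
    next
      fix u assume "u \<in> \<alpha> ` carrier H"
      then obtain p q r where "u = \<alpha> (heis a c p q r)" unfolding H_carrier by blast
      then show "u \<in> V" using e f by (simp add: \<alpha>)
    qed
    show "\<omega> (commutator H x y) = (A (\<alpha> x) (\<alpha> y), B (\<alpha> x) (\<alpha> y))" if "x \<in> carrier H" "y \<in> carrier H" for x y
      using form[OF that] by simp
    show "\<alpha> (x \<otimes>\<^bsub>H\<^esub> y) = \<alpha> x + \<alpha> y" if "x \<in> carrier H" "y \<in> carrier H" for x y
      using that by (auto simp: H_carrier H_mult \<alpha> act_add)
    show "commutator H x y \<in> Z" if "x \<in> carrier H" "y \<in> carrier H" for x y
      using that by (auto simp: H_carrier H_commutator Z_def)
    show "\<alpha> z = 0" if "z \<in> Z" for z using that by (auto simp: Z_def \<alpha>)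
    show "\<omega> (z \<otimes>\<^bsub>H\<^esub> z') = \<omega> z + \<omega> z'" if "z \<in> Z" "z' \<in> Z" for z z'
    proof -
      obtain r s where "z = heis a c 0 0 r" "z' = heis a c 0 0 s" using \<open>z \<in> Z\<close> \<open>z' \<in> Z\<close> unfolding Z_def by blast
      then show ?thesis by (simp add: H_mult \<omega> \<Lambda>_add \<Lambda>x_add)
    qed
  qed
  then interpret H: bimap_model H V "\<lambda>x y. (A x y, B x y)" \<alpha> Z \<omega> .
  define L where "L = {z \<in> Z. \<omega> z = 0}"
  obtain \<alpha>' Z' \<omega>' where model: "bimap_model (H Mod L) V (\<lambda>x y. (A x y, B x y)) \<alpha>' Z' \<omega>'" "inj_on \<omega>' Z'"
    using H.quotient_model unfolding L_def by blast

  \<comment> \<open>A linear relation between \<open>\<Lambda>\<close> and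
    \<open>\<Lambda> x\<close> would be the same relation between \<open>A\<close> and
    \<open>B\<close>, by the determinant formula.\<close>
  have surj: "\<exists>r. \<Lambda> r = s \<and> \<Lambda> (pCons 0 r) = t" for s t
  proof -
    have form_eq: "\<exists>r. A x y = \<Lambda> r \<and> B x y = \<Lambda> (pCons 0 r)" if xy: "x \<in> V" "y \<in> V" for x y
    proof -
      obtain p q p' q' where "x = act p e + act q f" "y = act p' e + act q' f" using V_exp[OF xy(1)] V_exp[OF xy(2)] by blast
      then show ?thesis unfolding \<Lambda>_def using hyperbolic_form[OF e f] by blast
    qed
    have "\<exists>r. \<Lambda> r \<noteq> 0"
    proof (rule ccontr)
      assume "\<nexists>r. \<Lambda> r \<noteq> 0"
      then have "1 * A x y + 0 * B x y = 0" if "x \<in> V" "y \<in> V" for x y using form_eq[OF that] by auto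
      then show False using independent by (metis one_neq_zero)
    qed
    then obtain r1 where r1: "\<Lambda> r1 \<noteq> 0" by blast
    define r0 where "r0 = Polynomial.smult (inverse (\<Lambda> r1)) r1"
    have r0: "\<Lambda> r0 = 1" using r1 by (simp add: r0_def \<Lambda>_smult)
    \<comment> \<open>The images of \<open>r0\<close> and \<open>r2\<close> are
      \<open>(1, k)\<close> and a vector off that line; \<open>u\<close> and \<open>r\<close> solve
      the resulting 2 by 2 system.\<close>
    define k where "k = \<Lambda> (pCons 0 r0)"
    have "\<exists>r. \<Lambda> (pCons 0 r) \<noteq> k * \<Lambda> r"
    proof (rule ccontr)
      assume "\<nexists>r. \<Lambda> (pCons 0 r) \<noteq> k * \<Lambda> r"
      then have "k * A x y + (- 1) * B x y = 0" if "x \<in> V" "y \<in> V" for x y using form_eq[OF that] by auto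
      then show False using independent by (metis neg_equal_0_iff_equal one_neq_zero)
    qed
    then obtain r2 where r2: "\<Lambda> (pCons 0 r2) \<noteq> k * \<Lambda> r2" by blast
    define d where "d = \<Lambda> (pCons 0 r2) - k * \<Lambda> r2"
    have d: "d \<noteq> 0" using r2 by (simp add: d_def)
    define u where "u = (t - k * s) / d"
    define r where "r = Polynomial.smult (s - u * \<Lambda> r2) r0 + Polynomial.smult u r2"
    have "\<Lambda> r = s" by (simp add: r_def \<Lambda>_add \<Lambda>_smult r0)
    moreover have "\<Lambda> (pCons 0 r) = (s - u * \<Lambda> r2) * k + u * \<Lambda> (pCons 0 r2)"
      unfolding r_def \<Lambda>x_add \<Lambda>x_smult k_def by simp
    then have "\<Lambda> (pCons 0 r) = k * s + u * d" by (simp add: d_def algebra_simps)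
    then have "\<Lambda> (pCons 0 r) = t" using d by (simp add: u_def)
    ultimately show ?thesis by blast
  qed

  define M where "M = heisenberg_derived_space a c"
  interpret W: vec_space "TYPE('a)" 2 .
  \<comment> \<open>\<open>\<omega>\<close> written as a vector of length 2, so that rank and
    nullity apply to its kernel \<open>L\<close>.\<close>
  define S where "S X = vec 2 (\<lambda>i. if i = 0 then fst (\<omega> X) else snd (\<omega> X))" for X
  have a0: "a \<noteq> 0" using a by auto
  have S_linear: "linear_map class_ring M (module_vec TYPE('a) 2) S"
  proof (rule linear_mapI)
    show "vectorspace class_ring M" unfolding M_def by (rule vectorspace_heisenberg)
    show "vectorspace class_ring (module_vec TYPE('a) 2)" by (rule vec_vs)
    show "S X \<in> carrier (module_vec TYPE('a) 2)" for X by (simp add: S_def module_vec_simps)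
    show "S (X \<oplus>\<^bsub>M\<^esub> Y) = S X \<oplus>\<^bsub>module_vec TYPE('a) 2\<^esub> S Y" if XY: "X \<in> carrier M" "Y \<in> carrier M" for X Y
    proof -
      obtain r s where "X = heis a c 0 0 r" "Y = heis a c 0 0 s"
        using XY unfolding M_def heisenberg_space_simps by blast
      then show ?thesis
        by (auto simp: M_def heisenberg_space_simps S_def module_vec_simps \<omega> \<Lambda>_add \<Lambda>x_add)
    qed
    show "S (k \<odot>\<^bsub>M\<^esub> X) = k \<odot>\<^bsub>module_vec TYPE('a) 2\<^esub> S X" if X: "X \<in> carrier M" for k X
    proof -
      obtain r where "X = heis a c 0 0 r"
        using X unfolding M_def heisenberg_space_simps by blast
      then show ?thesis
        by (auto simp: M_def heisenberg_space_simps S_def module_vec_simps \<omega> \<Lambda>_smult \<Lambda>x_smult)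
    qed
  qed
  interpret S: linear_map class_ring M "module_vec TYPE('a) 2" S by (rule S_linear)
  have S_surj: "S ` carrier M = carrier (module_vec TYPE('a) 2)"
  proof (intro equalityI subsetI)
    fix v :: "'a vec" assume v: "v \<in> carrier (module_vec TYPE('a) 2)"
    obtain r where r: "\<Lambda> r = v $ 0" "\<Lambda> (pCons 0 r) = v $ 1" using surj by blast
    have "v = S (heis a c 0 0 r)"
      using v r by (intro eq_vecI) (auto simp: S_def \<omega> module_vec_simps less_Suc_eq numeral_2_eq_2)
    then show "v \<in> S ` carrier M" unfolding M_def heisenberg_space_simps by blast
  qed (auto simp: S_def module_vec_simps)
  have "has_codim class_ring {v \<in> carrier M. S v = \<zero>\<^bsub>module_vec TYPE('a) 2\<^esub>} M W.dim"
    by (rule S.kernel_codim[OF _ S_surj]) (simp add: M_def heisenberg_space_dim(1)[OF a0])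
  moreover have "{v \<in> carrier M. S v = \<zero>\<^bsub>module_vec TYPE('a) 2\<^esub>} = L"
  proof -
    have "S X = 0\<^sub>v 2 \<longleftrightarrow> \<omega> X = 0" for X
      by (auto simp: S_def vec_eq_iff prod_eq_iff less_Suc_eq numeral_2_eq_2)
    then show ?thesis by (simp add: L_def Z_def M_def heisenberg_space_simps module_vec_simps)
  qed
  ultimately have "has_codim class_ring L M 2" using W.dim_is_n by simp
  then show ?thesis
    using a c model heisenberg_space_dim(2)[OF a0, of c] unfolding H_def M_def by blast
qed

end

section \<open>The pencil of a group of genus two\<close>

lemma (in vectorspace) two_dimensional_basis:
  assumes "fin_dim" "dim = 2"
  obtains b1 b2 where "b1 \<in> carrier V" "b2 \<in> carrier V"
    "\<And>v. v \<in> carrier V \<Longrightarrow> \<exists>s\<in>carrier K. \<exists>t\<in>carrier K. v = s \<odot>\<^bsub>V\<^esub> b1 \<oplus>\<^bsub>V\<^esub> t \<odot>\<^bsub>V\<^esub> b2"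
    "\<And>s t s' t'. s \<in> carrier K \<Longrightarrow> t \<in> carrier K \<Longrightarrow> s' \<in> carrier K \<Longrightarrow> t' \<in> carrier K \<Longrightarrow>
      s \<odot>\<^bsub>V\<^esub> b1 \<oplus>\<^bsub>V\<^esub> t \<odot>\<^bsub>V\<^esub> b2 = s' \<odot>\<^bsub>V\<^esub> b1 \<oplus>\<^bsub>V\<^esub> t' \<odot>\<^bsub>V\<^esub> b2 \<Longrightarrow> s = s' \<and> t = t'"
proof -
  obtain X where X: "finite X" "basis X" using finite_basis_exists[OF assms(1)] by blast
  then have "card X = 2" using dim_basis assms(2) by simp
  then obtain b1 b2 where b: "X = {b1, b2}" "b1 \<noteq> b2" by (auto simp: card_2_iff)
  have XV: "X \<subseteq> carrier V" using X(2) by (simp add: basis_def)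
  then have bV: "b1 \<in> carrier V" "b2 \<in> carrier V" by (simp_all add: b)
  have lc: "lincomb c X = c b1 \<odot>\<^bsub>V\<^esub> b1 \<oplus>\<^bsub>V\<^esub> c b2 \<odot>\<^bsub>V\<^esub> b2"
    if "c b1 \<in> carrier K" "c b2 \<in> carrier K" for c
    using that bV b(2) by (simp add: lincomb_def b(1))
  have unique: "\<exists>!c. c \<in> X \<rightarrow>\<^sub>E carrier K \<and> lincomb c X = v" if "v \<in> carrier V" for v
    using basis_criterion[OF X(1) XV] X(2) that by blast
  show ?thesis
  proof (rule that[OF bV])
    fix v assume "v \<in> carrier V"
    then obtain c where c: "c \<in> X \<rightarrow>\<^sub>E carrier K" "lincomb c X = v" using unique by blast
    then have "c b1 \<in> carrier K" "c b2 \<in> carrier K" by (auto simp: b(1))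
    then show "\<exists>s\<in>carrier K. \<exists>t\<in>carrier K. v = s \<odot>\<^bsub>V\<^esub> b1 \<oplus>\<^bsub>V\<^esub> t \<odot>\<^bsub>V\<^esub> b2"
      using lc c(2) by metis
  next
    fix s t s' t' assume st: "s \<in> carrier K" "t \<in> carrier K" "s' \<in> carrier K" "t' \<in> carrier K"
      and eq: "s \<odot>\<^bsub>V\<^esub> b1 \<oplus>\<^bsub>V\<^esub> t \<odot>\<^bsub>V\<^esub> b2 = s' \<odot>\<^bsub>V\<^esub> b1 \<oplus>\<^bsub>V\<^esub> t' \<odot>\<^bsub>V\<^esub> b2"
    define c where "c = (\<lambda>x\<in>X. if x = b1 then s else t)"
    define c' where "c' = (\<lambda>x\<in>X. if x = b1 then s' else t')"
    have c: "c b1 = s" "c b2 = t" "c' b1 = s'" "c' b2 = t'" using b by (auto simp: c_def c'_def)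
    have "c \<in> X \<rightarrow>\<^sub>E carrier K" "c' \<in> X \<rightarrow>\<^sub>E carrier K" using st by (auto simp: c_def c'_def)
    moreover have "lincomb c X = lincomb c' X" using lc[of c] lc[of c'] st eq by (simp add: c)
    moreover have "lincomb c X \<in> carrier V" using st bV lc[of c] by (simp add: c)
    ultimately have "c = c'" using unique[of "lincomb c X"] by metis
    then show "s = s' \<and> t = t'" using c by metis
  qed
qed

section \<open>Commutator calculus in class two\<close>

locale class_two_group = group G for G (structure) +
  assumes derived_central: "derived G (carrier G) \<subseteq> group_center G"
begin

abbreviation comm :: "'a \<Rightarrow> 'a \<Rightarrow> 'a" where "comm x y \<equiv> commutator G x y"

abbreviation coset :: "'a \<Rightarrow> 'a set" where "coset x \<equiv> group_center G #> x"

lemma comm_closed [simp]: "x \<in> carrier G \<Longrightarrow> y \<in> carrier G \<Longrightarrow> comm x y \<in> carrier G"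
  by (simp add: commutator_def)

lemma comm_derived: "x \<in> carrier G \<Longrightarrow> y \<in> carrier G \<Longrightarrow> comm x y \<in> derived G (carrier G)"
  unfolding derived_def commutator_def by (rule generate.incl) blast

lemma center_commute: "z \<in> group_center G \<Longrightarrow> x \<in> carrier G \<Longrightarrow> z \<otimes> x = x \<otimes> z"
  by (simp add: group_center_def)

lemma center_carrier: "z \<in> group_center G \<Longrightarrow> z \<in> carrier G"
  by (simp add: group_center_def)

lemma cancel_left:
  assumes "x \<in> carrier G" "y \<in> carrier G"
  shows "inv y \<otimes> (y \<otimes> x) = x"
  using assms by (simp flip: m_assoc)

lemma comm_swap: "x \<in> carrier G \<Longrightarrow> y \<in> carrier G \<Longrightarrow> comm x y \<otimes> (y \<otimes> x) = x \<otimes> y"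
  by (simp add: commutator_def m_assoc cancel_left)

lemma comm_mult_left:
  assumes "x \<in> carrier G" "x' \<in> carrier G" "y \<in> carrier G"
  shows "comm (x \<otimes> x') y = comm x y \<otimes> comm x' y"
proof (rule commutator_eqI)
  have c: "comm x' y \<in> group_center G" using comm_derived derived_central assms by blast
  have "comm x y \<otimes> comm x' y \<otimes> (y \<otimes> (x \<otimes> x')) = comm x y \<otimes> (y \<otimes> x) \<otimes> (comm x' y \<otimes> x')"
    using assms center_commute[OF c, of "y \<otimes> x"] by (simp add: m_assoc) (simp flip: m_assoc)
  also have "\<dots> = x \<otimes> y \<otimes> (comm x' y \<otimes> x')" by (simp only: comm_swap assms)
  also have "\<dots> = x \<otimes> (comm x' y \<otimes> (y \<otimes> x'))"
    using assms center_commute[OF c, of y] by (simp add: m_assoc) (simp flip: m_assoc)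
  also have "\<dots> = x \<otimes> (x' \<otimes> y)" by (simp only: comm_swap assms)
  finally show "comm x y \<otimes> comm x' y \<otimes> (y \<otimes> (x \<otimes> x')) = x \<otimes> x' \<otimes> y" using assms by (simp add: m_assoc)
qed (use assms in simp_all)

lemma comm_inverse: "x \<in> carrier G \<Longrightarrow> y \<in> carrier G \<Longrightarrow> comm y x = inv (comm x y)"
  by (simp add: commutator_def inv_mult_group m_assoc)

lemma comm_self: "x \<in> carrier G \<Longrightarrow> comm x x = \<one>"
  by (simp add: commutator_def m_assoc)

lemma comm_center: "z \<in> group_center G \<Longrightarrow> y \<in> carrier G \<Longrightarrow> comm z y = \<one>"
  by (rule commutator_eqI) (simp_all add: center_carrier center_commute)

lemma subgroup_center: "subgroup (group_center G) G"
proof (rule subgroupI)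
  have "\<one> \<in> group_center G" by (simp add: group_center_def)
  then show "group_center G \<noteq> {}" by blast
  fix z assume z: "z \<in> group_center G"
  have "inv z \<otimes> x = x \<otimes> inv z" if x: "x \<in> carrier G" for x
  proof -
    have zc: "z \<in> carrier G" using z by (rule center_carrier)
    have "inv z \<otimes> x = inv z \<otimes> (x \<otimes> z) \<otimes> inv z" using x zc by (simp add: m_assoc)
    also have "\<dots> = x \<otimes> inv z" using x zc by (simp add: m_assoc cancel_left flip: center_commute[OF z x])
    finally show ?thesis .
  qed
  moreover have "inv z \<in> carrier G" using center_carrier[OF z] by simp
  ultimately show "inv z \<in> group_center G" unfolding group_center_def by blast
  fix z' assume z': "z' \<in> group_center G"
  have "z \<otimes> z' \<otimes> x = x \<otimes> (z \<otimes> z')" if x: "x \<in> carrier G" for x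
  proof -
    have zc: "z \<in> carrier G" "z' \<in> carrier G" using z z' by (auto dest: center_carrier)
    have "z \<otimes> z' \<otimes> x = z \<otimes> x \<otimes> z'" using x zc center_commute[OF z' x] by (simp add: m_assoc)
    also have "\<dots> = x \<otimes> (z \<otimes> z')" using x zc center_commute[OF z x] by (simp add: m_assoc)
    finally show ?thesis .
  qed
  moreover have "z \<otimes> z' \<in> carrier G" using center_carrier[OF z] center_carrier[OF z'] by simp
  ultimately show "z \<otimes> z' \<in> group_center G" unfolding group_center_def by blast
qed (auto simp: group_center_def)

lemma comm_coset:
  assumes x: "x \<in> carrier G" and y: "y \<in> carrier G" and x': "x' \<in> coset x"
  shows "comm x' y = comm x y"
proof -
  obtain z where z: "z \<in> group_center G" "x' = z \<otimes> x" using x' by (auto simp: r_coset_def)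
  then show ?thesis using x y by (simp add: comm_mult_left center_carrier comm_center)
qed

lemma bimap_coset:
  assumes x: "x \<in> carrier G" and y: "y \<in> carrier G"
  shows "commutation_bimap G (coset x) (coset y) = comm x y"
proof -
  have *: "comm x' y' = comm x y" if "x' \<in> coset x" "y' \<in> coset y" for x' y'
  proof -
    have c: "y' \<in> carrier G"
      using that(2) subgroup.elemrcos_carrier[OF subgroup_center group_axioms y] by blast
    have "comm x' y' = comm x y'" using comm_coset[OF x c that(1)] .
    also have "\<dots> = inv (comm y' x)" using comm_inverse x c by blast
    also have "comm y' x = comm y x" using comm_coset[OF y x that(2)] .
    also have "inv (comm y x) = comm x y" using comm_inverse[OF y x] by simp
    finally show ?thesis .
  qed
  have "{comm x' y' | x' y'. x' \<in> coset x \<and> y' \<in> coset y} = {comm x y}"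
  proof (intro equalityI subsetI)
    fix c assume "c \<in> {comm x' y' | x' y'. x' \<in> coset x \<and> y' \<in> coset y}"
    then show "c \<in> {comm x y}" using * by blast
  next
    fix c assume "c \<in> {comm x y}"
    then show "c \<in> {comm x' y' | x' y'. x' \<in> coset x \<and> y' \<in> coset y}"
      using rcos_self[OF x subgroup_center] rcos_self[OF y subgroup_center] by blast
  qed
  then show ?thesis by (simp add: commutation_bimap_def)
qed

lemma derived_commute:
  assumes "w \<in> derived G (carrier G)" "w' \<in> derived G (carrier G)"
  shows "w \<otimes> w' = w' \<otimes> w"
  by (rule center_commute) (use assms derived_central center_carrier in auto)

end

section \<open>The vector space structures coming from the centroid\<close>

definition scale_fun :: "'k :: field \<Rightarrow> ('i \<Rightarrow> 'k) \<Rightarrow> 'i \<Rightarrow> 'k" where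
  "scale_fun c f = (\<lambda>i. c * f i)"

interpretation scale_fun: vector_space scale_fun
  by unfold_locales (auto simp: scale_fun_def fun_eq_iff algebra_simps)

text \<open>Alternating forms are required on the whole type. Precomposing with a projection extends
  a form from \<open>V\<close> to all functions.\<close>

lemma exists_linear_projection:
  fixes V :: "('i \<Rightarrow> 'k :: field) set"
  assumes "scale_fun.subspace V"
  shows "\<exists>\<pi>. (\<forall>u. \<pi> u \<in> V) \<and> (\<forall>u\<in>V. \<pi> u = u) \<and> (\<forall>u v. \<pi> (u + v) = \<pi> u + \<pi> v) \<and>
    (\<forall>c u. \<pi> (scale_fun c u) = scale_fun c (\<pi> u))"
proof -
  interpret vector_space_pair "scale_fun :: 'k \<Rightarrow> ('i \<Rightarrow> 'k) \<Rightarrow> 'i \<Rightarrow> 'k"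
    "scale_fun :: 'k \<Rightarrow> ('i \<Rightarrow> 'k) \<Rightarrow> 'i \<Rightarrow> 'k" by unfold_locales
  have "Vector_Spaces.linear scale_fun scale_fun (\<lambda>u :: 'i \<Rightarrow> 'k. u)" by (rule scale_fun.linear_ident)
  from linear_exists_left_inverse_on[OF this assms(1) inj_on_id2] obtain \<pi>
    where \<pi>: "range \<pi> \<subseteq> V" "Vector_Spaces.linear scale_fun scale_fun \<pi>" "\<forall>u\<in>V. \<pi> u = u" by auto
  then show ?thesis using linear_add[OF \<pi>(2)] linear_scale[OF \<pi>(2)] by (intro exI[of _ \<pi>]) auto
qed

locale genus_two_group = class_two_group G for G (structure) +
  fixes \<phi> :: "'k :: field \<Rightarrow> ('a set \<Rightarrow> 'a set) \<times> ('a set \<Rightarrow> 'a set) \<times> ('a \<Rightarrow> 'a)"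
  assumes \<phi>: "\<phi> \<in> ring_iso class_ring (group_centroid G)"
    and dim_two: "vectorspace.dim class_ring (derived_space G \<phi>) = 2"
    and finite_carrier: "finite (carrier G)"
    and centrally_indecomposable: "centrally_indecomposable G"
begin

abbreviation D :: "'a set" where "D \<equiv> derived G (carrier G)"

definition \<sigma> :: "'k \<Rightarrow> 'a \<Rightarrow> 'a" where "\<sigma> t = snd (snd (\<phi> t))"

lemma subgroup_D: "subgroup D G"
  by (rule derived_is_subgroup) simp

lemma D_carrier [simp]: "w \<in> D \<Longrightarrow> w \<in> carrier G"
  using subgroup.mem_carrier[OF subgroup_D] .

lemma D_mult [simp]: "w \<in> D \<Longrightarrow> w' \<in> D \<Longrightarrow> w \<otimes> w' \<in> D"
  using subgroup.m_closed[OF subgroup_D] .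

lemma D_inv [simp]: "w \<in> D \<Longrightarrow> inv w \<in> D"
  using subgroup.m_inv_closed[OF subgroup_D] .

lemma D_one [simp]: "\<one> \<in> D"
  using subgroup.one_closed[OF subgroup_D] .

lemma \<phi>_hom: "\<phi> \<in> Ring.ring_hom class_ring (group_centroid G)"
  using \<phi> by (simp add: ring_iso_def)

lemma \<phi>_carrier:
  obtains sU sV where "\<phi> t = (sU, sV, \<sigma> t)" "sU \<in> group_End (central_factor G)"
    "\<sigma> t \<in> group_End (derived_group G)"
    "\<And>C E. C \<in> carrier (central_factor G) \<Longrightarrow> E \<in> carrier (central_factor G) \<Longrightarrow>
      commutation_bimap G (sU C) E = \<sigma> t (commutation_bimap G C E)"
proof -
  have "\<phi> t \<in> carrier (group_centroid G)" using ring_hom_closed[OF \<phi>_hom, of t] by simp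
  then show ?thesis using that unfolding group_centroid_def centroid_def \<sigma>_def by auto
qed

lemma \<sigma>_closed [simp]: "w \<in> D \<Longrightarrow> \<sigma> t w \<in> D"
  by (rule \<phi>_carrier[of t]) (auto simp: group_End_def hom_def)

lemma \<sigma>_hom: "w \<in> D \<Longrightarrow> w' \<in> D \<Longrightarrow> \<sigma> t (w \<otimes> w') = \<sigma> t w \<otimes> \<sigma> t w'"
  by (rule \<phi>_carrier[of t]) (auto simp: group_End_def hom_def)

lemma \<sigma>_add: "w \<in> D \<Longrightarrow> \<sigma> (s + t) w = \<sigma> s w \<otimes> \<sigma> t w"
  using ring_hom_add[OF \<phi>_hom, of s t]
  by (simp add: \<sigma>_def group_centroid_def centroid_def case_prod_unfold)

text \<open>The order of the factors comes from endomorphisms acting on the right; commutativity of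
  the field turns this into the usual module law.\<close>

lemma \<sigma>_mult: "w \<in> D \<Longrightarrow> \<sigma> (s * t) w = \<sigma> t (\<sigma> s w)"
  using ring_hom_mult[OF \<phi>_hom, of s t]
  by (simp add: \<sigma>_def group_centroid_def centroid_def case_prod_unfold compose_def)

lemma \<sigma>_one: "w \<in> D \<Longrightarrow> \<sigma> 1 w = w"
  using ring_hom_one[OF \<phi>_hom] by (simp add: \<sigma>_def group_centroid_def centroid_def)

text \<open>The component of a centroid element on \<open>G/Z(G)\<close> is lifted to
  representatives; this is what makes \<open>G/Z(G)\<close> a space over the field.\<close>

lemma scale_element:
  assumes x: "x \<in> carrier G"
  shows "\<exists>x'\<in>carrier G. \<forall>y\<in>carrier G. comm x' y = \<sigma> t (comm x y)"
proof -
  obtain sU sV where "\<phi> t = (sU, sV, \<sigma> t)" and s: "sU \<in> group_End (central_factor G)"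
    and "\<sigma> t \<in> group_End (derived_group G)" and bimap: "\<And>C E. C \<in> carrier (central_factor G) \<Longrightarrow> E \<in> carrier (central_factor G) \<Longrightarrow>
      commutation_bimap G (sU C) E = \<sigma> t (commutation_bimap G C E)"
    by (rule \<phi>_carrier[of t]) (rule that)
  have coset_closed: "coset y \<in> carrier (central_factor G)" if "y \<in> carrier G" for y
    using that by (simp add: carrier_FactGroup)
  have "sU (coset x) \<in> carrier (central_factor G)"
    using s coset_closed[OF x] by (auto simp: group_End_def hom_def)
  then obtain x' where x': "x' \<in> carrier G" "sU (coset x) = coset x'"
    by (auto simp: carrier_FactGroup)
  have "comm x' y = \<sigma> t (comm x y)" if y: "y \<in> carrier G" for y
    using bimap[OF coset_closed[OF x] coset_closed[OF y]] unfolding x'(2) bimap_coset[OF x y] bimap_coset[OF x'(1) y] .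
  then show ?thesis using x'(1) by blast
qed

lemma derived_space_simps:
  "carrier (derived_space G \<phi>) = D" "add (derived_space G \<phi>) = mult G"
  "zero (derived_space G \<phi>) = \<one>" "smult (derived_space G \<phi>) = \<sigma>"
  by (simp_all add: derived_space_def \<sigma>_def fun_eq_iff)

lemma vectorspace_derived: "vectorspace class_ring (derived_space G \<phi>)"
proof (rule vs_criteria)
  let ?M = "derived_space G \<phi>"
  show "\<forall>v\<in>carrier (?M). \<exists>neg_v\<in>carrier (?M).
      v \<oplus>\<^bsub>?M\<^esub> neg_v = \<zero>\<^bsub>?M\<^esub>"
  proof
    fix v assume "v \<in> carrier (?M)"
    then have "v \<in> D" by (simp add: derived_space_simps)
    then show "\<exists>neg_v\<in>carrier (?M). v \<oplus>\<^bsub>?M\<^esub> neg_v = \<zero>\<^bsub>?M\<^esub>"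
      by (intro bexI[of _ "inv v"]) (simp_all add: derived_space_simps)
  qed
  show "\<forall>a b v. a \<in> carrier class_ring \<and> b \<in> carrier class_ring \<and> v \<in> carrier (?M) \<longrightarrow>
    (a \<otimes>\<^bsub>class_ring\<^esub> b) \<odot>\<^bsub>?M\<^esub> v = a \<odot>\<^bsub>?M\<^esub> (b \<odot>\<^bsub>?M\<^esub> v)"
  proof (intro allI impI)
    fix a b :: 'k and v
    assume "a \<in> carrier class_ring \<and> b \<in> carrier class_ring \<and> v \<in> carrier (?M)"
    then have "\<sigma> (b * a) v = \<sigma> a (\<sigma> b v)" by (simp add: derived_space_simps \<sigma>_mult)
    then show "(a \<otimes>\<^bsub>class_ring\<^esub> b) \<odot>\<^bsub>?M\<^esub> v = a \<odot>\<^bsub>?M\<^esub> (b \<odot>\<^bsub>?M\<^esub> v)"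
      by (simp add: derived_space_simps mult.commute)
  qed
  show "\<forall>v w. v \<in> carrier (?M) \<and> w \<in> carrier (?M) \<longrightarrow>
    v \<oplus>\<^bsub>?M\<^esub> w = w \<oplus>\<^bsub>?M\<^esub> v"
    unfolding derived_space_simps using derived_commute by blast
qed (auto simp: class_field derived_space_simps \<sigma>_add \<sigma>_one \<sigma>_hom m_assoc)

lemma exists_coordinates:
  "\<exists>\<kappa> :: 'a \<Rightarrow> 'k \<times> 'k. inj_on \<kappa> D \<and> \<kappa> ` D = UNIV \<and> (\<forall>w\<in>D. \<forall>w'\<in>D. \<kappa> (w \<otimes> w') = \<kappa> w + \<kappa> w') \<and>
    (\<forall>w\<in>D. \<forall>t. \<kappa> (\<sigma> t w) = (t * fst (\<kappa> w), t * snd (\<kappa> w)))"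
proof -
  interpret W: vectorspace class_ring "derived_space G \<phi>" by (rule vectorspace_derived)
  have "W.fin_dim"
    unfolding W.fin_dim_def
  proof (intro exI conjI)
    show "finite (carrier (derived_space G \<phi>))"
      unfolding derived_space_simps using finite_subset[OF _ finite_carrier] D_carrier by blast
    show "carrier (derived_space G \<phi>) \<subseteq> carrier (derived_space G \<phi>)" by simp
    show "W.gen_set (carrier (derived_space G \<phi>))"
      using W.in_own_span[of "carrier (derived_space G \<phi>)"] W.span_is_subset2[of "carrier (derived_space G \<phi>)"]
      by blast
  qed
  then obtain b1 b2 where b: "b1 \<in> D" "b2 \<in> D"
    and ex: "\<And>w. w \<in> D \<Longrightarrow> \<exists>s\<in>UNIV. \<exists>t\<in>UNIV. w = \<sigma> s b1 \<otimes> \<sigma> t b2"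
    and unique: "\<And>s t s' t'. s \<in> UNIV \<Longrightarrow> t \<in> UNIV \<Longrightarrow> s' \<in> UNIV \<Longrightarrow> t' \<in> UNIV \<Longrightarrow>
      \<sigma> s b1 \<otimes> \<sigma> t b2 = \<sigma> s' b1 \<otimes> \<sigma> t' b2 \<Longrightarrow> s = s' \<and> t = t'"
    by (rule W.two_dimensional_basis[OF _ dim_two, unfolded derived_space_simps partial_object.simps]) (rule that)
  define \<kappa> where "\<kappa> w = (SOME p. w = \<sigma> (fst p) b1 \<otimes> \<sigma> (snd p) b2)" for w
  have \<kappa>: "w = \<sigma> (fst (\<kappa> w)) b1 \<otimes> \<sigma> (snd (\<kappa> w)) b2" if w: "w \<in> D" for w
    unfolding \<kappa>_def by (rule someI_ex) (use ex[OF w] in simp)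
  have \<kappa>_eq: "\<kappa> (\<sigma> s b1 \<otimes> \<sigma> t b2) = (s, t)" for s t
    using unique[OF _ _ _ _ \<kappa>[of "\<sigma> s b1 \<otimes> \<sigma> t b2"]] b by (simp add: prod_eq_iff)
  have "inj_on \<kappa> D" by (rule inj_onI) (metis \<kappa>)
  moreover have "\<kappa> ` D = UNIV"
  proof -
    have "p \<in> \<kappa> ` D" for p
      using \<kappa>_eq[of "fst p" "snd p"] b by (intro image_eqI[of _ _ "\<sigma> (fst p) b1 \<otimes> \<sigma> (snd p) b2"]) auto
    then show ?thesis by blast
  qed
  moreover have "\<kappa> (w \<otimes> w') = \<kappa> w + \<kappa> w'" if w: "w \<in> D" "w' \<in> D" for w w'
  proof -
    let ?s = "fst (\<kappa> w)" and ?t = "snd (\<kappa> w)" and ?s' = "fst (\<kappa> w')" and ?t' = "snd (\<kappa> w')"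
    have "w \<otimes> w' = (\<sigma> ?s b1 \<otimes> \<sigma> ?t b2) \<otimes> (\<sigma> ?s' b1 \<otimes> \<sigma> ?t' b2)" using \<kappa>[OF w(1)] \<kappa>[OF w(2)] by simp
    also have "\<dots> = \<sigma> ?s b1 \<otimes> (\<sigma> ?t b2 \<otimes> \<sigma> ?s' b1) \<otimes> \<sigma> ?t' b2" using b by (simp add: m_assoc)
    also have "\<sigma> ?t b2 \<otimes> \<sigma> ?s' b1 = \<sigma> ?s' b1 \<otimes> \<sigma> ?t b2" using b by (intro derived_commute) simp_all
    also have "\<sigma> ?s b1 \<otimes> (\<sigma> ?s' b1 \<otimes> \<sigma> ?t b2) \<otimes> \<sigma> ?t' b2 = \<sigma> (?s + ?s') b1 \<otimes> \<sigma> (?t + ?t') b2"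
      using b by (simp add: m_assoc \<sigma>_add)
    finally show ?thesis using \<kappa>_eq by (simp add: prod_eq_iff)
  qed
  moreover have "\<kappa> (\<sigma> t w) = (t * fst (\<kappa> w), t * snd (\<kappa> w))" if w: "w \<in> D" for t w
  proof -
    have "\<sigma> t w = \<sigma> t (\<sigma> (fst (\<kappa> w)) b1 \<otimes> \<sigma> (snd (\<kappa> w)) b2)" using \<kappa>[OF w] by simp
    also have "\<dots> = \<sigma> (fst (\<kappa> w) * t) b1 \<otimes> \<sigma> (snd (\<kappa> w) * t) b2" using b by (simp add: \<sigma>_hom \<sigma>_mult)
    finally show ?thesis using \<kappa>_eq by (simp add: mult.commute)
  qed
  ultimately show ?thesis by blast
qed

text \<open>Indexing by \<open>bool\<close> the two coordinates of \<open>[x, y]\<close>, the class of \<open>x\<close> modulo the centre is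
  represented by the function \<open>(y, i) \<mapsto> [x, y]\<^sub>i\<close>.\<close>

theorem pencil_model:
  obtains A B :: "('a \<times> bool \<Rightarrow> 'k) \<Rightarrow> ('a \<times> bool \<Rightarrow> 'k) \<Rightarrow> 'k" and V \<alpha> Z \<omega>
  where "indecomposable_pencil scale_fun A B V" "V \<noteq> {0}"
    "faithful_bimap_model G V (\<lambda>x y. (A x y, B x y)) \<alpha> Z \<omega>"
    "\<forall>s t. (\<forall>x\<in>V. \<forall>y\<in>V. s * A x y + t * B x y = 0) \<longrightarrow> s = 0 \<and> t = 0"
proof -
  obtain \<kappa> :: "'a \<Rightarrow> 'k \<times> 'k" where \<kappa>_inj: "inj_on \<kappa> D" and \<kappa>_surj: "\<kappa> ` D = UNIV"
    and \<kappa>_mult: "\<And>w w'. w \<in> D \<Longrightarrow> w' \<in> D \<Longrightarrow> \<kappa> (w \<otimes> w') = \<kappa> w + \<kappa> w'"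
    and \<kappa>_\<sigma>: "\<And>w t. w \<in> D \<Longrightarrow> \<kappa> (\<sigma> t w) = (t * fst (\<kappa> w), t * snd (\<kappa> w))"
    using exists_coordinates by blast
  have \<kappa>_one: "\<kappa> \<one> = 0" using \<kappa>_mult[of \<one> \<one>] by simp
  have \<kappa>_inv: "\<kappa> (inv w) = - \<kappa> w" if "w \<in> D" for w
    using \<kappa>_mult[of "inv w" w] that \<kappa>_one by (simp add: eq_neg_iff_add_eq_0)
  have \<kappa>_eq_iff: "\<kappa> w = \<kappa> w' \<longleftrightarrow> w = w'" if "w \<in> D" "w' \<in> D" for w w'
    using inj_on_eq_iff[OF \<kappa>_inj that] .
  define coord :: "bool \<Rightarrow> 'k \<times> 'k \<Rightarrow> 'k" where "coord i = (if i then snd else fst)" for i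
  have coord_add: "coord i (p + q) = coord i p + coord i q" for i p q by (simp add: coord_def)
  have coord_zero: "coord i 0 = 0" for i by (simp add: coord_def)
  define \<alpha> where "\<alpha> x = (\<lambda>(y, i). if y \<in> carrier G then coord i (\<kappa> (comm x y)) else 0)" for x
  define V where "V = \<alpha> ` carrier G"
  have \<alpha>_eq_iff: "\<alpha> x = \<alpha> x' \<longleftrightarrow> (\<forall>y\<in>carrier G. comm x y = comm x' y)"
    if x: "x \<in> carrier G" "x' \<in> carrier G" for x x'
  proof
    assume eq: "\<alpha> x = \<alpha> x'"
    show "\<forall>y\<in>carrier G. comm x y = comm x' y"
    proof
      fix y assume y: "y \<in> carrier G"
      have "coord i (\<kappa> (comm x y)) = coord i (\<kappa> (comm x' y))" for i
        using fun_cong[OF eq, of "(y, i)"] y by (simp add: \<alpha>_def)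
      from this[of False] this[of True] have "\<kappa> (comm x y) = \<kappa> (comm x' y)"
        by (simp add: coord_def prod_eq_iff)
      then show "comm x y = comm x' y" using \<kappa>_eq_iff[OF comm_derived comm_derived] x y by simp
    qed
  qed (auto simp: \<alpha>_def)
  have \<alpha>_mult: "\<alpha> (x \<otimes> x') = \<alpha> x + \<alpha> x'" if "x \<in> carrier G" "x' \<in> carrier G" for x x'
    using that by (auto simp: \<alpha>_def fun_eq_iff comm_mult_left \<kappa>_mult comm_derived coord_add)
  have \<alpha>_one: "\<alpha> \<one> = 0" using \<alpha>_mult[of \<one> \<one>] by simp
  have \<alpha>_scale: "\<exists>x'\<in>carrier G. \<alpha> x' = scale_fun t (\<alpha> x)" if x: "x \<in> carrier G" for t x
  proof -
    obtain x' where x': "x' \<in> carrier G" "\<And>y. y \<in> carrier G \<Longrightarrow> comm x' y = \<sigma> t (comm x y)"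
      using scale_element[OF x] by blast
    have "\<alpha> x' = scale_fun t (\<alpha> x)"
      by (auto simp: \<alpha>_def scale_fun_def fun_eq_iff x' \<kappa>_\<sigma> comm_derived x coord_def)
    then show ?thesis using x'(1) by blast
  qed
  have subspace_V: "scale_fun.subspace V"
  proof (rule scale_fun.subspaceI)
    show "0 \<in> V" unfolding V_def using \<alpha>_one by (intro image_eqI[of _ _ \<one>]) simp_all
    fix u v assume "u \<in> V" "v \<in> V"
    then obtain x y where "x \<in> carrier G" "y \<in> carrier G" "u = \<alpha> x" "v = \<alpha> y" unfolding V_def by blast
    then show "u + v \<in> V" unfolding V_def by (intro image_eqI[of _ _ "x \<otimes> y"]) (simp_all add: \<alpha>_mult)
  next
    fix c u assume "u \<in> V"
    then obtain x where "x \<in> carrier G" "u = \<alpha> x" unfolding V_def by blast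
    then show "scale_fun c u \<in> V" unfolding V_def using \<alpha>_scale[of x c] by (metis image_eqI)
  qed
  define \<iota> where "\<iota> v = inv_into (carrier G) \<alpha> v" for v
  have \<iota>: "\<iota> v \<in> carrier G" "\<alpha> (\<iota> v) = v" if "v \<in> V" for v
    using that inv_into_into[of v \<alpha> "carrier G"] f_inv_into_f[of v \<alpha> "carrier G"] by (simp_all add: \<iota>_def V_def)
  obtain \<pi> where \<pi>_V: "\<And>u. \<pi> u \<in> V" and \<pi>_id: "\<And>u. u \<in> V \<Longrightarrow> \<pi> u = u"
    and \<pi>_add: "\<And>u v. \<pi> (u + v) = \<pi> u + \<pi> v" and \<pi>_scale: "\<And>c u. \<pi> (scale_fun c u) = scale_fun c (\<pi> u)"
    using exists_linear_projection[OF subspace_V] by blast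
  \<comment> \<open>Elements of \<open>V\<close> are functions, so pairing is evaluation:
    \<open>u\<close> is evaluated at a group element representing \<open>v\<close>. Linearity in
    \<open>v\<close> then comes from skew symmetry.\<close>
  define F where "F i u v = \<pi> u (\<iota> (\<pi> v), i)" for i u v
  have F: "F i (\<alpha> x) (\<alpha> y) = coord i (\<kappa> (comm x y))" if x: "x \<in> carrier G" and y: "y \<in> carrier G" for i x y
  proof -
    have yV: "\<alpha> y \<in> V" and xV: "\<alpha> x \<in> V" using x y by (simp_all add: V_def)
    have "comm (\<iota> (\<alpha> y)) x = comm y x" using \<alpha>_eq_iff[OF \<iota>(1)[OF yV] y] \<iota>(2)[OF yV] x by blast
    then have "comm x (\<iota> (\<alpha> y)) = comm x y"
      using comm_inverse[OF \<iota>(1)[OF yV] x] comm_inverse[OF y x] by simp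
    moreover have "F i (\<alpha> x) (\<alpha> y) = \<alpha> x (\<iota> (\<alpha> y), i)" unfolding F_def \<pi>_id[OF xV] \<pi>_id[OF yV] ..
    ultimately show ?thesis using \<iota>(1)[OF yV] by (simp add: \<alpha>_def)
  qed
  have F_\<pi>: "F i u v = F i (\<pi> u) (\<pi> v)" for i u v by (simp add: F_def \<pi>_id \<pi>_V)
  have V_E: "\<exists>x\<in>carrier G. \<pi> u = \<alpha> x" for u using \<pi>_V[of u] unfolding V_def by blast
  have F_skew: "F i u v = - F i v u" for i u v
  proof -
    obtain x y where xy: "x \<in> carrier G" "y \<in> carrier G" "\<pi> u = \<alpha> x" "\<pi> v = \<alpha> y" using V_E by metis
    have "F i u v = coord i (\<kappa> (comm x y))" using F_\<pi>[of i u v] F xy by simp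
    moreover have "F i v u = coord i (\<kappa> (comm y x))" using F_\<pi>[of i v u] F xy by simp
    ultimately show ?thesis
      using xy comm_inverse[of x y] \<kappa>_inv[OF comm_derived, of x y] by (simp add: coord_def)
  qed
  have form: "alternating_form scale_fun (F i)" for i
  proof (intro alternating_form.intro alternating_form_axioms.intro)
    show "vector_space (scale_fun :: 'k \<Rightarrow> _ \<Rightarrow> 'a \<times> bool \<Rightarrow> 'k)" by (rule scale_fun.vector_space_axioms)
    show add: "F i (x + y) z = F i x z + F i y z" for x y z by (simp add: F_def \<pi>_add)
    show scale: "F i (scale_fun c x) y = c * F i x y" for c x y
      unfolding F_def \<pi>_scale by (simp add: scale_fun_def)
    show "F i z (x + y) = F i z x + F i z y" for x y z
      using add[of x y z] F_skew[of i z] by simp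
    show "F i x (scale_fun c y) = c * F i x y" for c x y
      using scale[of c y x] F_skew[of i x] by simp
    show "F i x x = 0" for x
    proof -
      obtain g where "g \<in> carrier G" "\<pi> x = \<alpha> g" using V_E by blast
      then show ?thesis using F_\<pi>[of i x x] F[of g g i] by (simp add: comm_self \<kappa>_one coord_zero)
    qed
  qed
  define A where "A = F False"
  define B where "B = F True"
  have AB: "(A (\<alpha> x) (\<alpha> y), B (\<alpha> x) (\<alpha> y)) = \<kappa> (comm x y)" if "x \<in> carrier G" "y \<in> carrier G" for x y
    using that by (simp add: A_def B_def F coord_def)
  have nondeg: "u = 0" if u: "u \<in> V" and zero: "\<And>v. v \<in> V \<Longrightarrow> (A u v, B u v) = 0" for u
  proof -
    obtain x where x: "x \<in> carrier G" "u = \<alpha> x" using u unfolding V_def by blast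
    have "\<kappa> (comm x y) = 0" if y: "y \<in> carrier G" for y
      using AB[OF x(1) y] zero[of "\<alpha> y"] x y by (simp add: V_def)
    then show "u = 0" by (auto simp: x(2) \<alpha>_def fun_eq_iff coord_zero)
  qed
  have model: "faithful_bimap_model G V (\<lambda>x y. (A x y, B x y)) \<alpha> D \<kappa>"
  proof (intro faithful_bimap_model.intro bimap_model.intro bimap_model_axioms.intro
      faithful_bimap_model_axioms.intro is_group subgroup_D \<kappa>_inj)
    show "\<alpha> ` carrier G = V" by (simp add: V_def)
    show "\<alpha> z = 0" if z: "z \<in> D" for z
    proof -
      have "z \<in> group_center G" using z derived_central by blast
      then show ?thesis by (auto simp: \<alpha>_def fun_eq_iff comm_center \<kappa>_one coord_zero)
    qed
  qed (use AB \<kappa>_mult \<alpha>_mult comm_derived nondeg in simp_all)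
  have ind: "X = {0} \<or> Y = {0}"
    if X: "scale_fun.subspace X" and Y: "scale_fun.subspace Y" and XV: "X \<subseteq> V" and YV: "Y \<subseteq> V"
      and XY: "X \<inter> Y = {0}" and sum: "\<And>v. v \<in> V \<Longrightarrow> \<exists>x\<in>X. \<exists>y\<in>Y. v = x + y"
      and orth: "\<And>x y. x \<in> X \<Longrightarrow> y \<in> Y \<Longrightarrow> A x y = 0 \<and> B x y = 0" for X Y
  proof (rule ccontr)
    assume neg: "\<not> (X = {0} \<or> Y = {0})"
    \<comment> \<open>Preimages of orthogonal summands commute elementwise, and they generate
      \<open>G\<close> because the summands span \<open>V\<close>.\<close>
    define P where "P S = {x \<in> carrier G. \<alpha> x \<in> S}" for S
    have sub: "subgroup (P S) G" if S: "scale_fun.subspace S" for S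
    proof (rule subgroupI)
      show "P S \<noteq> {}" using \<alpha>_one scale_fun.subspace_0[OF S] by (auto simp: P_def)
      show "inv a \<in> P S" if a: "a \<in> P S" for a
      proof -
        have "\<alpha> (inv a) + \<alpha> a = 0" using a \<alpha>_mult[of "inv a" a] by (simp add: P_def \<alpha>_one)
        then have "\<alpha> (inv a) = - \<alpha> a" by (simp add: eq_neg_iff_add_eq_0)
        then show ?thesis using a scale_fun.subspace_neg[OF S, of "\<alpha> a"] by (simp add: P_def)
      qed
    qed (auto simp: P_def \<alpha>_mult scale_fun.subspace_add[OF S])
    have gen: "generate G (P S) = P S" if S: "scale_fun.subspace S" for S
      using generate_subgroup_incl[OF subset_refl sub[OF S]] generate.incl[of _ "P S" G] by blast
    \<comment> \<open>A central decomposition is a set of subgroups: if the two coincided, removing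
      one would remove both.\<close>
    have ne: "P X \<noteq> P Y"
    proof
      assume eq: "P X = P Y"
      have "X \<subseteq> Y"
      proof
        fix u assume u: "u \<in> X"
        then obtain x where "x \<in> carrier G" "u = \<alpha> x" using XV unfolding V_def by blast
        then have "x \<in> P Y" using u eq[symmetric] by (simp add: P_def)
        then show "u \<in> Y" using \<open>u = \<alpha> x\<close> by (simp add: P_def)
      qed
      then show False using XY neg by auto
    qed
    have proper: "carrier G \<noteq> P S" if S: "S \<subseteq> V" "S \<inter> S' = {0}" "S' \<subseteq> V" "S' \<noteq> {0}" "0 \<in> S'" for S S'
    proof
      assume eq: "carrier G = P S"
      obtain u where u: "u \<in> S'" "u \<noteq> 0" using S(4,5) by blast
      then have "u \<in> V" using S(3) by blast
      then obtain x where x: "u = \<alpha> x" "x \<in> carrier G" unfolding V_def by (rule imageE)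
      then have "x \<in> P S" using eq by simp
      then have "u \<in> S" unfolding P_def x by simp
      then show False using u S(2) by blast
    qed
    have pX: "carrier G \<noteq> P X" using proper[OF XV XY YV] neg scale_fun.subspace_0[OF Y] by blast
    have pY: "carrier G \<noteq> P Y"
      using proper[OF YV _ XV] XY neg scale_fun.subspace_0[OF X] by blast
    have comm1: "comm x y = \<one>" if x: "x \<in> P X" and y: "y \<in> P Y" for x y
    proof -
      have "\<kappa> (comm x y) = \<kappa> \<one>" using AB[of x y] orth[of "\<alpha> x" "\<alpha> y"] x y by (simp add: P_def \<kappa>_one zero_prod_def)
      then show ?thesis using \<kappa>_eq_iff[OF comm_derived D_one, of x y] x y by (simp add: P_def)
    qed
    have comm2: "comm y x = \<one>" if x: "x \<in> P X" and y: "y \<in> P Y" for x y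
      using comm1[OF x y] comm_inverse[of x y] x y by (simp add: P_def)
    have generates: "generate G (P X \<union> P Y) = carrier G"
    proof
      show "generate G (P X \<union> P Y) \<subseteq> carrier G" by (rule generate_incl) (auto simp: P_def)
      show "carrier G \<subseteq> generate G (P X \<union> P Y)"
      proof
        fix g assume g: "g \<in> carrier G"
        then obtain u v where uv: "u \<in> X" "v \<in> Y" "\<alpha> g = u + v" using sum[of "\<alpha> g"] unfolding V_def by blast
        obtain x where x: "x \<in> carrier G" "u = \<alpha> x" using uv XV unfolding V_def by blast
        have "\<alpha> (inv x \<otimes> g) = v"
        proof -
          have "\<alpha> (inv x) + \<alpha> x = 0" using x \<alpha>_mult[of "inv x" x] by (simp add: \<alpha>_one)
          then have "\<alpha> (inv x) = - u" by (simp add: eq_neg_iff_add_eq_0 x)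
          then show ?thesis using x g uv by (simp add: \<alpha>_mult)
        qed
        then have "x \<in> P X" "inv x \<otimes> g \<in> P Y" using x g uv by (simp_all add: P_def)
        then have "x \<otimes> (inv x \<otimes> g) \<in> generate G (P X \<union> P Y)" by (intro generate.eng generate.incl) auto
        moreover have "x \<otimes> (inv x \<otimes> g) = g" using x g by (simp flip: m_assoc)
        ultimately show "g \<in> generate G (P X \<union> P Y)" by simp
      qed
    qed
    have "central_decomposition G {P X, P Y}"
    proof -
      have "{P X, P Y} - {P X} = {P Y}" "{P X, P Y} - {P Y} = {P X}" using ne by auto
      then show ?thesis
        unfolding central_decomposition_def
        using sub[OF X] sub[OF Y] generates pX pY comm1 comm2 by (simp add: gen[OF X] gen[OF Y])
    qed
    then have "{P X, P Y} = {carrier G}"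
      by (rule centrally_indecomposable[unfolded centrally_indecomposable_def, THEN spec, THEN iffD1])
    then have "P X \<in> {carrier G}" by (metis insertI1)
    then show False using pX by simp
  qed
  \<comment> \<open>A relation between the forms annihilates all commutators, hence the subgroup
    they generate; but \<open>\<kappa>\<close> maps that subgroup onto
    \<open>k \<times> k\<close>.\<close>
  have zero_if_vanish: "s = 0 \<and> t = 0"
    if van: "\<And>x y. x \<in> V \<Longrightarrow> y \<in> V \<Longrightarrow> s * A x y + t * B x y = 0" for s t
  proof -
    interpret M: faithful_bimap_model G V "\<lambda>x y. (A x y, B x y)" \<alpha> D \<kappa> by (rule model)
    have all: "s * fst (\<kappa> w) + t * snd (\<kappa> w) = 0" if "w \<in> D" for w
      using that
    proof (induction rule: M.derived_induct)
      case (commutator x y)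
      then have "\<alpha> x \<in> V" "\<alpha> y \<in> V" by (simp_all add: V_def)
      from van[OF this] show ?case using AB[OF commutator, symmetric] by simp
    next
      case (mult z z')
      then show ?case by (simp add: \<kappa>_mult algebra_simps)
    next
      case (inv z)
      then show ?case by (simp add: \<kappa>_inv neg_eq_iff_add_eq_0)
    qed
    obtain w where w: "w \<in> D" "\<kappa> w = (1, 0)" using \<kappa>_surj by (metis UNIV_I imageE)
    obtain w' where w': "w' \<in> D" "\<kappa> w' = (0, 1)" using \<kappa>_surj by (metis UNIV_I imageE)
    show ?thesis using all[OF w(1)] all[OF w'(1)] w w' by simp
  qed
  have pencil: "indecomposable_pencil scale_fun A B V"
  proof (intro indecomposable_pencil.intro indecomposable_pencil_axioms.intro)
    show "vector_space (scale_fun :: 'k \<Rightarrow> _ \<Rightarrow> 'a \<times> bool \<Rightarrow> 'k)" by (rule scale_fun.vector_space_axioms)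
    show "alternating_form scale_fun A" "alternating_form scale_fun B" unfolding A_def B_def by (rule form)+
    show "scale_fun.subspace V" by (rule subspace_V)
    show "finite V" using finite_carrier by (simp add: V_def)
    show "x = 0" if "x \<in> V" "\<And>y. y \<in> V \<Longrightarrow> A x y = 0" "\<And>y. y \<in> V \<Longrightarrow> B x y = 0" for x
      by (rule nondeg[OF that(1)]) (simp add: that zero_prod_def)
  qed (rule ind)
  have "V \<noteq> {0}"
  proof
    assume V: "V = {0}"
    have "(1 :: 'k) = 0 \<and> (1 :: 'k) = 0"
    proof (rule zero_if_vanish)
      fix x y assume "x \<in> V" "y \<in> V"
      then have "x = 0" using V by blast
      then show "1 * A x y + 1 * B x y = 0"
        by (simp add: A_def B_def alternating_form.zero_left[OF form])
    qed
    then show False by simp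
  qed
  moreover have "\<forall>s t. (\<forall>x\<in>V. \<forall>y\<in>V. s * A x y + t * B x y = 0) \<longrightarrow> s = 0 \<and> t = 0"
    using zero_if_vanish by blast
  ultimately show ?thesis using that pencil model by blast
qed

end

section \<open>Assembling the cases\<close>

lemma (in indecomposable_pencil) pencil_cases:
  obtains "regular_pencil scale A B V" | "regular_pencil scale B A V"
  | v m where "minimal_kernel_chain scale A B V v m"
  | "V = {0}"
proof (cases "V = {0}")
  case nontrivial: False
  show ?thesis
  proof (cases "\<exists>n v. kernel_chain v \<and> (\<forall>i\<ge>n. v i = 0) \<and> (\<exists>i. v i \<noteq> 0)")
    case True
    \<comment> \<open>\<open>n\<close> bounds the number of terms of a shortest polynomial kernel
      vector, so its degree is \<open>n - 1\<close>, called \<open>m\<close> below.\<close>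
    define n where "n = (LEAST n. \<exists>v. kernel_chain v \<and> (\<forall>i\<ge>n. v i = 0) \<and> (\<exists>i. v i \<noteq> 0))"
    have "\<exists>v. kernel_chain v \<and> (\<forall>i\<ge>n. v i = 0) \<and> (\<exists>i. v i \<noteq> 0)"
      unfolding n_def using True by (rule LeastI_ex)
    then obtain v where v: "kernel_chain v" "\<forall>i\<ge>n. v i = 0" "\<exists>i. v i \<noteq> 0" by blast
    have "n \<noteq> 0" using v(2,3) by auto
    then obtain m where m: "n = Suc m" using not0_implies_Suc by blast
    have min: "w i = 0" if w: "kernel_chain w" "\<And>i. i \<ge> m \<Longrightarrow> w i = 0" for w i
    proof (rule ccontr)
      assume "w i \<noteq> 0"
      then have "n \<le> m" unfolding n_def using w by (intro Least_le) blast
      then show False using m by simp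
    qed
    have "minimal_kernel_chain scale A B V v m"
      by (intro minimal_kernel_chain.intro minimal_kernel_chain_axioms.intro indecomposable_pencil_axioms)
        (use v m min in auto)
    then show ?thesis by (rule that(3))
  next
    case False
    then have "\<And>v n. kernel_chain v \<Longrightarrow> (\<forall>i\<ge>n. v i = 0) \<Longrightarrow> \<forall>i. v i = 0" by blast
    from regular_or_singular[OF this] show ?thesis
    proof
      assume "\<forall>x\<in>V. (\<forall>z\<in>V. A x z = 0) \<longrightarrow> x = 0"
      then have "regular_pencil scale A B V"
        using nontrivial by (intro regular_pencil.intro regular_pencil_axioms.intro indecomposable_pencil_axioms) blast+
      then show ?thesis by (rule that(1))
    next
      assume "\<forall>x\<in>V. (\<forall>z\<in>V. B x z = 0) \<longrightarrow> x = 0"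
      then have "regular_pencil scale B A V"
        using nontrivial by (intro regular_pencil.intro regular_pencil_axioms.intro swap) blast+
      then show ?thesis by (rule that(2))
    qed
  qed
qed (rule that(4))

text \<open>When only \<open>B\<close> is nondegenerate the forms trade places, which amounts to
  exchanging the two coordinates of the derived subgroup.\<close>

lemma faithful_model_swap:
  assumes "faithful_bimap_model H U (\<lambda>x y. (A x y, B x y)) \<alpha> Z \<omega>"
  shows "faithful_bimap_model H U (\<lambda>x y. (B x y, A x y)) \<alpha> Z (\<lambda>z. prod.swap (\<omega> z))"
proof -
  interpret faithful_bimap_model H U "\<lambda>x y. (A x y, B x y)" \<alpha> Z \<omega> by fact
  show ?thesis
  proof (intro faithful_bimap_model.intro bimap_model.intro bimap_model_axioms.intro
      faithful_bimap_model_axioms.intro is_group subgroup_Z \<alpha>_image)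
    show "inj_on (\<lambda>z. prod.swap (\<omega> z)) Z"
      by (rule inj_onI) (metis inj_onD[OF \<omega>_inj] swap_swap)
    show "u = 0" if "u \<in> U" "\<And>v. v \<in> U \<Longrightarrow> (B u v, A u v) = 0" for u
      using b_nondegenerate[OF that(1)] that(2) by (simp add: zero_prod_def)
  qed (simp_all add: \<alpha>_mult commutator_Z \<alpha>_Z \<omega>_mult \<omega>_commutator plus_prod_def)
qed

text \<open>Nondegeneracy is a property of \<open>U\<close> and \<open>b\<close> alone, so it is
  inherited from the model of \<open>G\<close>.\<close>

lemma faithful_modelI:
  assumes "bimap_model H U b \<beta> Y \<eta>" "inj_on \<eta> Y" "faithful_bimap_model G U b \<alpha> Z \<omega>"
  shows "faithful_bimap_model H U b \<beta> Y \<eta>"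
  using assms unfolding faithful_bimap_model_def faithful_bimap_model_axioms_def by blast

lemma (in regular_pencil) isoclinic_heisenberg:
  assumes G: "faithful_bimap_model G V (\<lambda>x y. (A x y, B x y)) \<alpha> Z \<omega>"
    and "\<forall>s t. (\<forall>x\<in>V. \<forall>y\<in>V. s * A x y + t * B x y = 0) \<longrightarrow> s = 0 \<and> t = 0"
  shows "\<exists>(a :: 'a poly) c L. Factorial_Ring.irreducible a \<and> c > 0 \<and>
    vectorspace.dim class_ring (heisenberg_derived_space a c) = c * Polynomial.degree a \<and>
    has_codim class_ring L (heisenberg_derived_space a c) 2 \<and>
    isoclinic G (heisenberg_group (quotient_ring a c) Mod L)"
proof -
  obtain a :: "'a poly" and c L \<alpha>' Z' \<omega>' where *: "Factorial_Ring.irreducible a" "c > 0"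
      "vectorspace.dim class_ring (heisenberg_derived_space a c) = c * Polynomial.degree a"
      "has_codim class_ring L (heisenberg_derived_space a c) 2"
    and H: "bimap_model (heisenberg_group (quotient_ring a c) Mod L) V (\<lambda>x y. (A x y, B x y)) \<alpha>' Z' \<omega>'"
      "inj_on \<omega>' Z'"
    using heisenberg_model[OF assms(2)] by (elim exE conjE) (rule that)
  have "isoclinic G (heisenberg_group (quotient_ring a c) Mod L)"
    by (rule faithful_models_isoclinic[OF G faithful_modelI[OF H G]])
  with * show ?thesis by blast
qed

lemma (in minimal_kernel_chain) isoclinic_flat:
  assumes G: "faithful_bimap_model G V (\<lambda>x y. (A x y, B x y)) \<alpha> Z \<omega>"
  shows "isoclinic G (flat_group TYPE('a) m)"
proof -
  obtain \<alpha>' Z' \<omega>' where H: "bimap_model (flat_group TYPE('a) m) V (\<lambda>x y. (A x y, B x y)) \<alpha>' Z' \<omega>'"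
      "inj_on \<omega>' Z'"
    using flat_model by (elim exE conjE) (rule that)
  show ?thesis by (rule faithful_models_isoclinic[OF G faithful_modelI[OF H G]])
qed

theorem theorem1p2:
  fixes G :: "('a, 'b) monoid_scheme" and p :: nat
  assumes "has_genus p (class_ring :: 'k :: field ring) 2 G"
    and "centrally_indecomposable G"
  shows "(\<exists>(a :: 'k poly) c L.
            Factorial_Ring.irreducible a \<and> c > 0 \<and>
            vectorspace.dim class_ring (heisenberg_derived_space a c) = c * Polynomial.degree a \<and>
            has_codim class_ring L (heisenberg_derived_space a c) 2 \<and>
            isoclinic G (heisenberg_group (quotient_ring a c) Mod L)) \<or>
         (\<exists>m > 0. isoclinic G (flat_group TYPE('k) m))"
proof -
  obtain \<phi> where \<phi>: "\<phi> \<in> ring_iso (class_ring :: 'k ring) (group_centroid G)"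
      "vectorspace.dim class_ring (derived_space G \<phi>) = 2"
    and G: "group G" "finite (carrier G)" "derived G (carrier G) \<subseteq> group_center G"
    using assms(1) unfolding has_genus_def p_group_def nilpotence_class_two_def by blast
  interpret genus_two_group G \<phi>
    by (intro genus_two_group.intro class_two_group.intro class_two_group_axioms.intro
        genus_two_group_axioms.intro G \<phi> assms(2))
  obtain A B :: "('a \<times> bool \<Rightarrow> 'k) \<Rightarrow> ('a \<times> bool \<Rightarrow> 'k) \<Rightarrow> 'k" and V \<alpha> Z \<omega>
    where pencil: "indecomposable_pencil scale_fun A B V" and V: "V \<noteq> {0}"
    and model: "faithful_bimap_model G V (\<lambda>x y. (A x y, B x y)) \<alpha> Z \<omega>"
    and independent: "\<forall>s t. (\<forall>x\<in>V. \<forall>y\<in>V. s * A x y + t * B x y = 0) \<longrightarrow> s = 0 \<and> t = 0"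
    by (rule pencil_model) (rule that)
  show ?thesis
  proof (rule indecomposable_pencil.pencil_cases[OF pencil])
    assume A: "regular_pencil scale_fun A B V"
    from regular_pencil.isoclinic_heisenberg[OF A model independent] show ?thesis by (rule disjI1)
  next
    assume B: "regular_pencil scale_fun B A V"
    have "\<forall>s t. (\<forall>x\<in>V. \<forall>y\<in>V. s * B x y + t * A x y = 0) \<longrightarrow> s = 0 \<and> t = 0"
      using independent by (metis add.commute)
    from regular_pencil.isoclinic_heisenberg[OF B faithful_model_swap[OF model] this]
    show ?thesis by (rule disjI1)
  next
    fix v m assume chain: "minimal_kernel_chain scale_fun A B V v m"
    show ?thesis
      using minimal_kernel_chain.isoclinic_flat[OF chain model] minimal_kernel_chain.m_pos[OF chain]
      by (intro disjI2 exI[of _ m] conjI)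
  qed (use V in simp)
qed

end
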